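(* Let $G$ be a group, let $k$ be a commutative $G$-ring, let $n$ be a natural number and let $\varepsilon\in k$ be invertible. Let $GB\mathcal{R}_n(\varepsilon)$ be the $G$-braided rook algebra over $k$, and let $G^n\rtimes B_n$ be the semi-direct product in which the braid group $B_n$ acts on $G^n$ by permuting the factors. Then there exists an isomorphism of graded $k$-modules $$\mathrm{Tor}_{\star}^{GB\mathcal{R}_n(\varepsilon)}(\mathbf{1},\mathbf{1})\cong \mathrm{Tor}_{\star}^{k[G^n\rtimes B_n]}(\mathbf{1},\mathbf{1})=H_{\star}(G^n\rtimes B_n,k).$$
   Context: A commutative $G$-ring is a unital commutative ring $k$ together with a group homomorphism $G\to\mathrm{Aut}(k)$ to the group of ring automorphisms of $k$. A $G$-braided rook $n$-diagram consists of two columns (left and right) of $n$ nodes and a set of disjoint strands, each joining a left node to a right node, such that each node is the endpoint of at most one strand (nodes may be unconnected; there are no left-to-left and no right-to-right connections), and each strand is labelled by an element of $G$. Whenever two strands cross, the crossing is an over-crossing or an under-crossing. Strands run as in a braid, and diagrams are considered up to isotopy fixing endpoints, as for (partial) braids. The $G$-braided rook algebra $GB\mathcal{R}_n(\varepsilon)$ consists of formal $k$-linear combinations of such diagrams. The product $x\cdot y$ of two diagrams is the $k$-bilinear extension of: identify the right-hand nodes of $x$ with the left-hand nodes of $y$, forget the middle nodes, label each strand formed by concatenation with the product of the group elements read from left to right, and multiply by a factor $\varepsilon$ for each contractible component lying entirely in the middle, i.e. for each middle node attached to no strand of $x$ and no strand of $y$. A strand which reaches the middle column and is not continued is discarded without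 a factor, leaving its outer node unconnected. The trivial module $\mathbf{1}$ of $GB\mathcal{R}_n(\varepsilon)$ is a copy of $k$ (as a left and as a right module) on which diagrams with no missing edges act as $1$ and all other diagrams act as $0$. For the (untwisted) group algebra $k[G^n\rtimes B_n]$, $\mathbf{1}$ is $k$ with every group element acting as $1$. *)

theory Defs
  imports
    "HOL-Analysis.Analysis"
    "HOL-Algebra.Bij"
    "HOL-Algebra.QuotRing"
    "HOL-Algebra.Product_Groups"
    "HOL-Algebra.Module"
    "HOL-Library.FSet"
begin

section \<open>Commutative G-rings\<close>

definition ring_auto_group :: "('k, 'z) ring_scheme \<Rightarrow> ('k \<Rightarrow> 'k) monoid" where
  "ring_auto_group k =
     (BijGroup (carrier k)) \<lparr>carrier := ring_iso k k \<inter> extensional (carrier k)\<rparr>"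

definition comm_G_ring ::
    "('g, 'y) monoid_scheme \<Rightarrow> ('k, 'z) ring_scheme \<Rightarrow> ('g \<Rightarrow> 'k \<Rightarrow> 'k) \<Rightarrow> bool" where
  "comm_G_ring G k \<phi> \<longleftrightarrow> cring k \<and> \<phi> \<in> hom G (ring_auto_group k)"

section \<open>Modules over possibly noncommutative rings\<close>

text \<open>
  The locale \<^locale>\<open>module\<close> of the library presupposes a commutative ring of scalars; only the
  record type is reused for one-sided modules over a noncommutative ring \<open>A\<close>. If \<open>M\<close> is meant as a
  right module, \<open>a \<odot>\<^bsub>M\<^esub> m\<close> stands for the right action of \<open>a\<close> on \<open>m\<close>. The fields \<open>mult\<close> and
  \<open>one\<close> of a module carry no information and are \<open>undefined\<close>.
  A \<open>k\<close>-algebra is a record whose ring operations are those of the algebra and whose scalar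
  multiplication is that of \<open>k\<close>.
\<close>

definition fin_supp :: "('a, 'z) ring_scheme \<Rightarrow> 's set \<Rightarrow> ('s \<Rightarrow> 'a) set" where
  "fin_supp A S =
     {f. (\<forall>s\<in>S. f s \<in> carrier A) \<and> (\<forall>s. s \<notin> S \<longrightarrow> f s = \<zero>\<^bsub>A\<^esub>) \<and> finite {s. f s \<noteq> \<zero>\<^bsub>A\<^esub>}}"

definition delta :: "('a, 'z) ring_scheme \<Rightarrow> 's \<Rightarrow> 's \<Rightarrow> 'a" where
  "delta A s = (\<lambda>t. if t = s then \<one>\<^bsub>A\<^esub> else \<zero>\<^bsub>A\<^esub>)"

text \<open>The free right \<open>A\<close>-module on \<open>S\<close>; for commutative \<open>A\<close> it is also the free left module.\<close>

definition free_module :: "('a, 'z) ring_scheme \<Rightarrow> 's set \<Rightarrow> ('a, 's \<Rightarrow> 'a) module" where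
  "free_module A S =
     \<lparr>carrier = fin_supp A S, mult = undefined, one = undefined,
      zero = (\<lambda>_. \<zero>\<^bsub>A\<^esub>), add = (\<lambda>f g s. f s \<oplus>\<^bsub>A\<^esub> g s),
      smult = (\<lambda>a f s. f s \<otimes>\<^bsub>A\<^esub> a)\<rparr>"

text \<open>The linear extension of a map \<open>f\<close> between bases.\<close>

definition free_map :: "('k, 'z) ring_scheme \<Rightarrow> ('s \<Rightarrow> 't) \<Rightarrow> ('s \<Rightarrow> 'k) \<Rightarrow> 't \<Rightarrow> 'k" where
  "free_map k f u = (\<lambda>t. \<Oplus>\<^bsub>k\<^esub>s\<in>{s. u s \<noteq> \<zero>\<^bsub>k\<^esub> \<and> f s = t}. u s)"

definition submodule_span ::
    "('k, 'z) ring_scheme \<Rightarrow> ('k, 'm, 'y) module_scheme \<Rightarrow> 'm set \<Rightarrow> 'm set" where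
  "submodule_span k M X = \<Inter>{H. submodule H k M \<and> X \<subseteq> H}"

definition quotient_module ::
    "('k, 'm, 'y) module_scheme \<Rightarrow> 'm set \<Rightarrow> ('k, 'm set) module" where
  "quotient_module M H =
     \<lparr>carrier = a_rcosets\<^bsub>M\<^esub> H, mult = undefined, one = undefined,
      zero = H, add = (\<lambda>X Y. X <+>\<^bsub>M\<^esub> Y),
      smult = (\<lambda>c X. \<Union>x\<in>X. H +>\<^bsub>M\<^esub> (c \<odot>\<^bsub>M\<^esub> x))\<rparr>"

definition module_iso ::
    "('k, 'z) ring_scheme \<Rightarrow> ('k, 'm, 'x) module_scheme \<Rightarrow> ('k, 'n, 'y) module_scheme
      \<Rightarrow> ('m \<Rightarrow> 'n) set" where
  "module_iso k M N =
     {h. bij_betw h (carrier M) (carrier N) \<and>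
         (\<forall>x\<in>carrier M. \<forall>y\<in>carrier M. h (x \<oplus>\<^bsub>M\<^esub> y) = h x \<oplus>\<^bsub>N\<^esub> h y) \<and>
         (\<forall>c\<in>carrier k. \<forall>x\<in>carrier M. h (c \<odot>\<^bsub>M\<^esub> x) = c \<odot>\<^bsub>N\<^esub> h x)}"

definition graded_isomorphic ::
    "('k, 'z) ring_scheme \<Rightarrow> (nat \<Rightarrow> ('k, 'm) module) \<Rightarrow> (nat \<Rightarrow> ('k, 'n) module) \<Rightarrow> bool" where
  "graded_isomorphic k C D \<longleftrightarrow> (\<exists>h. \<forall>i. h i \<in> module_iso k (C i) (D i))"

section \<open>Homology of chain complexes\<close>

text \<open>Here \<open>d i\<close> is the differential from degree \<open>Suc i\<close> to degree \<open>i\<close>.\<close>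

definition cycles ::
    "(nat \<Rightarrow> ('k, 'm) module) \<Rightarrow> (nat \<Rightarrow> 'm \<Rightarrow> 'm) \<Rightarrow> nat \<Rightarrow> 'm set" where
  "cycles C d i =
     (case i of 0 \<Rightarrow> carrier (C 0) | Suc j \<Rightarrow> {x \<in> carrier (C (Suc j)). d j x = \<zero>\<^bsub>C j\<^esub>})"

definition homology ::
    "(nat \<Rightarrow> ('k, 'm) module) \<Rightarrow> (nat \<Rightarrow> 'm \<Rightarrow> 'm) \<Rightarrow> nat \<Rightarrow> ('k, 'm set) module" where
  "homology C d i =
     quotient_module ((C i)\<lparr>carrier := cycles C d i\<rparr>) (d i ` carrier (C (Suc i)))"

section \<open>Tensor products\<close>

text \<open>
  Let \<open>A\<close> be a \<open>k\<close>-algebra, \<open>M\<close> a right and \<open>N\<close> a left \<open>A\<close>-module. The tensor product over \<open>A\<close> is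
  a \<open>k\<close>-module by letting \<open>c\<close> act through \<open>c \<odot> 1\<close>, which is central in \<open>A\<close>. The last family of
  relations says exactly this; in its presence the free \<open>k\<close>-module and the free abelian group on
  the pairs have the same quotient.
\<close>

definition tensor_pairs ::
    "('k, 'z) ring_scheme \<Rightarrow> ('a, 'm) module \<Rightarrow> ('a, 'n) module \<Rightarrow> ('k, 'm \<times> 'n \<Rightarrow> 'k) module" where
  "tensor_pairs k M N = free_module k (carrier M \<times> carrier N)"

definition tensor_relators ::
    "('k, 'z) ring_scheme \<Rightarrow> ('k, 'a) module \<Rightarrow> ('a, 'm) module \<Rightarrow> ('a, 'n) module
      \<Rightarrow> ('m \<times> 'n \<Rightarrow> 'k) set" where
  "tensor_relators k A M N =
     (let F = tensor_pairs k M N; e = (\<lambda>m n. delta k (m, n)) in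
       {e (m \<oplus>\<^bsub>M\<^esub> m') n \<ominus>\<^bsub>F\<^esub> (e m n \<oplus>\<^bsub>F\<^esub> e m' n) | m m' n.
          m \<in> carrier M \<and> m' \<in> carrier M \<and> n \<in> carrier N} \<union>
       {e m (n \<oplus>\<^bsub>N\<^esub> n') \<ominus>\<^bsub>F\<^esub> (e m n \<oplus>\<^bsub>F\<^esub> e m n') | m n n'.
          m \<in> carrier M \<and> n \<in> carrier N \<and> n' \<in> carrier N} \<union>
       {e (a \<odot>\<^bsub>M\<^esub> m) n \<ominus>\<^bsub>F\<^esub> e m (a \<odot>\<^bsub>N\<^esub> n) | a m n.
          a \<in> carrier A \<and> m \<in> carrier M \<and> n \<in> carrier N} \<union>
       {c \<odot>\<^bsub>F\<^esub> e m n \<ominus>\<^bsub>F\<^esub> e ((c \<odot>\<^bsub>A\<^esub> \<one>\<^bsub>A\<^esub>) \<odot>\<^bsub>M\<^esub> m) n | c m n.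
          c \<in> carrier k \<and> m \<in> carrier M \<and> n \<in> carrier N})"

definition tensor_kernel ::
    "('k, 'z) ring_scheme \<Rightarrow> ('k, 'a) module \<Rightarrow> ('a, 'm) module \<Rightarrow> ('a, 'n) module
      \<Rightarrow> ('m \<times> 'n \<Rightarrow> 'k) set" where
  "tensor_kernel k A M N = submodule_span k (tensor_pairs k M N) (tensor_relators k A M N)"

definition tensor ::
    "('k, 'z) ring_scheme \<Rightarrow> ('k, 'a) module \<Rightarrow> ('a, 'm) module \<Rightarrow> ('a, 'n) module
      \<Rightarrow> ('k, ('m \<times> 'n \<Rightarrow> 'k) set) module" where
  "tensor k A M N = quotient_module (tensor_pairs k M N) (tensor_kernel k A M N)"

text \<open>For an \<open>A\<close>-linear map \<open>f\<close> with target \<open>M\<close>, the map \<open>f \<otimes> id\<close> with target \<open>M \<otimes> N\<close>.\<close>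

definition tensor_map ::
    "('k, 'z) ring_scheme \<Rightarrow> ('k, 'a) module \<Rightarrow> ('a, 'm) module \<Rightarrow> ('a, 'n) module
      \<Rightarrow> ('l \<Rightarrow> 'm) \<Rightarrow> ('l \<times> 'n \<Rightarrow> 'k) set \<Rightarrow> ('m \<times> 'n \<Rightarrow> 'k) set" where
  "tensor_map k A M N f X =
     (\<Union>u\<in>X. tensor_kernel k A M N +>\<^bsub>tensor_pairs k M N\<^esub> free_map k (map_prod f id) u)"

section \<open>The standard free resolution and Tor\<close>

text \<open>
  The standard free resolution of a right \<open>A\<close>-module \<open>M\<close>: the module in degree \<open>0\<close> is free on the
  set \<open>M\<close>, and the module in degree \<open>Suc i\<close> is free on the underlying set of the kernel of the map
  leaving degree \<open>i\<close>. To keep all degrees in a single type, the basis elements belong to a datatype: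
  \<open>Gen m\<close> is the basis element of degree \<open>0\<close> given by \<open>m\<close>, and \<open>Syz X\<close> is the one given by the
  finitely supported function \<open>f\<close> on basis elements of the degree below with finite graph
  \<open>X = {(s, f s) | f s \<noteq> 0}\<close>.
\<close>

datatype ('a, 'm) res_basis = Gen 'm | Syz "(('a, 'm) res_basis \<times> 'a) fset"

definition syz ::
    "('a, 'z) ring_scheme \<Rightarrow> (('a, 'm) res_basis \<Rightarrow> 'a) \<Rightarrow> ('a, 'm) res_basis" where
  "syz A f = Syz (Abs_fset {(s, f s) | s. f s \<noteq> \<zero>\<^bsub>A\<^esub>})"

fun syz_fun ::
    "('a, 'z) ring_scheme \<Rightarrow> ('a, 'm) res_basis \<Rightarrow> ('a, 'm) res_basis \<Rightarrow> 'a" where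
  "syz_fun A (Syz X) t = (if \<exists>a. (t, a) \<in> fset X then THE a. (t, a) \<in> fset X else \<zero>\<^bsub>A\<^esub>)"
| "syz_fun A (Gen m) t = \<zero>\<^bsub>A\<^esub>"

definition res_augment ::
    "('a, 'z) ring_scheme \<Rightarrow> ('a, 'm) module \<Rightarrow> (('a, 'm) res_basis \<Rightarrow> 'a) \<Rightarrow> 'm" where
  "res_augment A M f = (\<Oplus>\<^bsub>M\<^esub>m\<in>{m. f (Gen m) \<noteq> \<zero>\<^bsub>A\<^esub>}. f (Gen m) \<odot>\<^bsub>M\<^esub> m)"

definition res_diff ::
    "('a, 'z) ring_scheme \<Rightarrow> (('a, 'm) res_basis \<Rightarrow> 'a) \<Rightarrow> ('a, 'm) res_basis \<Rightarrow> 'a" where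
  "res_diff A f = (\<lambda>t. \<Oplus>\<^bsub>A\<^esub>s\<in>{s. f s \<noteq> \<zero>\<^bsub>A\<^esub>}. syz_fun A s t \<otimes>\<^bsub>A\<^esub> f s)"

fun res_gens ::
    "('a, 'z) ring_scheme \<Rightarrow> ('a, 'm) module \<Rightarrow> nat \<Rightarrow> ('a, 'm) res_basis set" where
  "res_gens A M 0 = Gen ` carrier M"
| "res_gens A M (Suc 0) =
     syz A ` {f \<in> fin_supp A (res_gens A M 0). res_augment A M f = \<zero>\<^bsub>M\<^esub>}"
| "res_gens A M (Suc (Suc i)) =
     syz A ` {f \<in> fin_supp A (res_gens A M (Suc i)). res_diff A f = (\<lambda>_. \<zero>\<^bsub>A\<^esub>)}"

definition std_resolution ::
    "('a, 'z) ring_scheme \<Rightarrow> ('a, 'm) module \<Rightarrow> nat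
      \<Rightarrow> ('a, ('a, 'm) res_basis \<Rightarrow> 'a) module" where
  "std_resolution A M i = free_module A (res_gens A M i)"

definition Tor ::
    "('k, 'z) ring_scheme \<Rightarrow> ('k, 'a) module \<Rightarrow> ('a, 'm) module \<Rightarrow> ('a, 'n) module \<Rightarrow> nat
      \<Rightarrow> ('k, ((('a, 'm) res_basis \<Rightarrow> 'a) \<times> 'n \<Rightarrow> 'k) set set) module" where
  "Tor k A M N =
     homology (\<lambda>i. tensor k A (std_resolution A M i) N)
              (\<lambda>i. tensor_map k A (std_resolution A M i) N (res_diff A))"

section \<open>Algebras with a basis closed under products up to scalars\<close>

text \<open>
  The free \<open>k\<close>-module on \<open>D\<close> with the \<open>k\<close>-bilinear product that sends \<open>(x, y)\<close> to
  \<open>w x y\<close> times \<open>mul x y\<close>, and with unit \<open>e\<close>.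
\<close>

definition basis_algebra ::
    "('k, 'z) ring_scheme \<Rightarrow> 'd set \<Rightarrow> ('d \<Rightarrow> 'd \<Rightarrow> 'd) \<Rightarrow> ('d \<Rightarrow> 'd \<Rightarrow> 'k) \<Rightarrow> 'd
      \<Rightarrow> ('k, 'd \<Rightarrow> 'k) module" where
  "basis_algebra k D mul w e =
     \<lparr>carrier = fin_supp k D,
      mult = (\<lambda>f g d.
        \<Oplus>\<^bsub>k\<^esub>p\<in>{p. f (fst p) \<noteq> \<zero>\<^bsub>k\<^esub> \<and> g (snd p) \<noteq> \<zero>\<^bsub>k\<^esub> \<and> mul (fst p) (snd p) = d}.
          w (fst p) (snd p) \<otimes>\<^bsub>k\<^esub> (f (fst p) \<otimes>\<^bsub>k\<^esub> g (snd p))),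
      one = delta k e,
      zero = (\<lambda>_. \<zero>\<^bsub>k\<^esub>),
      add = (\<lambda>f g d. f d \<oplus>\<^bsub>k\<^esub> g d),
      smult = (\<lambda>c f d. c \<otimes>\<^bsub>k\<^esub> f d)\<rparr>"

text \<open>
  The module \<open>k\<close> over such an algebra on which the basis elements in \<open>U\<close> act as \<open>1\<close> and the others
  as \<open>0\<close>. As \<open>k\<close> is commutative, the same record describes the left and the right module.
\<close>

definition trivial_module ::
    "('k, 'z) ring_scheme \<Rightarrow> 'd set \<Rightarrow> ('d \<Rightarrow> 'k, 'k) module" where
  "trivial_module k U =
     \<lparr>carrier = carrier k, mult = undefined, one = undefined,
      zero = \<zero>\<^bsub>k\<^esub>, add = (\<lambda>x y. x \<oplus>\<^bsub>k\<^esub> y),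
      smult = (\<lambda>f x. (\<Oplus>\<^bsub>k\<^esub>d\<in>{d \<in> U. f d \<noteq> \<zero>\<^bsub>k\<^esub>}. f d) \<otimes>\<^bsub>k\<^esub> x)\<rparr>"

definition group_algebra ::
    "('k, 'z) ring_scheme \<Rightarrow> ('h, 'y) monoid_scheme \<Rightarrow> ('k, 'h \<Rightarrow> 'k) module" where
  "group_algebra k H =
     basis_algebra k (carrier H) (\<lambda>x y. x \<otimes>\<^bsub>H\<^esub> y) (\<lambda>x y. \<one>\<^bsub>k\<^esub>) \<one>\<^bsub>H\<^esub>"

section \<open>Group homology with trivial coefficients\<close>

text \<open>The complex of inhomogeneous chains of \<open>H\<close> with coefficients in the trivial module \<open>k\<close>.\<close>

definition bar_face :: "('h, 'y) monoid_scheme \<Rightarrow> nat \<Rightarrow> 'h list \<Rightarrow> 'h list" where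
  "bar_face H j xs =
     (if j = 0 then tl xs
      else if j = length xs then butlast xs
      else take (j - 1) xs @ (xs ! (j - 1) \<otimes>\<^bsub>H\<^esub> xs ! j) # drop (j + 1) xs)"

definition bar_chains ::
    "('k, 'z) ring_scheme \<Rightarrow> ('h, 'y) monoid_scheme \<Rightarrow> nat \<Rightarrow> ('k, 'h list \<Rightarrow> 'k) module" where
  "bar_chains k H i = free_module k {xs. set xs \<subseteq> carrier H \<and> length xs = i}"

definition bar_diff ::
    "('k, 'z) ring_scheme \<Rightarrow> ('h, 'y) monoid_scheme \<Rightarrow> nat
      \<Rightarrow> ('h list \<Rightarrow> 'k) \<Rightarrow> 'h list \<Rightarrow> 'k" where
  "bar_diff k H i u =
     (\<lambda>ys. \<Oplus>\<^bsub>k\<^esub>j\<in>{..Suc i}. ((\<ominus>\<^bsub>k\<^esub> \<one>\<^bsub>k\<^esub>) [^]\<^bsub>k\<^esub> j) \<otimes>\<^bsub>k\<^esub> free_map k (bar_face H j) u ys)"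

definition group_homology ::
    "('k, 'z) ring_scheme \<Rightarrow> ('h, 'y) monoid_scheme \<Rightarrow> nat
      \<Rightarrow> ('k, ('h list \<Rightarrow> 'k) set) module" where
  "group_homology k H = homology (bar_chains k H) (bar_diff k H)"

section \<open>Partial braids\<close>

text \<open>
  The nodes are \<open>0, \<dots>, n - 1\<close>, placed on the real axis of the complex plane. A strand is named by
  its left node, and a geometric partial braid with strand set \<open>I\<close> is a path \<open>p\<close> such that \<open>p t i\<close>
  is the point of the strand \<open>i\<close> in the slice of the product of the unit interval and the plane at
  time \<open>t\<close>; strands run monotonically from left to right. Projecting the plane to the real axis
  gives the diagram, the imaginary part decides between over- and under-crossings. Coordinates
  outside \<open>I\<close> are kept at \<open>0\<close> and have no meaning. Isotopy with fixed endpoints is homotopy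
  relative to the endpoints through such paths.
\<close>

definition strand_configs :: "nat set \<Rightarrow> (nat \<Rightarrow> complex) set" where
  "strand_configs I = {z. inj_on z I \<and> (\<forall>i. i \<notin> I \<longrightarrow> z i = 0)}"

definition geometric_braid :: "nat \<Rightarrow> nat set \<Rightarrow> (real \<Rightarrow> nat \<Rightarrow> complex) \<Rightarrow> bool" where
  "geometric_braid n I p \<longleftrightarrow>
     I \<subseteq> {..<n} \<and> path p \<and> path_image p \<subseteq> strand_configs I \<and>
     (\<forall>i\<in>I. pathstart p i = of_nat i) \<and> (\<forall>i\<in>I. \<exists>j<n. pathfinish p i = of_nat j)"

definition isotopy_class ::
    "nat set \<Rightarrow> (real \<Rightarrow> nat \<Rightarrow> complex) \<Rightarrow> (real \<Rightarrow> nat \<Rightarrow> complex) set" where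
  "isotopy_class I p = {q. homotopic_paths (strand_configs I) p q}"

type_synonym pbraid = "nat set \<times> (real \<Rightarrow> nat \<Rightarrow> complex) set"

definition partial_braids :: "nat \<Rightarrow> pbraid set" where
  "partial_braids n = {(I, isotopy_class I p) | I p. geometric_braid n I p}"

abbreviation strands :: "pbraid \<Rightarrow> nat set" where
  "strands b \<equiv> fst b"

text \<open>The right node of the strand starting at the left node \<open>i\<close>.\<close>

definition right_node :: "pbraid \<Rightarrow> nat \<Rightarrow> nat" where
  "right_node b i = (THE j. \<forall>p\<in>snd b. pathfinish p i = of_nat j)"

definition pbraid_mult :: "pbraid \<Rightarrow> pbraid \<Rightarrow> pbraid" where
  "pbraid_mult b c =
     (let K = {i \<in> strands b. right_node b i \<in> strands c} in
       (K, \<Union>p\<in>snd b. \<Union>q\<in>snd c. isotopy_class K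
             ((\<lambda>t i. if i \<in> K then p t i else 0) +++
              (\<lambda>t i. if i \<in> K then q t (right_node b i) else 0))))"

definition pbraid_one :: "nat \<Rightarrow> pbraid" where
  "pbraid_one n = ({..<n}, isotopy_class {..<n} (\<lambda>t i. if i < n then of_nat i else 0))"

definition braid_group :: "nat \<Rightarrow> pbraid monoid" where
  "braid_group n =
     \<lparr>carrier = {b \<in> partial_braids n. strands b = {..<n}}, mult = pbraid_mult, one = pbraid_one n\<rparr>"

section \<open>The semidirect product of the braid group with a power of a group\<close>

definition semidirect_product ::
    "('n, 'y) monoid_scheme \<Rightarrow> ('h, 'z) monoid_scheme \<Rightarrow> ('h \<Rightarrow> 'n \<Rightarrow> 'n) \<Rightarrow> ('n \<times> 'h) monoid" where
  "semidirect_product N H \<alpha> =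
     \<lparr>carrier = carrier N \<times> carrier H,
      mult = (\<lambda>(x, h) (y, l). (x \<otimes>\<^bsub>N\<^esub> \<alpha> h y, h \<otimes>\<^bsub>H\<^esub> l)),
      one = (\<one>\<^bsub>N\<^esub>, \<one>\<^bsub>H\<^esub>)\<rparr>"

text \<open>
  Braids multiply from left to right, so the permutation underlying a product of braids \<open>b\<close>, \<open>c\<close> is
  \<open>right_node c \<circ> right_node b\<close>, and precomposition with \<open>right_node b\<close> is a left action.
\<close>

definition permute_factors :: "nat \<Rightarrow> pbraid \<Rightarrow> (nat \<Rightarrow> 'g) \<Rightarrow> nat \<Rightarrow> 'g" where
  "permute_factors n b x = (\<lambda>i\<in>{..<n}. x (right_node b i))"

definition wreath_braid_group ::
    "('g, 'y) monoid_scheme \<Rightarrow> nat \<Rightarrow> ((nat \<Rightarrow> 'g) \<times> pbraid) monoid" where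
  "wreath_braid_group G n =
     semidirect_product (product_group {..<n} (\<lambda>_. G)) (braid_group n) (permute_factors n)"

section \<open>The G-braided rook algebra\<close>

text \<open>A diagram consists of a partial braid and a label in \<open>G\<close> for each of its strands.\<close>

type_synonym 'g rook_diagram = "pbraid \<times> (nat \<Rightarrow> 'g)"

definition rook_diagrams :: "('g, 'y) monoid_scheme \<Rightarrow> nat \<Rightarrow> 'g rook_diagram set" where
  "rook_diagrams G n = (SIGMA b : partial_braids n. strands b \<rightarrow>\<^sub>E carrier G)"

definition rook_mult ::
    "('g, 'y) monoid_scheme \<Rightarrow> 'g rook_diagram \<Rightarrow> 'g rook_diagram \<Rightarrow> 'g rook_diagram" where
  "rook_mult G = (\<lambda>(b, x) (c, y).
     (pbraid_mult b c, \<lambda>i\<in>strands (pbraid_mult b c). x i \<otimes>\<^bsub>G\<^esub> y (right_node b i)))"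

definition rook_one :: "('g, 'y) monoid_scheme \<Rightarrow> nat \<Rightarrow> 'g rook_diagram" where
  "rook_one G n = (pbraid_one n, \<lambda>i\<in>{..<n}. \<one>\<^bsub>G\<^esub>)"

definition isolated_middle_nodes :: "nat \<Rightarrow> 'g rook_diagram \<Rightarrow> 'g rook_diagram \<Rightarrow> nat set" where
  "isolated_middle_nodes n = (\<lambda>(b, x) (c, y).
     {j \<in> {..<n}. j \<notin> right_node b ` strands b \<and> j \<notin> strands c})"

definition braided_rook_algebra ::
    "('g, 'y) monoid_scheme \<Rightarrow> ('k, 'z) ring_scheme \<Rightarrow> nat \<Rightarrow> 'k
      \<Rightarrow> ('k, 'g rook_diagram \<Rightarrow> 'k) module" where
  "braided_rook_algebra G k n \<epsilon> =
     basis_algebra k (rook_diagrams G n) (rook_mult G)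
       (\<lambda>d d'. \<epsilon> [^]\<^bsub>k\<^esub> card (isolated_middle_nodes n d d')) (rook_one G n)"

text \<open>A diagram has no missing edges iff all left nodes, equivalently all right nodes, are connected.\<close>

definition full_diagrams :: "('g, 'y) monoid_scheme \<Rightarrow> nat \<Rightarrow> 'g rook_diagram set" where
  "full_diagrams G n = {(b, x) \<in> rook_diagrams G n. strands b = {..<n}}"

definition rook_trivial ::
    "('g, 'y) monoid_scheme \<Rightarrow> ('k, 'z) ring_scheme \<Rightarrow> nat
      \<Rightarrow> ('g rook_diagram \<Rightarrow> 'k, 'k) module" where
  "rook_trivial G k n = trivial_module k (full_diagrams G n)"

definition group_trivial ::
    "('k, 'z) ring_scheme \<Rightarrow> ('h, 'y) monoid_scheme \<Rightarrow> ('h \<Rightarrow> 'k, 'k) module" where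
  "group_trivial k H = trivial_module k (carrier H)"

end

theory Submission
  imports Defs
begin

text \<open>
  Let \<open>A\<close> be the braided rook algebra, \<open>\<Gamma>\<close> the semidirect product, and \<open>\<pi> : A \<rightarrow> k[\<Gamma>]\<close> the restriction of
  coefficients to the diagrams without missing edges; it is a ring homomorphism because the other
  diagrams span an ideal. Let \<open>e m\<close> be the identity diagram without its \<open>m\<close>th strand. Since \<open>\<epsilon>\<close> is
  invertible, every diagram \<open>x\<close> whose \<open>m\<close>th right node is unattached satisfies \<open>x \<cdot> \<epsilon>\<inverse> e m = x\<close>. The
  product \<open>f\<close> of the elements \<open>1 - \<epsilon>\<inverse> e m\<close> therefore has \<open>\<pi> f = 1\<close>, and \<open>x f = 0\<close> whenever \<open>\<pi> x = 0\<close>.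

  It follows that \<open>\<pi>\<close> carries the standard free resolution of \<open>1\<close> over \<open>A\<close> to a free resolution of \<open>1\<close>
  over \<open>k[\<Gamma>]\<close>: a lift of a cycle becomes a cycle after multiplication with \<open>f\<close>. Both resolutions have the
  same reduction modulo the augmentation, and the comparison of the second one with the bar resolution
  identifies \<open>Tor\<close> over \<open>A\<close> with the homology of \<open>\<Gamma>\<close>. For \<open>Tor\<close> over \<open>k[\<Gamma>]\<close> take \<open>A = k[\<Gamma>]\<close> and \<open>f = 1\<close>.
\<close>

section \<open>Matrices over a ring\<close>

text \<open>Let \<open>I\<close> be the kernel of \<open>\<pi>\<close>. As \<open>1 - f\<close> lies
  in \<open>I\<close>, and \<open>x f = 0\<close> says \<open>x = x (1 - f)\<close> for
  \<open>x\<close> in \<open>I\<close>, the element \<open>f\<close> is idempotent and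
  \<open>I = A (1 - f)\<close>. So \<open>k[\<Gamma>] = A / I\<close> is isomorphic to
  \<open>A f\<close>, a projective left \<open>A\<close>-module. Base change of right modules from
  \<open>A\<close> to \<open>k[\<Gamma>]\<close> is therefore exact, and it preserves the trivial
  module because \<open>I\<close> acts on it as zero. The proof carries this out on matrices and
  never mentions projectivity. That \<open>f\<close> multiplies from the right fits the resolution:
  it consists of right modules, with coefficients on the right and differentials acting from the
  left.

  The factor \<open>\<epsilon>\<inverse>\<close> has its origin in the product of \<open>x\<close>
  with \<open>e m\<close>: the \<open>m\<close>th middle node is attached on neither side and is the
  only such node, so the product is \<open>\<epsilon> x\<close>.\<close>

definition lin :: "('a, 'z) ring_scheme \<Rightarrow> ('s \<Rightarrow> 't \<Rightarrow> 'a) \<Rightarrow> ('s \<Rightarrow> 'a) \<Rightarrow> 't \<Rightarrow> 'a" where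
  "lin R v u = (\<lambda>t. \<Oplus>\<^bsub>R\<^esub>s\<in>{s. u s \<noteq> \<zero>\<^bsub>R\<^esub>}. v s t \<otimes>\<^bsub>R\<^esub> u s)"

definition single :: "('a, 'z) ring_scheme \<Rightarrow> 's \<Rightarrow> 'a \<Rightarrow> 's \<Rightarrow> 'a" where
  "single R s a = (\<lambda>t. if t = s then a else \<zero>\<^bsub>R\<^esub>)"

lemma delta_eq_single: "delta R s = single R s \<one>\<^bsub>R\<^esub>"
  by (simp add: delta_def single_def)

lemma fin_suppI:
  assumes "\<And>s. s \<in> S \<Longrightarrow> f s \<in> carrier R" "\<And>s. s \<notin> S \<Longrightarrow> f s = \<zero>\<^bsub>R\<^esub>"
    "finite F" "{s. f s \<noteq> \<zero>\<^bsub>R\<^esub>} \<subseteq> F"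
  shows "f \<in> fin_supp R S"
  using assms by (auto simp: fin_supp_def intro: finite_subset)

lemma fin_supp_outside: "f \<in> fin_supp R S \<Longrightarrow> s \<notin> S \<Longrightarrow> f s = \<zero>\<^bsub>R\<^esub>"
  by (simp add: fin_supp_def)

lemma fin_supp_finite: "f \<in> fin_supp R S \<Longrightarrow> finite {s. f s \<noteq> \<zero>\<^bsub>R\<^esub>}"
  by (simp add: fin_supp_def)

lemma fin_supp_subset: "f \<in> fin_supp R S \<Longrightarrow> {s. f s \<noteq> \<zero>\<^bsub>R\<^esub>} \<subseteq> S"
  by (auto simp: fin_supp_def)

context ring
begin

lemma fin_supp_closed: "f \<in> fin_supp R S \<Longrightarrow> f s \<in> carrier R"
  by (cases "s \<in> S") (auto simp: fin_supp_def)

lemma fin_supp_zero [simp, intro]: "(\<lambda>_. \<zero>) \<in> fin_supp R S"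
  by (simp add: fin_supp_def)

lemma fin_supp_add [simp, intro]:
  assumes "f \<in> fin_supp R S" "g \<in> fin_supp R S"
  shows "(\<lambda>s. f s \<oplus> g s) \<in> fin_supp R S"
proof (rule fin_suppI)
  show "finite ({s. f s \<noteq> \<zero>} \<union> {s. g s \<noteq> \<zero>})"
    using assms by (simp add: fin_supp_finite)
qed (auto simp: assms[THEN fin_supp_outside] assms[THEN fin_supp_closed])

lemma fin_supp_map:
  assumes "f \<in> fin_supp R S" "h \<in> carrier R \<rightarrow> carrier R" "h \<zero> = \<zero>"
  shows "(\<lambda>s. h (f s)) \<in> fin_supp R S"
proof (rule fin_suppI)
  show "finite {s. f s \<noteq> \<zero>}"
    using assms by (simp add: fin_supp_finite)
qed (use assms in \<open>auto simp: fin_supp_outside[OF assms(1)] Pi_iff fin_supp_closed[OF assms(1)]\<close>)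

lemma fin_supp_neg [simp, intro]: "f \<in> fin_supp R S \<Longrightarrow> (\<lambda>s. \<ominus> f s) \<in> fin_supp R S"
  by (rule fin_supp_map) auto

lemma fin_supp_diff [simp, intro]:
  "f \<in> fin_supp R S \<Longrightarrow> g \<in> fin_supp R S \<Longrightarrow> (\<lambda>s. f s \<ominus> g s) \<in> fin_supp R S"
  unfolding a_minus_def by auto

lemma fin_supp_rmult [simp, intro]:
  "f \<in> fin_supp R S \<Longrightarrow> a \<in> carrier R \<Longrightarrow> (\<lambda>s. f s \<otimes> a) \<in> fin_supp R S"
  by (rule fin_supp_map[where h = "\<lambda>x. x \<otimes> a"]) auto

lemma fin_supp_lmult [simp, intro]:
  "f \<in> fin_supp R S \<Longrightarrow> a \<in> carrier R \<Longrightarrow> (\<lambda>s. a \<otimes> f s) \<in> fin_supp R S"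
  by (rule fin_supp_map[where h = "\<lambda>x. a \<otimes> x"]) auto

lemma fin_supp_single [simp, intro]: "s \<in> S \<Longrightarrow> a \<in> carrier R \<Longrightarrow> single R s a \<in> fin_supp R S"
  by (rule fin_suppI[where F = "{s}"]) (auto simp: single_def)

lemma fin_supp_delta [simp, intro]: "s \<in> S \<Longrightarrow> delta R s \<in> fin_supp R S"
  by (simp add: delta_eq_single)

lemma fin_supp_finsum:
  assumes "finite J" "\<And>j. j \<in> J \<Longrightarrow> f j \<in> fin_supp R S"
  shows "(\<lambda>s. \<Oplus>j\<in>J. f j s) \<in> fin_supp R S"
  using assms
proof (induction J rule: finite_induct)
  case (insert x F)
  then have "(\<lambda>s. \<Oplus>j\<in>insert x F. f j s) = (\<lambda>s. f x s \<oplus> (\<Oplus>j\<in>F. f j s))"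
    by (intro ext finsum_insert) (auto intro: fin_supp_closed)
  then show ?case using insert by simp
qed simp

text \<open>The principle behind most identities below: it suffices to treat vectors with one entry.
  It uses addition alone, so it is available over noncommutative rings and for maps that are
  additive without being linear.\<close>

lemma fin_supp_induct [consumes 1, case_names zero single add]:
  assumes u: "u \<in> fin_supp R S"
    and zero: "P (\<lambda>_. \<zero>)"
    and single: "\<And>s a. s \<in> S \<Longrightarrow> a \<in> carrier R \<Longrightarrow> P (single R s a)"
    and add: "\<And>f g. \<lbrakk>f \<in> fin_supp R S; g \<in> fin_supp R S; P f; P g\<rbrakk> \<Longrightarrow> P (\<lambda>s. f s \<oplus> g s)"
  shows "P u"
proof -
  \<comment> \<open>The induction runs over a finite set containing the support, not over the
    support itself, so that deleting an entry stays within the hypothesis.\<close>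
  have "P u" if "finite F" "u \<in> fin_supp R S" "{s. u s \<noteq> \<zero>} \<subseteq> F" for F u
    using that
  proof (induction F arbitrary: u rule: finite_induct)
    case empty
    then have "u = (\<lambda>_. \<zero>)" by auto
    then show ?case using zero by simp
  next
    case (insert x F)
    show ?case
    proof (cases "u x = \<zero>")
      case True
      then show ?thesis using insert by (metis (mono_tags, lifting) mem_Collect_eq subset_insert)
    next
      case False
      define w where "w = u(x := \<zero>)"
      have w: "w \<in> fin_supp R S"
        by (rule fin_suppI[OF _ _ fin_supp_finite[OF insert.prems(1)]])
          (auto simp: w_def fin_supp_outside[OF insert.prems(1)] fin_supp_closed[OF insert.prems(1)])
      have "{s. w s \<noteq> \<zero>} \<subseteq> F"
        using insert.prems by (auto simp: w_def)
      then have "P w" by (rule insert.IH[OF w])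
      moreover have x: "x \<in> S" using False insert.prems by (auto simp: fin_supp_def)
      ultimately have "P (\<lambda>s. single R x (u x) s \<oplus> w s)"
        using w by (intro add single fin_supp_single fin_supp_closed[OF insert.prems(1)])
      also have "(\<lambda>s. single R x (u x) s \<oplus> w s) = u"
        by (auto simp: single_def w_def fin_supp_closed[OF insert.prems(1)])
      finally show ?thesis .
    qed
  qed
  from this[OF fin_supp_finite[OF u] u order_refl] show ?thesis .
qed

section \<open>The action of a matrix on finitely supported vectors\<close>

lemma mat_closed: "v \<in> S \<rightarrow> fin_supp R T \<Longrightarrow> s \<in> S \<Longrightarrow> v s t \<in> carrier R"
  using fin_supp_closed[of "v s" T] by auto

text \<open>Enlarging the support to any finite subset of \<open>S\<close> gives two vectors a
  common range of summation, which \<open>lin_add_at\<close> needs.\<close>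

lemma lin_eq:
  assumes u: "u \<in> fin_supp R S" and v: "v \<in> S \<rightarrow> fin_supp R T"
    and F: "finite F" "{s. u s \<noteq> \<zero>} \<subseteq> F" "F \<subseteq> S"
  shows "lin R v u t = (\<Oplus>s\<in>F. v s t \<otimes> u s)"
proof -
  have "v s t \<otimes> u s \<in> carrier R" if "s \<in> F" for s
    using mat_closed[OF v] fin_supp_closed[OF u] that F by blast
  then show ?thesis
    unfolding lin_def by (intro add.finprod_mono_neutral_cong_left F)
      (use F mat_closed[OF v] in auto)
qed

lemma lin_closed [simp, intro]:
  assumes u: "u \<in> fin_supp R S" and v: "v \<in> S \<rightarrow> fin_supp R T"
  shows "lin R v u \<in> fin_supp R T"
  unfolding lin_def using assms fin_supp_subset[OF u]
  by (intro fin_supp_finsum fin_supp_rmult) (auto simp: fin_supp_finite fin_supp_closed[OF u])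

lemma lin_zero [simp]: "lin R v (\<lambda>_. \<zero>) = (\<lambda>_. \<zero>)"
  by (simp add: lin_def)

lemma lin_single:
  assumes "v s t \<in> carrier R" "a \<in> carrier R"
  shows "lin R v (single R s a) t = v s t \<otimes> a"
proof -
  have "lin R v (single R s a) t = (\<Oplus>s\<in>{s}. v s t \<otimes> a)"
    unfolding lin_def using assms
    by (intro add.finprod_mono_neutral_cong_left) (auto simp: single_def)
  then show ?thesis using assms by simp
qed

lemma lin_delta:
  assumes "\<And>t. v s t \<in> carrier R"
  shows "lin R v (delta R s) = v s"
  using assms by (intro ext) (simp add: delta_eq_single lin_single)

lemma lin_add_at:
  assumes u: "u \<in> fin_supp R S" and w: "w \<in> fin_supp R S"
    and v: "v \<in> S \<rightarrow> fin_supp R T"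
  shows "lin R v (\<lambda>s. u s \<oplus> w s) t = lin R v u t \<oplus> lin R v w t"
proof -
  define F where "F = {s. u s \<noteq> \<zero>} \<union> {s. w s \<noteq> \<zero>}"
  have F: "finite F" "F \<subseteq> S"
    using fin_supp_finite[OF u] fin_supp_finite[OF w] fin_supp_subset[OF u] fin_supp_subset[OF w]
    by (simp_all add: F_def)
  have c: "u s \<in> carrier R" "w s \<in> carrier R" for s
    by (rule fin_supp_closed[OF u], rule fin_supp_closed[OF w])
  have v': "v s t \<in> carrier R" if "s \<in> F" for s
    using mat_closed[OF v] that F by blast
  have supp: "{s. u s \<noteq> \<zero>} \<subseteq> F" "{s. w s \<noteq> \<zero>} \<subseteq> F" "{s. u s \<oplus> w s \<noteq> \<zero>} \<subseteq> F"
    by (auto simp: F_def)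
  have "lin R v (\<lambda>s. u s \<oplus> w s) t = (\<Oplus>s\<in>F. v s t \<otimes> (u s \<oplus> w s))"
    by (rule lin_eq[OF fin_supp_add[OF u w] v F(1) supp(3) F(2)])
  also have "\<dots> = (\<Oplus>s\<in>F. v s t \<otimes> u s \<oplus> v s t \<otimes> w s)"
    by (rule add.finprod_cong') (simp_all add: r_distr c v' Pi_iff)
  also have "\<dots> = (\<Oplus>s\<in>F. v s t \<otimes> u s) \<oplus> (\<Oplus>s\<in>F. v s t \<otimes> w s)"
    by (rule finsum_addf) (simp_all add: c v' Pi_iff)
  finally show ?thesis
    by (simp only: lin_eq[OF u v F(1) supp(1) F(2)] lin_eq[OF w v F(1) supp(2) F(2)])
qed

lemma lin_add:
  assumes "u \<in> fin_supp R S" "w \<in> fin_supp R S" "v \<in> S \<rightarrow> fin_supp R T"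
  shows "lin R v (\<lambda>s. u s \<oplus> w s) = (\<lambda>t. lin R v u t \<oplus> lin R v w t)"
  by (intro ext lin_add_at[OF assms])

text \<open>Matrix entries stand to the left of the coefficients, so matrices commute with right
  multiplication even when \<open>R\<close> is noncommutative. This convention is what allows a
  lifted cycle to be multiplied by \<open>f\<close> in \<open>resolution\<close>.\<close>

lemma lin_rmult:
  assumes u: "u \<in> fin_supp R S" and v: "v \<in> S \<rightarrow> fin_supp R T" and a: "a \<in> carrier R"
  shows "lin R v (\<lambda>s. u s \<otimes> a) t = lin R v u t \<otimes> a"
proof -
  define F where "F = {s. u s \<noteq> \<zero>}"
  have F: "finite F" "F \<subseteq> S"
    using fin_supp_finite[OF u] fin_supp_subset[OF u] by (simp_all add: F_def)
  have c: "u s \<in> carrier R" for s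
    by (rule fin_supp_closed[OF u])
  have v': "v s t \<in> carrier R" if "s \<in> F" for s
    using mat_closed[OF v] that F by blast
  have supp: "{s. u s \<noteq> \<zero>} \<subseteq> F" "{s. u s \<otimes> a \<noteq> \<zero>} \<subseteq> F"
    using a by (auto simp: F_def)
  have "lin R v (\<lambda>s. u s \<otimes> a) t = (\<Oplus>s\<in>F. v s t \<otimes> (u s \<otimes> a))"
    by (rule lin_eq[OF fin_supp_rmult[OF u a] v F(1) supp(2) F(2)])
  also have "\<dots> = (\<Oplus>s\<in>F. (v s t \<otimes> u s) \<otimes> a)"
    by (rule add.finprod_cong') (simp_all add: m_assoc c v' a Pi_iff)
  also have "\<dots> = (\<Oplus>s\<in>F. v s t \<otimes> u s) \<otimes> a"
    by (rule finsum_ldistr[symmetric]) (simp_all add: F c v' a Pi_iff)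
  finally show ?thesis
    by (simp only: lin_eq[OF u v F(1) supp(1) F(2)])
qed

lemma lin_neg:
  assumes u: "u \<in> fin_supp R S" and v: "v \<in> S \<rightarrow> fin_supp R T"
  shows "lin R v (\<lambda>s. \<ominus> u s) = (\<lambda>t. \<ominus> lin R v u t)"
proof
  fix t
  \<comment> \<open>Negation is right multiplication by \<open>\<ominus> \<one>\<close>, so
    \<open>lin_rmult\<close> covers it.\<close>
  have "lin R v (\<lambda>s. \<ominus> u s) t = lin R v (\<lambda>s. u s \<otimes> \<ominus> \<one>) t"
    by (simp add: r_minus fin_supp_closed[OF u])
  also have "\<dots> = lin R v u t \<otimes> \<ominus> \<one>"
    by (rule lin_rmult[OF u v]) simp
  finally show "lin R v (\<lambda>s. \<ominus> u s) t = \<ominus> lin R v u t"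
    by (simp add: r_minus fin_supp_closed[OF lin_closed[OF u v]])
qed

lemma lin_diff:
  assumes "u \<in> fin_supp R S" "w \<in> fin_supp R S" "v \<in> S \<rightarrow> fin_supp R T"
  shows "lin R v (\<lambda>s. u s \<ominus> w s) = (\<lambda>t. lin R v u t \<ominus> lin R v w t)"
  unfolding a_minus_def
  by (subst lin_add[OF assms(1) fin_supp_neg[OF assms(2)] assms(3)]) (simp add: lin_neg[OF assms(2,3)])

text \<open>Composites, sums and identity matrices, and later the differential of inhomogeneous
  chains, are recognised as matrices by this criterion, without manipulating double sums.\<close>

lemma lin_ext_eq:
  assumes u: "u \<in> fin_supp R S" and h_zero: "h (\<lambda>_. \<zero>) = (\<lambda>_. \<zero>)"
    and h_add: "\<And>f g. \<lbrakk>f \<in> fin_supp R S; g \<in> fin_supp R S\<rbrakk> \<Longrightarrow>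
      h (\<lambda>s. f s \<oplus> g s) = (\<lambda>t. h f t \<oplus> h g t)"
    and h_single: "\<And>s a. \<lbrakk>s \<in> S; a \<in> carrier R\<rbrakk> \<Longrightarrow> h (single R s a) = (\<lambda>t. v s t \<otimes> a)"
    and v: "v \<in> S \<rightarrow> fin_supp R T"
  shows "h u = lin R v u"
  using u
proof (induction rule: fin_supp_induct)
  case zero
  show ?case by (simp add: h_zero)
next
  case (single s a)
  then show ?case by (simp add: h_single lin_single mat_closed[OF v])
next
  case (add f g)
  then show ?case by (simp add: h_add lin_add[OF _ _ v])
qed

lemma lin_lin:
  assumes u: "u \<in> fin_supp R S" and w: "w \<in> S \<rightarrow> fin_supp R T" and v: "v \<in> T \<rightarrow> fin_supp R U"
  shows "lin R v (lin R w u) = lin R (\<lambda>s. lin R v (w s)) u"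
proof (rule lin_ext_eq[OF u])
  fix f g assume f: "f \<in> fin_supp R S" and g: "g \<in> fin_supp R S"
  show "lin R v (lin R w (\<lambda>s. f s \<oplus> g s)) = (\<lambda>t. lin R v (lin R w f) t \<oplus> lin R v (lin R w g) t)"
    by (simp only: lin_add[OF f g w] lin_add[OF lin_closed[OF f w] lin_closed[OF g w] v])
next
  fix s a assume s: "s \<in> S" and a: "a \<in> carrier R"
  have ws: "w s \<in> fin_supp R T" using w s by auto
  have "lin R w (single R s a) = (\<lambda>t. w s t \<otimes> a)"
    by (intro ext lin_single mat_closed[OF w s] a)
  then show "lin R v (lin R w (single R s a)) = (\<lambda>t. lin R v (w s) t \<otimes> a)"
    by (simp only:) (intro ext lin_rmult[OF ws v a])
next
  show "(\<lambda>s. lin R v (w s)) \<in> S \<rightarrow> fin_supp R U"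
    using w v by auto
qed simp

lemma lin_id:
  assumes u: "u \<in> fin_supp R S"
  shows "lin R (delta R) u = u"
proof -
  have "u = lin R (delta R) u"
    by (rule lin_ext_eq[OF u, where h = "\<lambda>u. u" and T = S])
      (auto simp: delta_def single_def)
  then show ?thesis by simp
qed

lemma lin_cong:
  assumes "u \<in> fin_supp R S" "\<And>s. s \<in> S \<Longrightarrow> v s = w s" "\<And>s t. s \<in> S \<Longrightarrow> w s t \<in> carrier R"
  shows "lin R v u = lin R w u"
  unfolding lin_def using assms fin_supp_subset[OF assms(1)]
  by (intro ext add.finprod_cong') (auto simp: fin_supp_closed[OF assms(1)])

lemma lin_mat_add:
  assumes u: "u \<in> fin_supp R S" and v: "v \<in> S \<rightarrow> fin_supp R T" and w: "w \<in> S \<rightarrow> fin_supp R T"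
  shows "lin R (\<lambda>s t. v s t \<oplus> w s t) u = (\<lambda>t. lin R v u t \<oplus> lin R w u t)"
proof (rule lin_ext_eq[OF u, symmetric])
  fix f g assume f: "f \<in> fin_supp R S" and g: "g \<in> fin_supp R S"
  note [simp] = fin_supp_closed[OF lin_closed[OF f v]] fin_supp_closed[OF lin_closed[OF g v]]
    fin_supp_closed[OF lin_closed[OF f w]] fin_supp_closed[OF lin_closed[OF g w]]
  show "(\<lambda>t. lin R v (\<lambda>s. f s \<oplus> g s) t \<oplus> lin R w (\<lambda>s. f s \<oplus> g s) t) =
    (\<lambda>t. (lin R v f t \<oplus> lin R w f t) \<oplus> (lin R v g t \<oplus> lin R w g t))"
    by (simp add: lin_add[OF f g v] lin_add[OF f g w] a_ac)
next
  fix s a assume s: "s \<in> S" and a: "a \<in> carrier R"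
  show "(\<lambda>t. lin R v (single R s a) t \<oplus> lin R w (single R s a) t) =
    (\<lambda>t. (v s t \<oplus> w s t) \<otimes> a)"
    by (simp add: lin_single mat_closed[OF v s] mat_closed[OF w s] a l_distr)
next
  show "(\<lambda>s t. v s t \<oplus> w s t) \<in> S \<rightarrow> fin_supp R T"
    using v w by auto
qed simp

lemma lin_mat_diff:
  assumes u: "u \<in> fin_supp R S" and v: "v \<in> S \<rightarrow> fin_supp R T" and w: "w \<in> S \<rightarrow> fin_supp R T"
  shows "lin R (\<lambda>s t. v s t \<ominus> w s t) u = (\<lambda>t. lin R v u t \<ominus> lin R w u t)"
proof -
  have d: "(\<lambda>s t. v s t \<ominus> w s t) \<in> S \<rightarrow> fin_supp R T" using v w by auto
  note c = fin_supp_closed[OF lin_closed[OF u d]] fin_supp_closed[OF lin_closed[OF u w]]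
  \<comment> \<open>Additivity is applied to the matrix \<open>(v - w) + w\<close>, which saves an
    induction for negated matrices.\<close>
  have "(\<lambda>t. lin R (\<lambda>s t. v s t \<ominus> w s t) u t \<oplus> lin R w u t) =
    lin R (\<lambda>s t. (v s t \<ominus> w s t) \<oplus> w s t) u"
    by (rule lin_mat_add[OF u d w, symmetric])
  also have "\<dots> = lin R v u"
    by (rule lin_cong[OF u])
      (simp_all add: mat_closed[OF v] mat_closed[OF w] a_minus_def a_assoc l_neg)
  finally have *: "lin R (\<lambda>s t. v s t \<ominus> w s t) u t \<oplus> lin R w u t = lin R v u t" for t
    by (rule fun_cong)
  show ?thesis
    by (rule ext) (simp only: *[symmetric], simp add: a_minus_def a_assoc r_neg c[unfolded a_minus_def])
qed

end

lemma fin_supp_hom: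
  assumes "ring R" "ring R'" "h \<in> ring_hom R R'" and f: "f \<in> fin_supp R S"
  shows "(\<lambda>s. h (f s)) \<in> fin_supp R' S"
proof -
  interpret R: ring R by fact
  interpret R': ring R' by fact
  interpret h: ring_hom_ring R R' h
    by (simp add: assms ring_hom_ringI2)
  show ?thesis
    by (rule fin_suppI[OF _ _ fin_supp_finite[OF f]])
      (auto simp: fin_supp_outside[OF f] R.fin_supp_closed[OF f])
qed

text \<open>Needed for two kinds of homomorphism: augmentations, which turn resolutions into
  complexes over \<open>k\<close>, and the projection of an algebra onto the monoid algebra, which
  changes the ring of a resolution.\<close>

lemma lin_hom:
  assumes R: "ring R" and R': "ring R'" and h: "h \<in> ring_hom R R'"
    and u: "u \<in> fin_supp R S" and v: "v \<in> S \<rightarrow> fin_supp R T"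
  shows "(\<lambda>t. h (lin R v u t)) = lin R' (\<lambda>s t. h (v s t)) (\<lambda>s. h (u s))"
proof -
  interpret R: ring R by fact
  interpret R': ring R' by fact
  interpret h: ring_hom_ring R R' h
    by (simp add: assms ring_hom_ringI2)
  have hv: "(\<lambda>s t. h (v s t)) \<in> S \<rightarrow> fin_supp R' T"
    using v by (auto intro: fin_supp_hom[OF R R' h])
  show ?thesis using u
  proof (induction rule: R.fin_supp_induct)
    case zero
    show ?case by simp
  next
    case (single s a)
    have "(\<lambda>t. h (single R s a t)) = single R' s (h a)"
      by (auto simp: single_def)
    then show ?case
      by (intro ext) (simp add: R.lin_single R'.lin_single R.mat_closed[OF v] single)
  next
    case (add f g)
    note [simp] = R.fin_supp_closed[OF R.lin_closed[OF add.hyps(1) v]]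
      R.fin_supp_closed[OF R.lin_closed[OF add.hyps(2) v]]
      R.fin_supp_closed[OF add.hyps(1)] R.fin_supp_closed[OF add.hyps(2)]
    show ?case
      by (simp add: R.lin_add[OF add.hyps v] add.IH[symmetric]
        R'.lin_add[OF fin_supp_hom[OF R R' h add.hyps(1)] fin_supp_hom[OF R R' h add.hyps(2)] hv])
        (simp add: add.IH[THEN fun_cong, symmetric] fun_eq_iff)?
  qed
qed

section \<open>Linear maps, kernels and images\<close>

definition module_hom ::
    "('k, 'z) ring_scheme \<Rightarrow> ('k, 'm, 'x) module_scheme \<Rightarrow> ('k, 'n, 'y) module_scheme
      \<Rightarrow> ('m \<Rightarrow> 'n) set" where
  "module_hom k M N =
     {h. h \<in> carrier M \<rightarrow> carrier N \<and>
         (\<forall>x\<in>carrier M. \<forall>y\<in>carrier M. h (x \<oplus>\<^bsub>M\<^esub> y) = h x \<oplus>\<^bsub>N\<^esub> h y) \<and>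
         (\<forall>c\<in>carrier k. \<forall>x\<in>carrier M. h (c \<odot>\<^bsub>M\<^esub> x) = c \<odot>\<^bsub>N\<^esub> h x)}"

lemma (in abelian_group) minus_eq_zero_iff:
  assumes "x \<in> carrier G" "y \<in> carrier G"
  shows "x \<ominus> y = \<zero> \<longleftrightarrow> x = y"
proof
  assume "x \<ominus> y = \<zero>"
  then have "\<ominus> (\<ominus> y) = x"
    using assms by (intro minus_equality) (simp_all add: a_minus_def)
  then show "x = y" using assms by simp
qed (use assms in \<open>simp add: a_minus_def r_neg\<close>)

lemma module_hom_closed: "h \<in> module_hom k M N \<Longrightarrow> x \<in> carrier M \<Longrightarrow> h x \<in> carrier N"
  by (auto simp: module_hom_def)

lemma module_hom_add:
  "h \<in> module_hom k M N \<Longrightarrow> x \<in> carrier M \<Longrightarrow> y \<in> carrier M \<Longrightarrow> h (x \<oplus>\<^bsub>M\<^esub> y) = h x \<oplus>\<^bsub>N\<^esub> h y"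
  by (auto simp: module_hom_def)

lemma module_hom_smult:
  "h \<in> module_hom k M N \<Longrightarrow> c \<in> carrier k \<Longrightarrow> x \<in> carrier M \<Longrightarrow> h (c \<odot>\<^bsub>M\<^esub> x) = c \<odot>\<^bsub>N\<^esub> h x"
  by (auto simp: module_hom_def)

lemma module_hom_zero:
  assumes "module k M" "module k N" "h \<in> module_hom k M N"
  shows "h \<zero>\<^bsub>M\<^esub> = \<zero>\<^bsub>N\<^esub>"
proof -
  interpret M: module k M by fact
  interpret N: module k N by fact
  have "h \<zero>\<^bsub>M\<^esub> = h (\<zero>\<^bsub>k\<^esub> \<odot>\<^bsub>M\<^esub> \<zero>\<^bsub>M\<^esub>)" by simp
  also have "\<dots> = \<zero>\<^bsub>k\<^esub> \<odot>\<^bsub>N\<^esub> h \<zero>\<^bsub>M\<^esub>"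
    by (rule module_hom_smult[OF assms(3)]) simp_all
  also have "\<dots> = \<zero>\<^bsub>N\<^esub>"
    by (rule N.smult_l_null) (simp add: module_hom_closed[OF assms(3)])
  finally show ?thesis .
qed

lemma module_hom_neg:
  assumes "module k M" "module k N" "h \<in> module_hom k M N" "x \<in> carrier M"
  shows "h (\<ominus>\<^bsub>M\<^esub> x) = \<ominus>\<^bsub>N\<^esub> h x"
proof -
  interpret M: module k M by fact
  interpret N: module k N by fact
  have "h (\<ominus>\<^bsub>M\<^esub> x) = h ((\<ominus>\<^bsub>k\<^esub> \<one>\<^bsub>k\<^esub>) \<odot>\<^bsub>M\<^esub> x)"
    using assms by (simp add: M.smult_l_minus)
  also have "\<dots> = \<ominus>\<^bsub>N\<^esub> h x"
    using assms module_hom_closed[OF assms(3,4)]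
    by (subst module_hom_smult[OF assms(3)]) (auto simp: N.smult_l_minus)
  finally show ?thesis .
qed

lemma module_hom_minus:
  assumes "module k M" "module k N" "h \<in> module_hom k M N" "x \<in> carrier M" "y \<in> carrier M"
  shows "h (x \<ominus>\<^bsub>M\<^esub> y) = h x \<ominus>\<^bsub>N\<^esub> h y"
proof -
  interpret M: module k M by fact
  show ?thesis
    using assms unfolding a_minus_def by (simp add: module_hom_add module_hom_neg)
qed

lemma module_hom_comp:
  assumes "f \<in> module_hom k L M" "g \<in> module_hom k M N"
  shows "(\<lambda>x. g (f x)) \<in> module_hom k L N"
  using assms unfolding module_hom_def by (auto simp: Pi_iff)

lemma kernel_submodule:
  assumes "module k M" "module k N" "h \<in> module_hom k M N"
  shows "submodule {x \<in> carrier M. h x = \<zero>\<^bsub>N\<^esub>} k M"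
proof -
  interpret M: module k M by fact
  interpret N: module k N by fact
  show ?thesis
    by (rule M.submoduleI)
      (use assms in \<open>auto simp: module_hom_zero module_hom_neg module_hom_add module_hom_smult\<close>)
qed

lemma image_submodule:
  assumes "module k M" "module k N" "h \<in> module_hom k M N"
  shows "submodule (h ` carrier M) k N"
proof -
  interpret M: module k M by fact
  interpret N: module k N by fact
  show ?thesis
  proof (rule N.submoduleI)
    show "\<zero>\<^bsub>N\<^esub> \<in> h ` carrier M"
      using imageI[OF M.zero_closed, of h] by (simp only: module_hom_zero[OF assms])
  next
    fix a assume "a \<in> h ` carrier M"
    then obtain x where x: "x \<in> carrier M" "a = h x" by blast
    show "\<ominus>\<^bsub>N\<^esub> a \<in> h ` carrier M"
      using imageI[OF M.a_inv_closed[OF x(1)], of h] by (simp only: module_hom_neg[OF assms x(1)] x(2))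
    {
      fix b assume "b \<in> h ` carrier M"
      then obtain y where y: "y \<in> carrier M" "b = h y" by blast
      show "a \<oplus>\<^bsub>N\<^esub> b \<in> h ` carrier M"
        using imageI[OF M.a_closed[OF x(1) y(1)], of h]
        by (simp only: module_hom_add[OF assms(3) x(1) y(1)] x(2) y(2))
    }
    fix c assume c: "c \<in> carrier k"
    show "c \<odot>\<^bsub>N\<^esub> a \<in> h ` carrier M"
      using imageI[OF M.smult_closed[OF c x(1)], of h]
      by (simp only: module_hom_smult[OF assms(3) c x(1)] x(2))
  qed (use module_hom_closed[OF assms(3)] in auto)
qed

section \<open>Quotient modules and the first isomorphism theorem\<close>

locale quotient_by_submodule = module k M + submodule H k M for k and M (structure) and H
begin

sublocale abelian_subgroup H M
  by (rule abelian_subgroupI3)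
    (simp_all add: additive_subgroup.intro subgroup_axioms M.abelian_group_axioms)

lemma coset_in_carrier: "x \<in> carrier M \<Longrightarrow> H +> x \<in> carrier (quotient_module M H)"
  by (auto simp: quotient_module_def A_RCOSETS_def')

lemma carrier_quotientE:
  assumes "X \<in> carrier (quotient_module M H)"
  obtains x where "x \<in> carrier M" "X = H +> x"
  using assms by (auto simp: quotient_module_def A_RCOSETS_def')

lemma coset_add:
  "x \<in> carrier M \<Longrightarrow> y \<in> carrier M \<Longrightarrow>
    (H +> x) \<oplus>\<^bsub>quotient_module M H\<^esub> (H +> y) = H +> (x \<oplus> y)"
  by (simp add: quotient_module_def a_rcos_sum)

lemma coset_eq_iff:
  assumes "x \<in> carrier M" "y \<in> carrier M"
  shows "H +> x = H +> y \<longleftrightarrow> x \<ominus>\<^bsub>M\<^esub> y \<in> H"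
proof -
  have "H +> x = H +> y \<longleftrightarrow> x \<in> H +> y"
    using assms a_repr_independence'[of x y] a_rcos_self[of x] by auto
  also have "\<dots> \<longleftrightarrow> x \<oplus> \<ominus> y \<in> H"
    using assms a_rcos_module by blast
  finally show ?thesis by (simp add: a_minus_def)
qed

lemma coset_zero: "H +> \<zero>\<^bsub>M\<^esub> = H"
  using a_coset_add_zero a_subset by blast

lemma coset_eq_zero_iff: "x \<in> carrier M \<Longrightarrow> H +> x = H \<longleftrightarrow> x \<in> H"
  using coset_eq_iff[of x "\<zero>\<^bsub>M\<^esub>"] M.minus_equality[of "\<zero>\<^bsub>M\<^esub>" "\<zero>\<^bsub>M\<^esub>"]
  by (simp add: coset_zero a_minus_def)

lemma coset_smult:
  assumes "c \<in> carrier k" "x \<in> carrier M"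
  shows "c \<odot>\<^bsub>quotient_module M H\<^esub> (H +> x) = H +> (c \<odot> x)"
proof -
  have "H +> (c \<odot> y) = H +> (c \<odot> x)" if "y \<in> H +> x" for y
  proof -
    have y: "y \<in> carrier M" by (rule a_elemrcos_carrier[OF assms(2) that])
    have "y \<ominus>\<^bsub>M\<^esub> x \<in> H"
      unfolding coset_eq_iff[OF y assms(2), symmetric]
      by (rule a_repr_independence'[OF that assms(2), symmetric])
    then have "c \<odot> (y \<ominus>\<^bsub>M\<^esub> x) \<in> H" using assms by auto
    then show ?thesis
      using assms y by (simp add: coset_eq_iff a_minus_def smult_r_distr smult_r_minus)
  qed
  \<comment> \<open>Without a representative, the union that defines the scalar multiple would be
    empty instead of a coset.\<close>
  moreover have "H +> x \<noteq> {}" using a_rcos_self[OF assms(2)] by force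
  ultimately have "(\<Union>y\<in>H +> x. H +> (c \<odot> y)) = H +> (c \<odot> x)"
    by (intro SUP_eq_const)
  then show ?thesis by (simp add: quotient_module_def)
qed

lemma quotient_module: "module k (quotient_module M H)"
proof (rule moduleI)
  let ?Q = "quotient_module M H"
  have H: "H = H +> \<zero>\<^bsub>M\<^esub>" by (simp add: coset_zero)
  have zero: "\<zero>\<^bsub>?Q\<^esub> = H +> \<zero>\<^bsub>M\<^esub>"
    by (simp add: quotient_module_def coset_zero)
  show "abelian_group ?Q"
  proof (rule abelian_groupI)
    show "X \<oplus>\<^bsub>?Q\<^esub> Y \<in> carrier ?Q" if "X \<in> carrier ?Q" "Y \<in> carrier ?Q" for X Y
      using that by (auto elim!: carrier_quotientE simp: coset_add intro!: coset_in_carrier)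
    show "\<zero>\<^bsub>?Q\<^esub> \<in> carrier ?Q"
      unfolding zero by (rule coset_in_carrier) simp
    show "X \<oplus>\<^bsub>?Q\<^esub> Y \<oplus>\<^bsub>?Q\<^esub> Z = X \<oplus>\<^bsub>?Q\<^esub> (Y \<oplus>\<^bsub>?Q\<^esub> Z)"
      if "X \<in> carrier ?Q" "Y \<in> carrier ?Q" "Z \<in> carrier ?Q" for X Y Z
      using that by (auto elim!: carrier_quotientE simp: coset_add M.a_assoc)
    show "X \<oplus>\<^bsub>?Q\<^esub> Y = Y \<oplus>\<^bsub>?Q\<^esub> X" if "X \<in> carrier ?Q" "Y \<in> carrier ?Q" for X Y
      using that by (auto elim!: carrier_quotientE simp: coset_add M.a_comm)
    show "\<zero>\<^bsub>?Q\<^esub> \<oplus>\<^bsub>?Q\<^esub> X = X" if "X \<in> carrier ?Q" for X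
      using that unfolding zero by (auto elim!: carrier_quotientE simp: coset_add)
    show "\<exists>Y\<in>carrier ?Q. Y \<oplus>\<^bsub>?Q\<^esub> X = \<zero>\<^bsub>?Q\<^esub>" if X: "X \<in> carrier ?Q" for X
    proof -
      obtain x where x: "x \<in> carrier M" "X = H +> x"
        using X by (rule carrier_quotientE)
      have "(H +> (\<ominus> x)) \<oplus>\<^bsub>?Q\<^esub> X = \<zero>\<^bsub>?Q\<^esub>"
        using x unfolding zero by (simp add: coset_add M.l_neg)
      moreover have "H +> (\<ominus> x) \<in> carrier ?Q"
        using x by (intro coset_in_carrier) simp
      ultimately show ?thesis by blast
    qed
  qed
  show "c \<odot>\<^bsub>?Q\<^esub> X \<in> carrier ?Q" if "c \<in> carrier k" "X \<in> carrier ?Q" for c X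
    using that by (auto elim!: carrier_quotientE simp: coset_smult intro!: coset_in_carrier)
  show "(a \<oplus>\<^bsub>k\<^esub> b) \<odot>\<^bsub>?Q\<^esub> X = a \<odot>\<^bsub>?Q\<^esub> X \<oplus>\<^bsub>?Q\<^esub> b \<odot>\<^bsub>?Q\<^esub> X"
    if "a \<in> carrier k" "b \<in> carrier k" "X \<in> carrier ?Q" for a b X
    using that by (auto elim!: carrier_quotientE simp: coset_smult coset_add smult_l_distr)
  show "a \<odot>\<^bsub>?Q\<^esub> (X \<oplus>\<^bsub>?Q\<^esub> Y) = a \<odot>\<^bsub>?Q\<^esub> X \<oplus>\<^bsub>?Q\<^esub> a \<odot>\<^bsub>?Q\<^esub> Y"
    if "a \<in> carrier k" "X \<in> carrier ?Q" "Y \<in> carrier ?Q" for a X Y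
    using that by (auto elim!: carrier_quotientE simp: coset_smult coset_add smult_r_distr)
  show "(a \<otimes>\<^bsub>k\<^esub> b) \<odot>\<^bsub>?Q\<^esub> X = a \<odot>\<^bsub>?Q\<^esub> (b \<odot>\<^bsub>?Q\<^esub> X)"
    if "a \<in> carrier k" "b \<in> carrier k" "X \<in> carrier ?Q" for a b X
    using that by (auto elim!: carrier_quotientE simp: coset_smult smult_assoc1)
  show "\<one>\<^bsub>k\<^esub> \<odot>\<^bsub>?Q\<^esub> X = X" if "X \<in> carrier ?Q" for X
    using that by (auto elim!: carrier_quotientE simp: coset_smult)
qed (rule R.is_cring)

lemma coset_hom: "(\<lambda>x. H +> x) \<in> module_hom k M (quotient_module M H)"
  by (auto simp: module_hom_def coset_add coset_smult intro!: coset_in_carrier)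

text \<open>Elements of the quotient are sets, so a map out of it is evaluated at a chosen
  representative; representatives differ by elements of the kernel, so the choice does not
  matter.\<close>

lemma coset_some_eq:
  assumes "module k N" "f \<in> module_hom k M N" "H = {x \<in> carrier M. f x = \<zero>\<^bsub>N\<^esub>}" "u \<in> carrier M"
  shows "f (SOME x. x \<in> H +> u) = f u"
proof -
  interpret N: module k N by fact
  define y where "y = (SOME x. x \<in> H +> u)"
  have "u \<in> H +> u" using assms(4) by (rule a_rcos_self)
  then have y: "y \<in> H +> u" unfolding y_def by (rule someI)
  then have yM: "y \<in> carrier M" by (rule a_elemrcos_carrier[OF assms(4)])
  have "H +> y = H +> u"
    by (rule a_repr_independence'[OF y assms(4), symmetric])
  then have "y \<ominus>\<^bsub>M\<^esub> u \<in> H"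
    unfolding coset_eq_iff[OF yM assms(4)] .
  then have "f (y \<ominus>\<^bsub>M\<^esub> u) = \<zero>\<^bsub>N\<^esub>"
    using assms(3) by blast
  then have "f y \<ominus>\<^bsub>N\<^esub> f u = \<zero>\<^bsub>N\<^esub>"
    by (simp only: module_hom_minus[OF module_axioms assms(1,2) yM assms(4)])
  then have "f y = f u"
    by (simp only: N.minus_eq_zero_iff[OF module_hom_closed[OF assms(2) yM] module_hom_closed[OF assms(2,4)]])
  then show ?thesis by (simp add: y_def)
qed

text \<open>The isomorphism is given explicitly because \<open>tensor_iso\<close> is of this form
  and has to be compared with differentials later.\<close>

lemma quotient_iso:
  assumes N: "module k N" and f: "f \<in> module_hom k M N"
    and surj: "\<And>y. y \<in> carrier N \<Longrightarrow> \<exists>x\<in>carrier M. f x = y"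
    and H: "H = {x \<in> carrier M. f x = \<zero>\<^bsub>N\<^esub>}"
  shows "(\<lambda>X. f (SOME x. x \<in> X)) \<in> module_iso k (quotient_module M H) N"
proof -
  interpret N: module k N by fact
  note eq [simp] = coset_some_eq[OF N f H]
  let ?g = "\<lambda>X. f (SOME x. x \<in> X)"
  have "inj_on ?g (carrier (quotient_module M H))"
  proof (rule inj_onI)
    fix X Y assume X: "X \<in> carrier (quotient_module M H)" and Y: "Y \<in> carrier (quotient_module M H)"
      and XY: "?g X = ?g Y"
    obtain x where x: "x \<in> carrier M" "X = H +> x" using X by (rule carrier_quotientE)
    obtain y where y: "y \<in> carrier M" "Y = H +> y" using Y by (rule carrier_quotientE)
    have "f x = f y" using XY x y by simp
    then have "f (x \<ominus>\<^bsub>M\<^esub> y) = \<zero>\<^bsub>N\<^esub>"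
      unfolding module_hom_minus[OF module_axioms N f x(1) y(1)]
        N.minus_eq_zero_iff[OF module_hom_closed[OF f x(1)] module_hom_closed[OF f y(1)]] .
    moreover have "x \<ominus>\<^bsub>M\<^esub> y \<in> carrier M" using x y by (simp add: a_minus_def)
    ultimately have "x \<ominus>\<^bsub>M\<^esub> y \<in> H" using H by blast
    then show "X = Y" unfolding x(2) y(2) coset_eq_iff[OF x(1) y(1)] .
  qed
  moreover have "?g ` carrier (quotient_module M H) = carrier N"
  proof (intro equalityI subsetI)
    fix y assume "y \<in> ?g ` carrier (quotient_module M H)"
    then show "y \<in> carrier N"
      by (auto elim!: carrier_quotientE intro: module_hom_closed[OF f])
  next
    fix y assume "y \<in> carrier N"
    then obtain x where x: "x \<in> carrier M" "f x = y" using surj by blast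
    then have "y = ?g (H +> x)" by simp
    then show "y \<in> ?g ` carrier (quotient_module M H)"
      using x coset_in_carrier by blast
  qed
  ultimately show ?thesis
    unfolding module_iso_def bij_betw_def
    by (auto elim!: carrier_quotientE simp: coset_add coset_smult module_hom_add[OF f] module_hom_smult[OF f])
qed

end

section \<open>Isomorphisms of graded modules\<close>

lemma module_iso_inv:
  assumes M: "module k M" and f: "f \<in> module_iso k M N"
  shows "inv_into (carrier M) f \<in> module_iso k N M"
proof -
  interpret M: module k M by fact
  let ?g = "inv_into (carrier M) f"
  have bij: "bij_betw f (carrier M) (carrier N)" using f by (simp add: module_iso_def)
  have g: "bij_betw ?g (carrier N) (carrier M)" using bij by (rule bij_betw_inv_into)
  have gM: "?g y \<in> carrier M" if "y \<in> carrier N" for y using g that by (auto simp: bij_betw_def)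
  have fg: "f (?g y) = y" if "y \<in> carrier N" for y using bij that by (rule bij_betw_inv_into_right)
  have gf: "?g (f x) = x" if "x \<in> carrier M" for x using bij that by (rule bij_betw_inv_into_left)
  have "?g (x \<oplus>\<^bsub>N\<^esub> y) = ?g x \<oplus>\<^bsub>M\<^esub> ?g y" if "x \<in> carrier N" "y \<in> carrier N" for x y
  proof -
    have "x \<oplus>\<^bsub>N\<^esub> y = f (?g x \<oplus>\<^bsub>M\<^esub> ?g y)"
      using f gM that fg by (simp add: module_iso_def)
    then show ?thesis using gf gM that by simp
  qed
  moreover have "?g (c \<odot>\<^bsub>N\<^esub> y) = c \<odot>\<^bsub>M\<^esub> ?g y" if "c \<in> carrier k" "y \<in> carrier N" for c y
  proof -
    have "c \<odot>\<^bsub>N\<^esub> y = f (c \<odot>\<^bsub>M\<^esub> ?g y)"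
      using f gM that fg by (simp add: module_iso_def)
    then show ?thesis using gf gM that by simp
  qed
  ultimately show ?thesis using g by (simp add: module_iso_def)
qed

lemma module_iso_comp:
  assumes "f \<in> module_iso k L M" "g \<in> module_iso k M N"
  shows "g \<circ> f \<in> module_iso k L N"
proof -
  have "f x \<in> carrier M" if "x \<in> carrier L" for x
    using assms(1) that by (auto simp: module_iso_def bij_betw_def)
  then show ?thesis
    using assms unfolding module_iso_def by (auto intro: bij_betw_trans)
qed

lemma graded_isomorphic_sym:
  assumes "\<And>i. module k (C i)" "graded_isomorphic k C D"
  shows "graded_isomorphic k D C"
proof -
  obtain h where "\<And>i. h i \<in> module_iso k (C i) (D i)"
    using assms(2) by (auto simp: graded_isomorphic_def)
  then have "inv_into (carrier (C i)) (h i) \<in> module_iso k (D i) (C i)" for i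
    using module_iso_inv[OF assms(1)] by blast
  then show ?thesis
    unfolding graded_isomorphic_def by (intro exI[of _ "\<lambda>i. inv_into (carrier (C i)) (h i)"]) simp
qed

lemma graded_isomorphic_trans:
  assumes "graded_isomorphic k C D" "graded_isomorphic k D E"
  shows "graded_isomorphic k C E"
proof -
  obtain h where h: "\<And>i. h i \<in> module_iso k (C i) (D i)"
    using assms(1) by (auto simp: graded_isomorphic_def)
  obtain h' where h': "\<And>i. h' i \<in> module_iso k (D i) (E i)"
    using assms(2) by (auto simp: graded_isomorphic_def)
  have "h' i \<circ> h i \<in> module_iso k (C i) (E i)" for i
    by (rule module_iso_comp[OF h h'])
  then show ?thesis
    unfolding graded_isomorphic_def by (intro exI[of _ "\<lambda>i. h' i \<circ> h i"]) simp
qed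

section \<open>Homology of complexes of modules\<close>

locale chain_complex =
  fixes k :: "('k, 'z) ring_scheme" and C :: "nat \<Rightarrow> ('k, 'm) module" and d :: "nat \<Rightarrow> 'm \<Rightarrow> 'm"
  assumes module_C: "module k (C i)"
    and d_hom: "d i \<in> module_hom k (C (Suc i)) (C i)"
    and d_d: "x \<in> carrier (C (Suc (Suc i))) \<Longrightarrow> d i (d (Suc i) x) = \<zero>\<^bsub>C i\<^esub>"
begin

lemma submodule_cycles: "submodule (cycles C d i) k (C i)"
proof (cases i)
  case 0
  then show ?thesis
    using module.carrier_is_submodule[OF module_C] by (simp add: cycles_def)
next
  case (Suc j)
  then show ?thesis
    using kernel_submodule[OF module_C module_C d_hom] by (simp add: cycles_def)
qed

lemma cycles_subset: "cycles C d i \<subseteq> carrier (C i)"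
  by (auto simp: cycles_def split: nat.splits)

lemma boundary_in_cycles: "x \<in> carrier (C (Suc i)) \<Longrightarrow> d i x \<in> cycles C d i"
  using d_d module_hom_closed[OF d_hom] by (auto simp: cycles_def split: nat.splits)

lemma module_cycles: "module k (C i\<lparr>carrier := cycles C d i\<rparr>)"
  using submodule.submodule_is_module[OF submodule_cycles module_C] .

lemma submodule_boundaries:
  "submodule (d i ` carrier (C (Suc i))) k (C i\<lparr>carrier := cycles C d i\<rparr>)"
proof (rule image_submodule[OF module_C module_cycles])
  show "d i \<in> module_hom k (C (Suc i)) (C i\<lparr>carrier := cycles C d i\<rparr>)"
    using d_hom[of i] boundary_in_cycles by (auto simp: module_hom_def)
qed

lemma quotient_by_boundaries:
  "quotient_by_submodule k (C i\<lparr>carrier := cycles C d i\<rparr>) (d i ` carrier (C (Suc i)))"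
  using module_cycles submodule_boundaries by (simp add: quotient_by_submodule_def)

lemma module_homology: "module k (homology C d i)"
  unfolding homology_def by (rule quotient_by_submodule.quotient_module[OF quotient_by_boundaries])

end

text \<open>Bijectivity on homology is expressed through elements of the complexes, so that
  applications work with chains and never with cosets.\<close>

lemma quasi_isomorphism:
  fixes C :: "nat \<Rightarrow> ('k, 'm) module" and C' :: "nat \<Rightarrow> ('k, 'n) module"
  assumes C: "chain_complex k C d" and C': "chain_complex k C' d'"
    and F: "\<And>i. F i \<in> module_hom k (C i) (C' i)"
    and F_d: "\<And>i x. x \<in> carrier (C (Suc i)) \<Longrightarrow> F i (d i x) = d' i (F (Suc i) x)"
    and inj: "\<And>i x y. \<lbrakk>x \<in> cycles C d i; y \<in> carrier (C' (Suc i)); F i x = d' i y\<rbrakk>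
      \<Longrightarrow> \<exists>z\<in>carrier (C (Suc i)). x = d i z"
    and surj: "\<And>i y. y \<in> cycles C' d' i
      \<Longrightarrow> \<exists>x\<in>cycles C d i. \<exists>z\<in>carrier (C' (Suc i)). y \<ominus>\<^bsub>C' i\<^esub> F i x = d' i z"
  shows "graded_isomorphic k (homology C d) (homology C' d')"
proof -
  interpret C: chain_complex k C d by fact
  interpret C': chain_complex k C' d' by fact
  have F_cycles: "F i x \<in> cycles C' d' i" if x: "x \<in> cycles C d i" for i x
  proof -
    have xC: "x \<in> carrier (C i)" using x C.cycles_subset by auto
    show ?thesis
    proof (cases i)
      case 0
      then show ?thesis using module_hom_closed[OF F] xC by (auto simp: cycles_def)
    next
      case (Suc j)
      then have "d' j (F i x) = F j \<zero>\<^bsub>C j\<^esub>"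
        using F_d[of x j] x xC by (simp add: cycles_def)
      also have "\<dots> = \<zero>\<^bsub>C' j\<^esub>"
        by (rule module_hom_zero[OF C.module_C C'.module_C F])
      finally show ?thesis using module_hom_closed[OF F] xC Suc by (auto simp: cycles_def)
    qed
  qed
  have "\<exists>h. h \<in> module_iso k (homology C d i) (homology C' d' i)" for i
  proof -
    let ?Z = "C i\<lparr>carrier := cycles C d i\<rparr>" and ?Z' = "C' i\<lparr>carrier := cycles C' d' i\<rparr>"
    let ?B = "d i ` carrier (C (Suc i))" and ?B' = "d' i ` carrier (C' (Suc i))"
    interpret Q: quotient_by_submodule k ?Z ?B by (rule C.quotient_by_boundaries)
    interpret Q': quotient_by_submodule k ?Z' ?B' by (rule C'.quotient_by_boundaries)
    interpret Ci': module k "C' i" by (rule C'.module_C)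
    have FZ: "F i \<in> module_hom k ?Z ?Z'"
      using F_cycles F[of i] C.cycles_subset[of i] by (auto simp: module_hom_def subset_iff)
    \<comment> \<open>\<open>F\<close> followed by the projection to homology. By \<open>F_d\<close>
      and \<open>inj\<close> its kernel on the cycles is the set of boundaries, and by
      \<open>surj\<close> it is onto, so the isomorphism theorem applies.\<close>
    let ?f = "\<lambda>x. ?B' +>\<^bsub>?Z'\<^esub> F i x"
    have f: "?f \<in> module_hom k ?Z (homology C' d' i)"
      unfolding homology_def by (rule module_hom_comp[OF FZ Q'.coset_hom])
    have zero: "\<zero>\<^bsub>homology C' d' i\<^esub> = ?B'"
      by (simp add: homology_def quotient_module_def)
    \<comment> \<open>Negation in a record refers to its carrier, so subtraction among the cycles
      has to be identified with subtraction in \<open>C' i\<close>.\<close>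
    have minus: "x \<ominus>\<^bsub>?Z'\<^esub> y = x \<ominus>\<^bsub>C' i\<^esub> y" if "x \<in> cycles C' d' i" "y \<in> cycles C' d' i" for x y
    proof -
      have y: "\<ominus>\<^bsub>?Z'\<^esub> y \<in> cycles C' d' i" "\<ominus>\<^bsub>?Z'\<^esub> y \<oplus>\<^bsub>C' i\<^esub> y = \<zero>\<^bsub>C' i\<^esub>"
        using that Q'.M.a_inv_closed[of y] Q'.M.l_neg[of y] by simp_all
      then have "\<ominus>\<^bsub>C' i\<^esub> y = \<ominus>\<^bsub>?Z'\<^esub> y"
        using that C'.cycles_subset by (intro Ci'.minus_equality) auto
      then show ?thesis by (simp add: a_minus_def)
    qed
    have "(\<lambda>X. ?f (SOME x. x \<in> X)) \<in> module_iso k (quotient_module ?Z ?B) (homology C' d' i)"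
    proof (rule Q.quotient_iso[OF C'.module_homology f])
      fix Y assume "Y \<in> carrier (homology C' d' i)"
      then obtain y where y: "y \<in> cycles C' d' i" "Y = ?B' +>\<^bsub>?Z'\<^esub> y"
        unfolding homology_def by (auto elim: Q'.carrier_quotientE)
      then obtain x z where x: "x \<in> cycles C d i" and z: "z \<in> carrier (C' (Suc i))"
        and eq: "y \<ominus>\<^bsub>C' i\<^esub> F i x = d' i z"
        using surj by blast
      have "?B' +>\<^bsub>?Z'\<^esub> y = ?f x"
        using y z eq F_cycles[OF x] by (subst Q'.coset_eq_iff) (simp_all add: minus)
      then show "\<exists>x\<in>carrier ?Z. ?f x = Y" using y x by auto
    next
      have "x \<in> ?B \<longleftrightarrow> F i x \<in> ?B'" if x: "x \<in> cycles C d i" for x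
      proof
        assume "x \<in> ?B"
        then obtain z where z: "z \<in> carrier (C (Suc i))" "x = d i z" by blast
        then show "F i x \<in> ?B'" using F_d module_hom_closed[OF F] by auto
      next
        assume "F i x \<in> ?B'"
        then show "x \<in> ?B" using inj[OF x] by auto
      qed
      then have "?f x = ?B' \<longleftrightarrow> x \<in> ?B" if "x \<in> cycles C d i" for x
        using that F_cycles[OF that] Q'.coset_eq_zero_iff by simp
      then show "?B = {x \<in> carrier ?Z. ?f x = \<zero>\<^bsub>homology C' d' i\<^esub>}"
        unfolding zero using C.boundary_in_cycles by auto
    qed
    then show ?thesis by (auto simp: homology_def)
  qed
  then show ?thesis unfolding graded_isomorphic_def by metis
qed

section \<open>Free modules\<close>

lemma free_module_simps [simp]:
  "carrier (free_module A S) = fin_supp A S"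
  "\<zero>\<^bsub>free_module A S\<^esub> = (\<lambda>_. \<zero>\<^bsub>A\<^esub>)"
  "f \<oplus>\<^bsub>free_module A S\<^esub> g = (\<lambda>s. f s \<oplus>\<^bsub>A\<^esub> g s)"
  "a \<odot>\<^bsub>free_module A S\<^esub> f = (\<lambda>s. f s \<otimes>\<^bsub>A\<^esub> a)"
  by (simp_all add: free_module_def)

lemma (in ring) free_module_abelian_group: "abelian_group (free_module R S)"
proof (rule abelian_groupI)
  let ?F = "free_module R S"
  show "x \<oplus>\<^bsub>?F\<^esub> y \<in> carrier ?F" if "x \<in> carrier ?F" "y \<in> carrier ?F" for x y
    using that by simp
  show "x \<oplus>\<^bsub>?F\<^esub> y \<oplus>\<^bsub>?F\<^esub> z = x \<oplus>\<^bsub>?F\<^esub> (y \<oplus>\<^bsub>?F\<^esub> z)"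
    if "x \<in> carrier ?F" "y \<in> carrier ?F" "z \<in> carrier ?F" for x y z
    using fin_supp_closed[of x S] fin_supp_closed[of y S] fin_supp_closed[of z S] that
    by (simp add: a_assoc)
  show "x \<oplus>\<^bsub>?F\<^esub> y = y \<oplus>\<^bsub>?F\<^esub> x" if "x \<in> carrier ?F" "y \<in> carrier ?F" for x y
    using fin_supp_closed[of x S] fin_supp_closed[of y S] that by (simp add: a_comm)
  show "\<zero>\<^bsub>?F\<^esub> \<oplus>\<^bsub>?F\<^esub> x = x" if "x \<in> carrier ?F" for x
    using fin_supp_closed[of x S] that by simp
  show "\<exists>y\<in>carrier ?F. y \<oplus>\<^bsub>?F\<^esub> x = \<zero>\<^bsub>?F\<^esub>" if "x \<in> carrier ?F" for x
    by (rule bexI[of _ "\<lambda>s. \<ominus> x s"]) (use fin_supp_closed[of x S] that in \<open>simp_all add: l_neg\<close>)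
qed simp

lemma (in ring) free_module_neg:
  assumes f: "f \<in> fin_supp R S"
  shows "\<ominus>\<^bsub>free_module R S\<^esub> f = (\<lambda>s. \<ominus> f s)"
proof -
  interpret F: abelian_group "free_module R S" by (rule free_module_abelian_group)
  show ?thesis
    by (rule F.minus_equality) (use f in \<open>simp_all add: l_neg fin_supp_closed[OF f]\<close>)
qed

lemma (in ring) free_module_minus:
  "f \<in> fin_supp R S \<Longrightarrow> g \<in> fin_supp R S \<Longrightarrow> f \<ominus>\<^bsub>free_module R S\<^esub> g = (\<lambda>s. f s \<ominus> g s)"
  by (simp add: a_minus_def free_module_neg)

context cring
begin

lemma free_module_module: "module R (free_module R S)"
proof (rule moduleI[OF is_cring free_module_abelian_group])
  let ?F = "free_module R S"
  show "a \<odot>\<^bsub>?F\<^esub> x \<in> carrier ?F" if "a \<in> carrier R" "x \<in> carrier ?F" for a x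
    using that by simp
  show "(a \<oplus> b) \<odot>\<^bsub>?F\<^esub> x = a \<odot>\<^bsub>?F\<^esub> x \<oplus>\<^bsub>?F\<^esub> b \<odot>\<^bsub>?F\<^esub> x"
    if "a \<in> carrier R" "b \<in> carrier R" "x \<in> carrier ?F" for a b x
    using fin_supp_closed[of x S] that by (simp add: r_distr)
  show "a \<odot>\<^bsub>?F\<^esub> (x \<oplus>\<^bsub>?F\<^esub> y) = a \<odot>\<^bsub>?F\<^esub> x \<oplus>\<^bsub>?F\<^esub> a \<odot>\<^bsub>?F\<^esub> y"
    if "a \<in> carrier R" "x \<in> carrier ?F" "y \<in> carrier ?F" for a x y
    using fin_supp_closed[of x S] fin_supp_closed[of y S] that by (simp add: l_distr)
  show "(a \<otimes> b) \<odot>\<^bsub>?F\<^esub> x = a \<odot>\<^bsub>?F\<^esub> (b \<odot>\<^bsub>?F\<^esub> x)"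
    if "a \<in> carrier R" "b \<in> carrier R" "x \<in> carrier ?F" for a b x
    using fin_supp_closed[of x S] that by (simp add: m_ac)
  show "\<one> \<odot>\<^bsub>?F\<^esub> x = x" if "x \<in> carrier ?F" for x
    using fin_supp_closed[of x S] that by simp
qed

lemma lin_module_hom:
  assumes v: "v \<in> S \<rightarrow> fin_supp R T"
  shows "lin R v \<in> module_hom R (free_module R S) (free_module R T)"
proof -
  have "lin R v (\<lambda>s. f s \<otimes> c) = (\<lambda>t. lin R v f t \<otimes> c)" if "f \<in> fin_supp R S" "c \<in> carrier R" for f c
    by (rule ext) (rule lin_rmult[OF that(1) v that(2)])
  then show ?thesis
    using v by (simp add: module_hom_def lin_add[OF _ _ v])
qed

end

section \<open>Free resolutions and their comparison\<close>

text \<open>The augmentation of a based free module with values \<open>a\<close> on the basis.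
  Writing it as a matrix with a single row, indexed by \<open>unit\<close>, makes the rules for
  \<open>lin\<close> available.\<close>

definition res_aug ::
    "('k, 'z) ring_scheme \<Rightarrow> ('b \<Rightarrow> 'k) \<Rightarrow> ('s \<Rightarrow> 'k) \<Rightarrow> ('s \<Rightarrow> 'b) \<Rightarrow> 'k" where
  "res_aug k \<eta> a u = lin k (\<lambda>s (_::unit). a s) (\<lambda>s. \<eta> (u s)) ()"

text \<open>Cycles of the augmented complex: unlike in \<open>cycles\<close>, degree 0 asks for
  vanishing augmentation, so that exactness is one condition for all degrees.\<close>

definition res_cycles ::
    "('b, 'y) ring_scheme \<Rightarrow> ('k, 'z) ring_scheme \<Rightarrow> ('b \<Rightarrow> 'k) \<Rightarrow> (nat \<Rightarrow> 's set)
      \<Rightarrow> (nat \<Rightarrow> 's \<Rightarrow> 's \<Rightarrow> 'b) \<Rightarrow> ('s \<Rightarrow> 'k) \<Rightarrow> nat \<Rightarrow> ('s \<Rightarrow> 'b) set" where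
  "res_cycles B k \<eta> S v a i =
     {u \<in> fin_supp B (S i).
        case i of 0 \<Rightarrow> res_aug k \<eta> a u = \<zero>\<^bsub>k\<^esub> | Suc j \<Rightarrow> lin B (v j) u = (\<lambda>_. \<zero>\<^bsub>B\<^esub>)}"

lemma (in ring) lin_mat_zero:
  assumes "u \<in> fin_supp R S" "\<And>s. s \<in> S \<Longrightarrow> v s = (\<lambda>_. \<zero>)"
  shows "lin R v u = (\<lambda>_. \<zero>)"
proof -
  have "lin R v u = lin R (\<lambda>_ _. \<zero>) u"
    using assms by (intro lin_cong) auto
  also have "\<dots> = (\<lambda>_. \<zero>)"
    using fin_supp_closed[OF assms(1)] by (simp add: lin_def)
  finally show ?thesis .
qed

locale augmented_ring =
  fixes B :: "('b, 'y) ring_scheme" and k :: "('k, 'z) ring_scheme" and \<eta> :: "'b \<Rightarrow> 'k"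
  assumes ring_B: "ring B" and cring_k: "cring k" and \<eta>: "\<eta> \<in> ring_hom B k"
begin

sublocale B: ring B by (rule ring_B)
sublocale k: cring k by (rule cring_k)
sublocale \<eta>: ring_hom_ring B k \<eta>
  by (simp add: ring_hom_ringI2 ring_B k.ring_axioms \<eta>)

lemma push: "u \<in> fin_supp B X \<Longrightarrow> (\<lambda>s. \<eta> (u s)) \<in> fin_supp k X"
  by (rule fin_supp_hom[OF ring_B k.ring_axioms \<eta>])

lemma push_mat: "f \<in> X \<rightarrow> fin_supp B Y \<Longrightarrow> (\<lambda>s t. \<eta> (f s t)) \<in> X \<rightarrow> fin_supp k Y"
  using push by auto

lemma push_lin:
  "u \<in> fin_supp B X \<Longrightarrow> f \<in> X \<rightarrow> fin_supp B Y \<Longrightarrow>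
    (\<lambda>t. \<eta> (lin B f u t)) = lin k (\<lambda>s t. \<eta> (f s t)) (\<lambda>s. \<eta> (u s))"
  by (rule lin_hom[OF ring_B k.ring_axioms \<eta>])

lemma push_delta: "(\<lambda>t. \<eta> (delta B s t)) = delta k s"
  by (auto simp: delta_def)

lemma aug_mat: "a \<in> X \<rightarrow> carrier k \<Longrightarrow> (\<lambda>s (_::unit). a s) \<in> X \<rightarrow> fin_supp k UNIV"
  by (auto simp: fin_supp_def)

lemma res_aug_lin:
  assumes u: "u \<in> fin_supp B X" and f: "f \<in> X \<rightarrow> fin_supp B Y" and a: "a \<in> Y \<rightarrow> carrier k"
  shows "res_aug k \<eta> a (lin B f u) = res_aug k \<eta> (\<lambda>s. res_aug k \<eta> a (f s)) u"
  unfolding res_aug_def push_lin[OF u f]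
    k.lin_lin[OF push[OF u] push_mat[OF f] aug_mat[OF a]]
  by (rule arg_cong[where f = "\<lambda>g. lin k g _ ()"]) (auto simp: fun_eq_iff)

lemma aug_cong:
  assumes "u \<in> fin_supp B X" "\<And>s. s \<in> X \<Longrightarrow> b s = b' s" "b' \<in> X \<rightarrow> carrier k"
  shows "res_aug k \<eta> b u = res_aug k \<eta> b' u"
  unfolding res_aug_def using assms
  by (subst k.lin_cong[OF push[OF assms(1)], where w = "\<lambda>s _. b' s"]) auto

lemma res_aug_add:
  assumes u: "u \<in> fin_supp B Y" and w: "w \<in> fin_supp B Y" and a: "a \<in> Y \<rightarrow> carrier k"
  shows "res_aug k \<eta> a (\<lambda>s. u s \<oplus>\<^bsub>B\<^esub> w s) = res_aug k \<eta> a u \<oplus>\<^bsub>k\<^esub> res_aug k \<eta> a w"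
  by (simp add: res_aug_def B.fin_supp_closed[OF u] B.fin_supp_closed[OF w]
    k.lin_add[OF push[OF u] push[OF w] aug_mat[OF a]])

lemma res_aug_diff:
  assumes u: "u \<in> fin_supp B Y" and w: "w \<in> fin_supp B Y" and a: "a \<in> Y \<rightarrow> carrier k"
  shows "res_aug k \<eta> a (\<lambda>s. u s \<ominus>\<^bsub>B\<^esub> w s) = res_aug k \<eta> a u \<ominus>\<^bsub>k\<^esub> res_aug k \<eta> a w"
proof -
  have "(\<lambda>s. \<eta> (u s \<ominus>\<^bsub>B\<^esub> w s)) = (\<lambda>s. \<eta> (u s) \<ominus>\<^bsub>k\<^esub> \<eta> (w s))"
    by (simp add: a_minus_def B.fin_supp_closed[OF u] B.fin_supp_closed[OF w])
  then show ?thesis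
    by (simp add: res_aug_def k.lin_diff[OF push[OF u] push[OF w] aug_mat[OF a]])
qed

lemma res_aug_zero: "res_aug k \<eta> a (\<lambda>_. \<zero>\<^bsub>B\<^esub>) = \<zero>\<^bsub>k\<^esub>"
  by (simp add: res_aug_def)

lemma res_aug_single:
  assumes "a s \<in> carrier k" "c \<in> carrier B"
  shows "res_aug k \<eta> a (single B s c) = a s \<otimes>\<^bsub>k\<^esub> \<eta> c"
proof -
  have "(\<lambda>t. \<eta> (single B s c t)) = single k s (\<eta> c)" by (auto simp: single_def)
  then show ?thesis using assms by (simp add: res_aug_def k.lin_single)
qed

lemma res_aug_closed: "u \<in> fin_supp B Y \<Longrightarrow> a \<in> Y \<rightarrow> carrier k \<Longrightarrow> res_aug k \<eta> a u \<in> carrier k"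
  unfolding res_aug_def by (rule k.fin_supp_closed[OF k.lin_closed[OF push aug_mat]])

text \<open>Stated before resolutions and for one degree at a time, because
  \<open>bar_mat_cycle\<close> applies it while the complex property is still being established
  degree by degree.\<close>

lemma boundary_cycles:
  assumes v: "\<And>i. v i \<in> S (Suc i) \<rightarrow> fin_supp B (S i)" and a: "a \<in> S 0 \<rightarrow> carrier k"
    and v_cycle: "\<And>s. s \<in> S (Suc i) \<Longrightarrow> v i s \<in> res_cycles B k \<eta> S v a i"
    and u: "u \<in> fin_supp B (S (Suc i))"
  shows "lin B (v i) u \<in> res_cycles B k \<eta> S v a i"
proof (cases i)
  case 0
  have u0: "u \<in> fin_supp B (S (Suc 0))" using u 0 by simp
  have "res_aug k \<eta> a (lin B (v 0) u) = res_aug k \<eta> (\<lambda>s. res_aug k \<eta> a (v 0 s)) u"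
    by (rule res_aug_lin[OF u0 v a])
  also have "\<dots> = res_aug k \<eta> (\<lambda>s. \<zero>\<^bsub>k\<^esub>) u"
    by (rule aug_cong[OF u]) (use v_cycle 0 in \<open>auto simp: res_cycles_def\<close>)
  also have "\<dots> = \<zero>\<^bsub>k\<^esub>"
    by (simp add: res_aug_def k.lin_mat_zero[OF push[OF u]])
  finally show ?thesis using B.lin_closed[OF u v] 0 by (simp add: res_cycles_def)
next
  case (Suc j)
  have u': "u \<in> fin_supp B (S (Suc (Suc j)))" using u Suc by simp
  have "lin B (v j) (lin B (v (Suc j)) u) = lin B (\<lambda>s. lin B (v j) (v (Suc j) s)) u"
    by (rule B.lin_lin[OF u' v v])
  also have "\<dots> = (\<lambda>_. \<zero>\<^bsub>B\<^esub>)"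
    by (rule B.lin_mat_zero[OF u']) (use v_cycle Suc in \<open>auto simp: res_cycles_def\<close>)
  finally show ?thesis using B.lin_closed[OF u v] Suc by (simp add: res_cycles_def)
qed

end

text \<open>With chosen bases a resolution of the trivial module is a family of index sets and
  matrices: \<open>v i\<close> lists the boundaries of the basis of degree \<open>Suc i\<close>, and
  \<open>a\<close> the augmentations of the basis of degree 0.\<close>

locale free_resolution = augmented_ring B k \<eta>
  for B :: "('b, 'y) ring_scheme" and k :: "('k, 'z) ring_scheme" and \<eta> :: "'b \<Rightarrow> 'k" +
  fixes S :: "nat \<Rightarrow> 's set" and v :: "nat \<Rightarrow> 's \<Rightarrow> 's \<Rightarrow> 'b" and a :: "'s \<Rightarrow> 'k"
  assumes v: "v i \<in> S (Suc i) \<rightarrow> fin_supp B (S i)"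
    and a: "a \<in> S 0 \<rightarrow> carrier k"
    and v_cycle: "s \<in> S (Suc i) \<Longrightarrow> v i s \<in> res_cycles B k \<eta> S v a i"
    and exact: "u \<in> res_cycles B k \<eta> S v a i \<Longrightarrow> \<exists>x\<in>fin_supp B (S (Suc i)). lin B (v i) x = u"
    and aug_surj: "c \<in> carrier k \<Longrightarrow> \<exists>u\<in>fin_supp B (S 0). res_aug k \<eta> a u = c"
begin

abbreviation "aug \<equiv> res_aug k \<eta> a"
abbreviation "cyc \<equiv> res_cycles B k \<eta> S v a"

lemmas aug_lin = res_aug_lin[OF _ _ a]
lemmas aug_diff = res_aug_diff[OF _ _ a]

lemma aug_delta: "s \<in> S 0 \<Longrightarrow> aug (delta B s) = a s"
  using a by (simp add: delta_eq_single res_aug_single Pi_iff)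

lemma cyc_subset: "u \<in> cyc i \<Longrightarrow> u \<in> fin_supp B (S i)"
  by (simp add: res_cycles_def)

text \<open>Applying \<open>\<eta>\<close> to all entries amounts to tensoring with the trivial
  module; \<open>tensor_complex\<close> makes this precise.\<close>

abbreviation "C i \<equiv> free_module k (S i)"
abbreviation "\<delta> i \<equiv> lin k (\<lambda>s t. \<eta> (v i s t))"

lemma \<delta>_\<delta>:
  assumes x: "x \<in> fin_supp k (S (Suc (Suc i)))"
  shows "\<delta> i (\<delta> (Suc i) x) = (\<lambda>_. \<zero>\<^bsub>k\<^esub>)"
  unfolding k.lin_lin[OF x push_mat[OF v] push_mat[OF v]]
proof (rule k.lin_mat_zero[OF x])
  fix s assume s: "s \<in> S (Suc (Suc i))"
  then have vs: "v (Suc i) s \<in> fin_supp B (S (Suc i))" using v by auto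
  show "\<delta> i (\<lambda>t. \<eta> (v (Suc i) s t)) = (\<lambda>_. \<zero>\<^bsub>k\<^esub>)"
    using v_cycle[OF s] unfolding push_lin[OF vs v, symmetric]
    by (simp add: res_cycles_def)
qed

lemma chain_complex_reduction: "chain_complex k C \<delta>"
  by (rule chain_complex.intro) (simp_all add: k.free_module_module k.lin_module_hom[OF push_mat[OF v]] \<delta>_\<delta>)

text \<open>The lift is chain homotopic to the identity; exactness provides the homotopy degree by degree.\<close>

lemma lift_of_id_homology:
  assumes \<theta>: "\<And>i. \<theta> i \<in> S i \<rightarrow> fin_supp B (S i)"
    and \<theta>_aug: "\<And>s. s \<in> S 0 \<Longrightarrow> aug (\<theta> 0 s) = a s"
    and \<theta>_v: "\<And>i s. s \<in> S (Suc i) \<Longrightarrow> lin B (v i) (\<theta> (Suc i) s) = lin B (\<theta> i) (v i s)"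
    and x: "x \<in> cycles C \<delta> i"
  shows "\<exists>z\<in>fin_supp k (S (Suc i)). (\<lambda>s. lin k (\<lambda>s t. \<eta> (\<theta> i s t)) x s \<ominus>\<^bsub>k\<^esub> x s) = \<delta> i z"
proof -
  define \<rho> where "\<rho> i s = (\<lambda>t. \<theta> i s t \<ominus>\<^bsub>B\<^esub> delta B s t)" for i s
  have delta_mat: "delta B \<in> S i \<rightarrow> fin_supp B (S i)" for i by auto
  have \<rho>: "\<rho> i \<in> S i \<rightarrow> fin_supp B (S i)" for i
    using B.fin_supp_diff[OF funcset_mem[OF \<theta>] B.fin_supp_delta] by (auto simp: \<rho>_def)
  have \<rho>_lin: "lin B (\<rho> i) u = (\<lambda>t. lin B (\<theta> i) u t \<ominus>\<^bsub>B\<^esub> u t)" if "u \<in> fin_supp B (S i)" for i u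
    unfolding \<rho>_def B.lin_mat_diff[OF that \<theta> delta_mat] B.lin_id[OF that] ..
  have \<rho>_v: "lin B (v i) (\<rho> (Suc i) s) = lin B (\<rho> i) (v i s)" if s: "s \<in> S (Suc i)" for i s
  proof -
    have \<theta>s: "\<theta> (Suc i) s \<in> fin_supp B (S (Suc i))" and vs: "v i s \<in> fin_supp B (S i)"
      using \<theta> v s by auto
    have "lin B (v i) (\<rho> (Suc i) s) = (\<lambda>t. lin B (\<theta> i) (v i s) t \<ominus>\<^bsub>B\<^esub> v i s t)"
      unfolding \<rho>_def B.lin_diff[OF \<theta>s B.fin_supp_delta[OF s] v]
      by (simp add: \<theta>_v[OF s] B.lin_delta B.mat_closed[OF v s])
    then show ?thesis by (simp add: \<rho>_lin[OF vs])
  qed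
  have \<rho>_aug: "\<rho> 0 s \<in> cyc 0" if s: "s \<in> S 0" for s
  proof -
    have "\<theta> 0 s \<in> fin_supp B (S 0)" using \<theta> s by auto
    then have "aug (\<rho> 0 s) = \<zero>\<^bsub>k\<^esub>"
      unfolding \<rho>_def
      using \<theta>_aug[OF s] aug_delta[OF s] a s
      by (simp add: aug_diff[OF _ B.fin_supp_delta[OF s]] k.minus_eq_zero_iff Pi_iff)
    then show ?thesis using \<rho> s by (auto simp: res_cycles_def)
  qed
  \<comment> \<open>The homotopy identity is \<open>v h + h v = \<rho>\<close>. The recursion
    remembers its consequence \<open>v h = \<rho>\<close> on cycles, where the other summand
    vanishes; \<open>Q\<close> records the full identity on basis elements. In degree 0 there is no
    other summand, so \<open>v h = \<rho>\<close> is asked on the whole basis.\<close>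
  define P where "P i h \<longleftrightarrow> h \<in> S i \<rightarrow> fin_supp B (S (Suc i)) \<and>
    (\<forall>u\<in>cyc i. lin B (v i) (lin B h u) = lin B (\<rho> i) u) \<and>
    (i = 0 \<longrightarrow> (\<forall>s\<in>S 0. lin B (v 0) (h s) = \<rho> 0 s))" for i h
  define Q where "Q i h h' \<longleftrightarrow> (\<forall>s\<in>S (Suc i).
    (\<lambda>t. lin B (v (Suc i)) (h' s) t \<oplus>\<^bsub>B\<^esub> lin B h (v i s) t) = \<rho> (Suc i) s)" for i h h'
  have "\<exists>h. \<forall>i. P i (h i) \<and> Q i (h i) (h (Suc i))"
  proof (rule dependent_nat_choice)
    have "\<forall>s\<in>S 0. \<exists>y\<in>fin_supp B (S (Suc 0)). lin B (v 0) y = \<rho> 0 s"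
      using exact \<rho>_aug by blast
    then obtain h where h: "\<And>s. s \<in> S 0 \<Longrightarrow> h s \<in> fin_supp B (S (Suc 0))"
      "\<And>s. s \<in> S 0 \<Longrightarrow> lin B (v 0) (h s) = \<rho> 0 s"
      by metis
    have hm: "h \<in> S 0 \<rightarrow> fin_supp B (S (Suc 0))" using h by auto
    have "lin B (v 0) (lin B h u) = lin B (\<rho> 0) u" if "u \<in> cyc 0" for u
      unfolding B.lin_lin[OF cyc_subset[OF that] hm v]
      by (rule B.lin_cong[OF cyc_subset[OF that]]) (use h B.mat_closed[OF \<rho>] in auto)
    then show "\<exists>h. P 0 h" using h hm by (auto simp: P_def)
  next
    fix h i assume "P i h"
    then have h: "h \<in> S i \<rightarrow> fin_supp B (S (Suc i))"
      and hv: "\<And>u. u \<in> cyc i \<Longrightarrow> lin B (v i) (lin B h u) = lin B (\<rho> i) u"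
      by (auto simp: P_def)
    have "\<exists>y\<in>fin_supp B (S (Suc (Suc i))).
        lin B (v (Suc i)) y = (\<lambda>t. \<rho> (Suc i) s t \<ominus>\<^bsub>B\<^esub> lin B h (v i s) t)" if s: "s \<in> S (Suc i)" for s
    proof (rule exact)
      have vs: "v i s \<in> fin_supp B (S i)" and \<rho>s: "\<rho> (Suc i) s \<in> fin_supp B (S (Suc i))"
        using v \<rho> s by auto
      \<comment> \<open>The vector to be hit is a cycle: \<open>v\<close> sends
        \<open>\<rho> s\<close> to \<open>\<rho> (v s)\<close>, and by the invariant it sends
        \<open>h (v s)\<close> there as well, since \<open>v s\<close> is a cycle.\<close>
      have "lin B (v i) (\<lambda>t. \<rho> (Suc i) s t \<ominus>\<^bsub>B\<^esub> lin B h (v i s) t) =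
        (\<lambda>t. lin B (\<rho> i) (v i s) t \<ominus>\<^bsub>B\<^esub> lin B (\<rho> i) (v i s) t)"
        unfolding B.lin_diff[OF \<rho>s B.lin_closed[OF vs h] v]
        by (simp add: \<rho>_v[OF s] hv[OF v_cycle[OF s]])
      also have "\<dots> = (\<lambda>_. \<zero>\<^bsub>B\<^esub>)"
        using B.fin_supp_closed[OF B.lin_closed[OF vs \<rho>]] by (intro ext) (simp add: B.minus_eq_zero_iff)
      finally show "(\<lambda>t. \<rho> (Suc i) s t \<ominus>\<^bsub>B\<^esub> lin B h (v i s) t) \<in> cyc (Suc i)"
        using \<rho>s B.lin_closed[OF vs h] by (simp add: res_cycles_def)
    qed
    then obtain h' where h': "\<And>s. s \<in> S (Suc i) \<Longrightarrow> h' s \<in> fin_supp B (S (Suc (Suc i)))"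
      "\<And>s. s \<in> S (Suc i) \<Longrightarrow> lin B (v (Suc i)) (h' s) = (\<lambda>t. \<rho> (Suc i) s t \<ominus>\<^bsub>B\<^esub> lin B h (v i s) t)"
      by metis
    have h'm: "h' \<in> S (Suc i) \<rightarrow> fin_supp B (S (Suc (Suc i)))" using h' by auto
    have hvm: "(\<lambda>s. lin B h (v i s)) \<in> S (Suc i) \<rightarrow> fin_supp B (S (Suc i))"
      using h v by (auto simp: Pi_iff)
    have "lin B (v (Suc i)) (lin B h' u) = lin B (\<rho> (Suc i)) u" if u: "u \<in> cyc (Suc i)" for u
    proof -
      note u' = cyc_subset[OF u]
      have "lin B (v (Suc i)) (lin B h' u) =
        lin B (\<lambda>s t. \<rho> (Suc i) s t \<ominus>\<^bsub>B\<^esub> lin B h (v i s) t) u"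
        unfolding B.lin_lin[OF u' h'm v]
        by (rule B.lin_cong[OF u' h'(2)])
          (simp_all add: B.mat_closed[OF \<rho>] B.mat_closed[OF hvm])
      also have "\<dots> = (\<lambda>t. lin B (\<rho> (Suc i)) u t \<ominus>\<^bsub>B\<^esub> lin B (\<lambda>s. lin B h (v i s)) u t)"
        by (rule B.lin_mat_diff[OF u' \<rho> hvm])
      also have "lin B (\<lambda>s. lin B h (v i s)) u = lin B h (lin B (v i) u)"
        by (rule B.lin_lin[OF u' v h, symmetric])
      also have "\<dots> = (\<lambda>_. \<zero>\<^bsub>B\<^esub>)"
        using u by (simp add: res_cycles_def)
      finally show ?thesis
        using B.fin_supp_closed[OF B.lin_closed[OF u' \<rho>]] by (simp add: a_minus_def)
    qed
    moreover have "Q i h h'"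
      unfolding Q_def
      by (simp add: h'(2) a_minus_def B.a_assoc B.l_neg B.mat_closed[OF \<rho>] B.mat_closed[OF hvm])
    ultimately show "\<exists>h'. P (Suc i) h' \<and> Q i h h'"
      using h'm by (auto simp: P_def)
  qed
  then obtain h where PQ: "\<And>i. P i (h i)" "\<And>i. Q i (h i) (h (Suc i))" by blast
  have h: "h i \<in> S i \<rightarrow> fin_supp B (S (Suc i))" for i using PQ(1)[of i] by (simp add: P_def)
  have x': "x \<in> fin_supp k (S i)" using x by (auto simp: cycles_def split: nat.splits)
  let ?h = "\<lambda>i s t. \<eta> (h i s t)" and ?\<rho> = "\<lambda>s t. \<eta> (\<rho> i s t)"
  \<comment> \<open>In the reduced complex
    \<open>\<rho> x = \<delta> (h x) + h (\<delta> x)\<close>, and the second summand is zero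
    because \<open>x\<close> is a cycle; in degree 0 it is absent.\<close>
  have "lin k ?\<rho> x = \<delta> i (lin k (?h i) x)"
  proof (cases i)
    case 0
    show ?thesis
      unfolding k.lin_lin[OF x' push_mat[OF h] push_mat[OF v]]
    proof (rule k.lin_cong[OF x', symmetric])
      fix s assume s: "s \<in> S i"
      then have "h i s \<in> fin_supp B (S (Suc i))" using h by auto
      then have "\<delta> i (?h i s) = (\<lambda>t. \<eta> (lin B (v i) (h i s) t))"
        by (rule push_lin[OF _ v, symmetric])
      also have "\<dots> = ?\<rho> s" using PQ(1)[of i] s 0 by (simp add: P_def)
      finally show "\<delta> i (?h i s) = ?\<rho> s" .
    qed (use k.mat_closed[OF push_mat[OF \<rho>]] in auto)
  next
    case (Suc j)
    have x'': "x \<in> fin_supp k (S (Suc j))" using x' Suc by simp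
    have dx: "\<delta> j x = (\<lambda>_. \<zero>\<^bsub>k\<^esub>)" using x Suc by (simp add: cycles_def)
    have m1: "(\<lambda>s. \<delta> i (?h i s)) \<in> S i \<rightarrow> fin_supp k (S i)"
      using k.lin_closed[OF _ push_mat[OF v]] push_mat[OF h] by (auto simp: Pi_iff)
    have m2: "(\<lambda>s. lin k (?h j) (\<lambda>t. \<eta> (v j s t))) \<in> S i \<rightarrow> fin_supp k (S i)"
      using k.lin_closed[OF _ push_mat[OF h]] push_mat[OF v] Suc by (auto simp: Pi_iff)
    have "lin k ?\<rho> x = lin k (\<lambda>s t. \<delta> i (?h i s) t \<oplus>\<^bsub>k\<^esub> lin k (?h j) (\<lambda>t. \<eta> (v j s t)) t) x"
    proof (rule k.lin_cong[OF x'])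
      fix s assume s: "s \<in> S i"
      then have hs: "h i s \<in> fin_supp B (S (Suc i))" and vs: "v j s \<in> fin_supp B (S j)"
        using h v[of j] Suc by auto
      have "\<rho> i s = (\<lambda>t. lin B (v i) (h i s) t \<oplus>\<^bsub>B\<^esub> lin B (h j) (v j s) t)"
        using PQ(2)[of j] s Suc by (simp add: Q_def)
      then have "?\<rho> s = (\<lambda>t. \<eta> (lin B (v i) (h i s) t) \<oplus>\<^bsub>k\<^esub> \<eta> (lin B (h j) (v j s) t))"
        using B.fin_supp_closed[OF B.lin_closed[OF hs v]] B.fin_supp_closed[OF B.lin_closed[OF vs h]]
        by simp
      also have "\<dots> = (\<lambda>t. \<delta> i (?h i s) t \<oplus>\<^bsub>k\<^esub> lin k (?h j) (\<lambda>t. \<eta> (v j s t)) t)"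
        by (simp only: push_lin[OF hs v, symmetric] push_lin[OF vs h, symmetric])
      finally show "?\<rho> s = (\<lambda>t. \<delta> i (?h i s) t \<oplus>\<^bsub>k\<^esub> lin k (?h j) (\<lambda>t. \<eta> (v j s t)) t)" .
    qed (simp add: k.mat_closed[OF m1] k.mat_closed[OF m2])
    also have "\<dots> = (\<lambda>t. lin k (\<lambda>s. \<delta> i (?h i s)) x t \<oplus>\<^bsub>k\<^esub>
        lin k (\<lambda>s. lin k (?h j) (\<lambda>t. \<eta> (v j s t))) x t)"
      by (rule k.lin_mat_add[OF x' m1 m2])
    also have "lin k (\<lambda>s. lin k (?h j) (\<lambda>t. \<eta> (v j s t))) x = lin k (?h j) (\<delta> j x)"
      by (rule k.lin_lin[OF x'' push_mat[OF v] push_mat[OF h], symmetric])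
    also have "lin k (\<lambda>s. \<delta> i (?h i s)) x = \<delta> i (lin k (?h i) x)"
      by (rule k.lin_lin[OF x' push_mat[OF h] push_mat[OF v], symmetric])
    finally show ?thesis
      using k.fin_supp_closed[OF k.lin_closed[OF k.lin_closed[OF x' push_mat[OF h]] push_mat[OF v]]]
      by (simp add: dx)
  qed
  moreover have "lin k ?\<rho> x = (\<lambda>s. lin k (\<lambda>s t. \<eta> (\<theta> i s t)) x s \<ominus>\<^bsub>k\<^esub> x s)"
  proof -
    have "lin k ?\<rho> x = lin k (\<lambda>s t. \<eta> (\<theta> i s t) \<ominus>\<^bsub>k\<^esub> delta k s t) x"
    proof (rule k.lin_cong[OF x'])
      fix s assume s: "s \<in> S i"
      show "?\<rho> s = (\<lambda>t. \<eta> (\<theta> i s t) \<ominus>\<^bsub>k\<^esub> delta k s t)"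
        using B.mat_closed[OF \<theta> s] B.fin_supp_closed[OF B.fin_supp_delta[OF s]]
        by (simp add: \<rho>_def a_minus_def fun_cong[OF push_delta])
      show "\<eta> (\<theta> i s t) \<ominus>\<^bsub>k\<^esub> delta k s t \<in> carrier k" for t
        using B.mat_closed[OF \<theta> s] k.fin_supp_closed[OF k.fin_supp_delta[OF s]] by simp
    qed
    also have "\<dots> = (\<lambda>s. lin k (\<lambda>s t. \<eta> (\<theta> i s t)) x s \<ominus>\<^bsub>k\<^esub> lin k (delta k) x s)"
      by (rule k.lin_mat_diff[OF x' push_mat[OF \<theta>]]) auto
    finally show ?thesis by (simp add: k.lin_id[OF x'])
  qed
  ultimately have "(\<lambda>s. lin k (\<lambda>s t. \<eta> (\<theta> i s t)) x s \<ominus>\<^bsub>k\<^esub> x s) = \<delta> i (lin k (?h i) x)"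
    by simp
  then show ?thesis
    using k.lin_closed[OF x' push_mat[OF h]] by blast
qed

end

text \<open>Freeness of the source permits a separate choice for each basis element, and exactness
  of the target guarantees that there is something to choose.\<close>

lemma lift_exists:
  fixes S :: "nat \<Rightarrow> 's set" and T :: "nat \<Rightarrow> 't set"
  assumes "free_resolution B k \<eta> S v a" and "free_resolution B k \<eta> T w b"
  shows "\<exists>\<phi>. (\<forall>i. \<phi> i \<in> S i \<rightarrow> fin_supp B (T i)) \<and>
    (\<forall>s\<in>S 0. res_aug k \<eta> b (\<phi> 0 s) = a s) \<and>
    (\<forall>i. \<forall>s\<in>S (Suc i). lin B (w i) (\<phi> (Suc i) s) = lin B (\<phi> i) (v i s))"
proof -
  interpret P: free_resolution B k \<eta> S v a by fact
  interpret Q: free_resolution B k \<eta> T w b by fact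
  \<comment> \<open>Sending cycles to cycles is the invariant: the boundary \<open>v i s\<close> is
    a cycle, so its image is one too and exactness of the target applies to it.\<close>
  define R where "R i f \<longleftrightarrow> f \<in> S i \<rightarrow> fin_supp B (T i) \<and> (\<forall>u\<in>P.cyc i. lin B f u \<in> Q.cyc i) \<and>
    (i = 0 \<longrightarrow> (\<forall>s\<in>S 0. Q.aug (f s) = a s))" for i f
  have "\<exists>f. \<forall>i. R i (f i) \<and> (\<forall>s\<in>S (Suc i). lin B (w i) (f (Suc i) s) = lin B (f i) (v i s))"
  proof (rule dependent_nat_choice)
    have "\<forall>s\<in>S 0. \<exists>y\<in>fin_supp B (T 0). Q.aug y = a s"
      using P.a Q.aug_surj by blast
    then obtain f where f: "\<And>s. s \<in> S 0 \<Longrightarrow> f s \<in> fin_supp B (T 0)"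
      "\<And>s. s \<in> S 0 \<Longrightarrow> Q.aug (f s) = a s"
      by metis
    have fm: "f \<in> S 0 \<rightarrow> fin_supp B (T 0)" using f by auto
    have "lin B f u \<in> Q.cyc 0" if u: "u \<in> P.cyc 0" for u
    proof -
      note u' = P.cyc_subset[OF u]
      have "Q.aug (lin B f u) = res_aug k \<eta> (\<lambda>s. Q.aug (f s)) u"
        by (rule Q.aug_lin[OF u' fm])
      also have "\<dots> = P.aug u"
        by (rule P.aug_cong[OF u' f(2) P.a])
      also have "\<dots> = \<zero>\<^bsub>k\<^esub>" using u by (simp add: res_cycles_def)
      finally show ?thesis using P.B.lin_closed[OF u' fm] by (simp add: res_cycles_def)
    qed
    then show "\<exists>f. R 0 f" using f fm by (auto simp: R_def)
  next
    fix f i assume "R i f"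
    then have f: "f \<in> S i \<rightarrow> fin_supp B (T i)" and fc: "\<And>u. u \<in> P.cyc i \<Longrightarrow> lin B f u \<in> Q.cyc i"
      by (auto simp: R_def)
    have "\<forall>s\<in>S (Suc i). \<exists>y\<in>fin_supp B (T (Suc i)). lin B (w i) y = lin B f (v i s)"
      using Q.exact fc P.v_cycle by blast
    then obtain g where g: "\<And>s. s \<in> S (Suc i) \<Longrightarrow> g s \<in> fin_supp B (T (Suc i))"
      "\<And>s. s \<in> S (Suc i) \<Longrightarrow> lin B (w i) (g s) = lin B f (v i s)"
      by metis
    have gm: "g \<in> S (Suc i) \<rightarrow> fin_supp B (T (Suc i))" using g by auto
    have fvm: "(\<lambda>s. lin B f (v i s)) \<in> S (Suc i) \<rightarrow> fin_supp B (T i)"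
      using P.B.lin_closed[OF _ f] P.v[of i] by (auto simp: Pi_iff)
    have "lin B g u \<in> Q.cyc (Suc i)" if u: "u \<in> P.cyc (Suc i)" for u
    proof -
      note u' = P.cyc_subset[OF u]
      have "lin B (w i) (lin B g u) = lin B (\<lambda>s. lin B f (v i s)) u"
        unfolding P.B.lin_lin[OF u' gm Q.v]
        by (rule P.B.lin_cong[OF u' g(2) P.B.mat_closed[OF fvm]])
      also have "\<dots> = lin B f (lin B (v i) u)"
        by (rule P.B.lin_lin[OF u' P.v f, symmetric])
      also have "\<dots> = (\<lambda>_. \<zero>\<^bsub>B\<^esub>)" using u by (simp add: res_cycles_def)
      finally show ?thesis using P.B.lin_closed[OF u' gm] by (simp add: res_cycles_def)
    qed
    then show "\<exists>g. R (Suc i) g \<and> (\<forall>s\<in>S (Suc i). lin B (w i) (g s) = lin B f (v i s))"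
      using g gm by (auto simp: R_def)
  qed
  then obtain f where f: "\<And>i. R i (f i)"
    "\<And>i. \<forall>s\<in>S (Suc i). lin B (w i) (f (Suc i) s) = lin B (f i) (v i s)"
    by blast
  then show ?thesis by (intro exI[of _ f]) (auto simp: R_def)
qed

text \<open>Lifts in opposite directions compose to a lift of the identity, so
  \<open>lift_of_id_homology\<close> takes the place of uniqueness of lifts up to homotopy.\<close>

lemma lift_composite:
  fixes S :: "nat \<Rightarrow> 's set" and T :: "nat \<Rightarrow> 't set"
  assumes "free_resolution B k \<eta> S v a" and "free_resolution B k \<eta> T w b"
    and \<phi>: "\<And>i. \<phi> i \<in> S i \<rightarrow> fin_supp B (T i)"
    and \<phi>_aug: "\<And>s. s \<in> S 0 \<Longrightarrow> res_aug k \<eta> b (\<phi> 0 s) = a s"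
    and \<phi>_v: "\<And>i s. s \<in> S (Suc i) \<Longrightarrow> lin B (w i) (\<phi> (Suc i) s) = lin B (\<phi> i) (v i s)"
    and \<psi>: "\<And>i. \<psi> i \<in> T i \<rightarrow> fin_supp B (S i)"
    and \<psi>_aug: "\<And>t. t \<in> T 0 \<Longrightarrow> res_aug k \<eta> a (\<psi> 0 t) = b t"
    and \<psi>_w: "\<And>i t. t \<in> T (Suc i) \<Longrightarrow> lin B (v i) (\<psi> (Suc i) t) = lin B (\<psi> i) (w i t)"
    and x: "x \<in> cycles (\<lambda>i. free_module k (S i)) (\<lambda>i. lin k (\<lambda>s t. \<eta> (v i s t))) i"
  shows "\<exists>z\<in>fin_supp k (S (Suc i)).
    (\<lambda>s. lin k (\<lambda>s t. \<eta> (\<psi> i s t)) (lin k (\<lambda>s t. \<eta> (\<phi> i s t)) x) s \<ominus>\<^bsub>k\<^esub> x s) =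
    lin k (\<lambda>s t. \<eta> (v i s t)) z"
proof -
  interpret P: free_resolution B k \<eta> S v a by fact
  interpret Q: free_resolution B k \<eta> T w b by fact
  define \<theta> where "\<theta> i s = lin B (\<psi> i) (\<phi> i s)" for i s
  have \<phi>s: "\<phi> i s \<in> fin_supp B (T i)" if "s \<in> S i" for i s using \<phi> that by auto
  have \<theta>: "\<theta> i \<in> S i \<rightarrow> fin_supp B (S i)" for i
    using P.B.lin_closed[OF \<phi>s \<psi>] by (auto simp: \<theta>_def)
  have \<theta>_aug: "P.aug (\<theta> 0 s) = a s" if s: "s \<in> S 0" for s
  proof -
    have "P.aug (\<theta> 0 s) = res_aug k \<eta> (\<lambda>t. P.aug (\<psi> 0 t)) (\<phi> 0 s)"
      unfolding \<theta>_def by (rule P.aug_lin[OF \<phi>s[OF s] \<psi>])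
    also have "\<dots> = Q.aug (\<phi> 0 s)"
      by (rule P.aug_cong[OF \<phi>s[OF s] \<psi>_aug Q.a])
    finally show ?thesis using \<phi>_aug[OF s] by simp
  qed
  have \<theta>_v: "lin B (v i) (\<theta> (Suc i) s) = lin B (\<theta> i) (v i s)" if s: "s \<in> S (Suc i)" for i s
  proof -
    have vs: "v i s \<in> fin_supp B (S i)" using P.v s by auto
    have m: "(\<lambda>t. lin B (\<psi> i) (w i t)) \<in> T (Suc i) \<rightarrow> fin_supp B (S i)"
      using P.B.lin_closed[OF _ \<psi>] Q.v[of i] by (auto simp: Pi_iff)
    have "lin B (v i) (\<theta> (Suc i) s) = lin B (\<lambda>t. lin B (v i) (\<psi> (Suc i) t)) (\<phi> (Suc i) s)"
      unfolding \<theta>_def by (rule P.B.lin_lin[OF \<phi>s[OF s] \<psi> P.v])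
    also have "\<dots> = lin B (\<lambda>t. lin B (\<psi> i) (w i t)) (\<phi> (Suc i) s)"
      by (rule P.B.lin_cong[OF \<phi>s[OF s] \<psi>_w P.B.mat_closed[OF m]])
    also have "\<dots> = lin B (\<psi> i) (lin B (w i) (\<phi> (Suc i) s))"
      by (rule P.B.lin_lin[OF \<phi>s[OF s] Q.v \<psi>, symmetric])
    also have "\<dots> = lin B (\<psi> i) (lin B (\<phi> i) (v i s))" by (simp add: \<phi>_v[OF s])
    also have "\<dots> = lin B (\<theta> i) (v i s)"
      unfolding \<theta>_def by (rule P.B.lin_lin[OF vs \<phi> \<psi>])
    finally show ?thesis .
  qed
  have x': "x \<in> fin_supp k (S i)" using x by (auto simp: cycles_def split: nat.splits)
  have "lin k (\<lambda>s t. \<eta> (\<theta> i s t)) x = lin k (\<lambda>s t. \<eta> (\<psi> i s t)) (lin k (\<lambda>s t. \<eta> (\<phi> i s t)) x)"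
    unfolding P.k.lin_lin[OF x' P.push_mat[OF \<phi>] P.push_mat[OF \<psi>]]
  proof (rule P.k.lin_cong[OF x'])
    fix s assume s: "s \<in> S i"
    show "(\<lambda>t. \<eta> (\<theta> i s t)) = lin k (\<lambda>s t. \<eta> (\<psi> i s t)) (\<lambda>t. \<eta> (\<phi> i s t))"
      unfolding \<theta>_def by (rule P.push_lin[OF \<phi>s[OF s] \<psi>])
    show "lin k (\<lambda>s t. \<eta> (\<psi> i s t)) (\<lambda>t. \<eta> (\<phi> i s t)) t \<in> carrier k" for t
      by (rule P.k.fin_supp_closed[OF P.k.lin_closed[OF P.push[OF \<phi>s[OF s]] P.push_mat[OF \<psi>]]])
  qed
  then show ?thesis using P.lift_of_id_homology[of \<theta>, OF \<theta> \<theta>_aug \<theta>_v x] by simp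
qed

lemma lift_commutes:
  fixes S :: "nat \<Rightarrow> 's set" and T :: "nat \<Rightarrow> 't set"
  assumes "free_resolution B k \<eta> S v a" and "free_resolution B k \<eta> T w b"
    and \<phi>: "\<And>i. \<phi> i \<in> S i \<rightarrow> fin_supp B (T i)"
    and \<phi>_v: "\<And>i s. s \<in> S (Suc i) \<Longrightarrow> lin B (w i) (\<phi> (Suc i) s) = lin B (\<phi> i) (v i s)"
    and x: "x \<in> fin_supp k (S (Suc i))"
  shows "lin k (\<lambda>s t. \<eta> (\<phi> i s t)) (lin k (\<lambda>s t. \<eta> (v i s t)) x) =
    lin k (\<lambda>s t. \<eta> (w i s t)) (lin k (\<lambda>s t. \<eta> (\<phi> (Suc i) s t)) x)"
proof -
  interpret P: free_resolution B k \<eta> S v a by fact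
  interpret Q: free_resolution B k \<eta> T w b by fact
  show ?thesis
    unfolding P.k.lin_lin[OF x P.push_mat[OF P.v] P.push_mat[OF \<phi>]]
      P.k.lin_lin[OF x P.push_mat[OF \<phi>] P.push_mat[OF Q.v]]
  proof (rule P.k.lin_cong[OF x])
    fix s assume s: "s \<in> S (Suc i)"
    have vs: "v i s \<in> fin_supp B (S i)" and \<phi>s: "\<phi> (Suc i) s \<in> fin_supp B (T (Suc i))"
      using P.v \<phi> s by auto
    show "lin k (\<lambda>s t. \<eta> (\<phi> i s t)) (\<lambda>t. \<eta> (v i s t)) =
      lin k (\<lambda>s t. \<eta> (w i s t)) (\<lambda>t. \<eta> (\<phi> (Suc i) s t))"
      unfolding P.push_lin[OF vs \<phi>, symmetric] P.push_lin[OF \<phi>s Q.v, symmetric] \<phi>_v[OF s] ..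
    show "lin k (\<lambda>s t. \<eta> (w i s t)) (\<lambda>t. \<eta> (\<phi> (Suc i) s t)) t \<in> carrier k" for t
      by (rule P.k.fin_supp_closed[OF P.k.lin_closed[OF P.push[OF \<phi>s] P.push_mat[OF Q.v]]])
  qed
qed

theorem resolution_comparison:
  fixes S :: "nat \<Rightarrow> 's set" and T :: "nat \<Rightarrow> 't set"
  assumes P: "free_resolution B k \<eta> S v a" and Q: "free_resolution B k \<eta> T w b"
  shows "graded_isomorphic k
    (homology (\<lambda>i. free_module k (S i)) (\<lambda>i. lin k (\<lambda>s t. \<eta> (v i s t))))
    (homology (\<lambda>i. free_module k (T i)) (\<lambda>i. lin k (\<lambda>s t. \<eta> (w i s t))))"
proof -
  interpret P: free_resolution B k \<eta> S v a by fact
  interpret Q: free_resolution B k \<eta> T w b by fact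
  obtain \<phi> where \<phi>: "\<And>i. \<phi> i \<in> S i \<rightarrow> fin_supp B (T i)"
    and \<phi>_aug: "\<And>s. s \<in> S 0 \<Longrightarrow> Q.aug (\<phi> 0 s) = a s"
    and \<phi>_v: "\<And>i s. s \<in> S (Suc i) \<Longrightarrow> lin B (w i) (\<phi> (Suc i) s) = lin B (\<phi> i) (v i s)"
    using lift_exists[OF P Q] by blast
  obtain \<psi> where \<psi>: "\<And>i. \<psi> i \<in> T i \<rightarrow> fin_supp B (S i)"
    and \<psi>_aug: "\<And>t. t \<in> T 0 \<Longrightarrow> P.aug (\<psi> 0 t) = b t"
    and \<psi>_w: "\<And>i t. t \<in> T (Suc i) \<Longrightarrow> lin B (v i) (\<psi> (Suc i) t) = lin B (\<psi> i) (w i t)"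
    using lift_exists[OF Q P] by blast
  let ?F = "\<lambda>i. lin k (\<lambda>s t. \<eta> (\<phi> i s t))" and ?G = "\<lambda>i. lin k (\<lambda>s t. \<eta> (\<psi> i s t))"
  note F_closed = P.k.lin_closed[OF _ P.push_mat[OF \<phi>]]
  note G_closed = P.k.lin_closed[OF _ P.push_mat[OF \<psi>]]
  have F_d: "?F i (P.\<delta> i x) = Q.\<delta> i (?F (Suc i) x)" if "x \<in> fin_supp k (S (Suc i))" for i x
    by (rule lift_commutes[OF P Q \<phi> \<phi>_v that])
  have G_d: "?G i (Q.\<delta> i x) = P.\<delta> i (?G (Suc i) x)" if "x \<in> fin_supp k (T (Suc i))" for i x
    by (rule lift_commutes[OF Q P \<psi> \<psi>_w that])
  have GF: "\<exists>z\<in>fin_supp k (S (Suc i)). (\<lambda>s. ?G i (?F i x) s \<ominus>\<^bsub>k\<^esub> x s) = P.\<delta> i z"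
    if "x \<in> cycles P.C P.\<delta> i" for i x
    by (rule lift_composite[OF P Q \<phi> \<phi>_aug \<phi>_v \<psi> \<psi>_aug \<psi>_w that])
  have FG: "\<exists>z\<in>fin_supp k (T (Suc i)). (\<lambda>s. ?F i (?G i x) s \<ominus>\<^bsub>k\<^esub> x s) = Q.\<delta> i z"
    if "x \<in> cycles Q.C Q.\<delta> i" for i x
    by (rule lift_composite[OF Q P \<psi> \<psi>_aug \<psi>_w \<phi> \<phi>_aug \<phi>_v that])
  show ?thesis
  proof (rule quasi_isomorphism[where F = ?F])
    show "chain_complex k P.C P.\<delta>" "chain_complex k Q.C Q.\<delta>"
      by (rule P.chain_complex_reduction, rule Q.chain_complex_reduction)
    show "?F i \<in> module_hom k (P.C i) (Q.C i)" for i
      by (rule P.k.lin_module_hom[OF P.push_mat[OF \<phi>]])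
    show "?F i (P.\<delta> i x) = Q.\<delta> i (?F (Suc i) x)" if "x \<in> carrier (P.C (Suc i))" for i x
      using F_d that by simp
  next
    fix i x y
    assume x: "x \<in> cycles P.C P.\<delta> i" and y: "y \<in> carrier (Q.C (Suc i))" and xy: "?F i x = Q.\<delta> i y"
    have x': "x \<in> fin_supp k (S i)" using x by (auto simp: cycles_def split: nat.splits)
    have y': "y \<in> fin_supp k (T (Suc i))" using y by simp
    obtain z where z: "z \<in> fin_supp k (S (Suc i))"
      and eq: "(\<lambda>s. ?G i (?F i x) s \<ominus>\<^bsub>k\<^esub> x s) = P.\<delta> i z"
      using GF[OF x] by blast
    \<comment> \<open>As \<open>F x\<close> is the boundary of \<open>y\<close>,
      \<open>G (F x)\<close> is the boundary of \<open>G y\<close>; subtracting \<open>z\<close>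
      corrects for the difference between \<open>G (F x)\<close> and \<open>x\<close>.\<close>
    have "P.\<delta> i (\<lambda>s. ?G (Suc i) y s \<ominus>\<^bsub>k\<^esub> z s) = (\<lambda>s. ?G i (?F i x) s \<ominus>\<^bsub>k\<^esub> P.\<delta> i z s)"
      unfolding P.k.lin_diff[OF G_closed[OF y'] z P.push_mat[OF P.v]] xy G_d[OF y'] ..
    also have "\<dots> = x"
    proof
      fix s
      have c: "?G i (?F i x) s \<in> carrier k" "x s \<in> carrier k"
        by (rule P.k.fin_supp_closed[OF G_closed[OF F_closed[OF x']]], rule P.k.fin_supp_closed[OF x'])
      show "?G i (?F i x) s \<ominus>\<^bsub>k\<^esub> P.\<delta> i z s = x s"
        unfolding eq[symmetric] using c
        by (simp add: a_minus_def P.k.minus_add P.k.a_assoc[symmetric] P.k.r_neg)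
    qed
    finally show "\<exists>z\<in>carrier (P.C (Suc i)). x = P.\<delta> i z"
      using P.k.fin_supp_diff[OF G_closed[OF y'] z]
      by (intro bexI[of _ "\<lambda>s. ?G (Suc i) y s \<ominus>\<^bsub>k\<^esub> z s"]) simp_all
  next
    fix i y
    assume y: "y \<in> cycles Q.C Q.\<delta> i"
    have y': "y \<in> fin_supp k (T i)" using y by (auto simp: cycles_def split: nat.splits)
    have Gy: "?G i y \<in> cycles P.C P.\<delta> i"
    proof (cases i)
      case 0
      then show ?thesis using G_closed[OF y'] by (simp add: cycles_def)
    next
      case (Suc j)
      have y'': "y \<in> fin_supp k (T (Suc j))" using y' Suc by simp
      have "P.\<delta> j (?G (Suc j) y) = ?G j (Q.\<delta> j y)" by (rule G_d[OF y'', symmetric])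
      also have "\<dots> = (\<lambda>_. \<zero>\<^bsub>k\<^esub>)" using y Suc by (simp add: cycles_def)
      finally show ?thesis using G_closed[OF y''] Suc by (simp add: cycles_def)
    qed
    obtain z where z: "z \<in> fin_supp k (T (Suc i))"
      and eq: "(\<lambda>s. ?F i (?G i y) s \<ominus>\<^bsub>k\<^esub> y s) = Q.\<delta> i z"
      using FG[OF y] by blast
    \<comment> \<open>\<open>FG\<close> bounds \<open>F (G y) - y\<close>, whereas the criterion
      asks for the opposite difference; hence the sign.\<close>
    have "y \<ominus>\<^bsub>Q.C i\<^esub> ?F i (?G i y) = Q.\<delta> i (\<lambda>s. \<ominus>\<^bsub>k\<^esub> z s)"
      unfolding P.k.lin_neg[OF z P.push_mat[OF Q.v]] eq[symmetric]
        P.k.free_module_minus[OF y' F_closed[OF G_closed[OF y']]]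
    proof
      fix s
      have c: "?F i (?G i y) s \<in> carrier k" "y s \<in> carrier k"
        by (rule P.k.fin_supp_closed[OF F_closed[OF G_closed[OF y']]], rule P.k.fin_supp_closed[OF y'])
      then show "y s \<ominus>\<^bsub>k\<^esub> ?F i (?G i y) s = \<ominus>\<^bsub>k\<^esub> (?F i (?G i y) s \<ominus>\<^bsub>k\<^esub> y s)"
        by (simp add: a_minus_def P.k.minus_add P.k.a_comm)
    qed
    then show "\<exists>x\<in>cycles P.C P.\<delta> i. \<exists>z\<in>carrier (Q.C (Suc i)). y \<ominus>\<^bsub>Q.C i\<^esub> ?F i x = Q.\<delta> i z"
      using Gy P.k.fin_supp_neg[OF z] by auto
  qed
qed

text \<open>Meant for differentials that are awkward to handle, such as maps between sets of cosets:
  linearity of \<open>d\<close> and \<open>d d = 0\<close> are pulled back along the injective maps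
  \<open>F i\<close>.\<close>

lemma transport_chain_complex:
  fixes C :: "nat \<Rightarrow> ('k, 'm) module" and C' :: "nat \<Rightarrow> ('k, 'n) module"
  assumes C': "chain_complex k C' d'" and C: "\<And>i. module k (C i)"
    and F: "\<And>i. F i \<in> module_iso k (C i) (C' i)"
    and d: "\<And>i x. x \<in> carrier (C (Suc i)) \<Longrightarrow> d i x \<in> carrier (C i)"
    and F_d: "\<And>i x. x \<in> carrier (C (Suc i)) \<Longrightarrow> F i (d i x) = d' i (F (Suc i) x)"
  shows "chain_complex k C d" "graded_isomorphic k (homology C d) (homology C' d')"
proof -
  interpret C': chain_complex k C' d' by fact
  have Fh: "F i \<in> module_hom k (C i) (C' i)" for i
    using F[of i] by (auto simp: module_iso_def module_hom_def bij_betw_def)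
  have F_inj: "x = y" if "F i x = F i y" "x \<in> carrier (C i)" "y \<in> carrier (C i)" for i x y
    using F[of i] that by (auto simp: module_iso_def bij_betw_def inj_on_def)
  have F_surj: "\<exists>x\<in>carrier (C i). F i x = y" if "y \<in> carrier (C' i)" for i y
  proof -
    have "y \<in> F i ` carrier (C i)" using F[of i] that by (simp add: module_iso_def bij_betw_def)
    then show ?thesis by blast
  qed
  note Fc = module_hom_closed[OF Fh]
  note dh = C'.d_hom
  show cc: "chain_complex k C d"
  proof (rule chain_complex.intro[OF C])
    fix i
    interpret Ci: module k "C i" by (rule C)
    interpret Csi: module k "C (Suc i)" by (rule C)
    show "d i \<in> module_hom k (C (Suc i)) (C i)"
      unfolding module_hom_def
    proof (intro CollectI conjI ballI)
      show "d i \<in> carrier (C (Suc i)) \<rightarrow> carrier (C i)" using d by auto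
      fix x y assume xy: "x \<in> carrier (C (Suc i))" "y \<in> carrier (C (Suc i))"
      show "d i (x \<oplus>\<^bsub>C (Suc i)\<^esub> y) = d i x \<oplus>\<^bsub>C i\<^esub> d i y"
        by (rule F_inj[of i])
          (simp_all add: xy d F_d module_hom_add[OF Fh] module_hom_add[OF dh] Fc)
    next
      fix c x assume c: "c \<in> carrier k" and x: "x \<in> carrier (C (Suc i))"
      show "d i (c \<odot>\<^bsub>C (Suc i)\<^esub> x) = c \<odot>\<^bsub>C i\<^esub> d i x"
        by (rule F_inj[of i])
          (simp_all add: c x d F_d module_hom_smult[OF Fh] module_hom_smult[OF dh] Fc)
    qed
    fix x assume x: "x \<in> carrier (C (Suc (Suc i)))"
    show "d i (d (Suc i) x) = \<zero>\<^bsub>C i\<^esub>"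
      by (rule F_inj[of i])
        (simp_all add: x d F_d Fc C'.d_d module_hom_zero[OF C C'.module_C Fh])
  qed
  show "graded_isomorphic k (homology C d) (homology C' d')"
  proof (rule quasi_isomorphism[OF cc C' Fh F_d])
    fix i x y
    assume x: "x \<in> cycles C d i" and y: "y \<in> carrier (C' (Suc i))" and xy: "F i x = d' i y"
    obtain z where z: "z \<in> carrier (C (Suc i))" "F (Suc i) z = y" using F_surj[OF y] by blast
    have "F i x = F i (d i z)" using xy z F_d by simp
    then have "x = d i z"
      using x z d chain_complex.cycles_subset[OF cc] by (intro F_inj[of i]) auto
    then show "\<exists>z\<in>carrier (C (Suc i)). x = d i z" using z by blast
  next
    fix i y assume y: "y \<in> cycles C' d' i"
    interpret Ci: module k "C i" by (rule C)
    interpret Csi: module k "C (Suc i)" by (rule C)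
    interpret C'i: module k "C' i" by (rule C'.module_C)
    have y': "y \<in> carrier (C' i)" using y C'.cycles_subset by auto
    obtain x where x: "x \<in> carrier (C i)" "F i x = y" using F_surj[OF y'] by blast
    have "x \<in> cycles C d i"
    proof (cases i)
      case 0
      then show ?thesis using x by (simp add: cycles_def)
    next
      case (Suc j)
      have "F j (d j x) = \<zero>\<^bsub>C' j\<^esub>" using F_d[of x j] x y Suc by (simp add: cycles_def)
      also have "\<dots> = F j \<zero>\<^bsub>C j\<^esub>" by (rule module_hom_zero[OF C C'.module_C Fh, symmetric])
      finally have "d j x = \<zero>\<^bsub>C j\<^esub>"
        using x Suc d abelian_group.axioms(1)[OF module.axioms(2)[OF C]]
        by (intro F_inj[of j]) (auto intro: abelian_monoid.zero_closed)
      then show ?thesis using x Suc by (simp add: cycles_def)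
    qed
    moreover have "y \<ominus>\<^bsub>C' i\<^esub> F i x = d' i \<zero>\<^bsub>C' (Suc i)\<^esub>"
      using x y' by (simp add: C'i.minus_eq_zero_iff module_hom_zero[OF C'.module_C C'.module_C dh])
    moreover have "\<zero>\<^bsub>C' (Suc i)\<^esub> \<in> carrier (C' (Suc i))"
      using abelian_group.axioms(1)[OF module.axioms(2)[OF C'.module_C]]
      by (rule abelian_monoid.zero_closed)
    ultimately show "\<exists>x\<in>cycles C d i. \<exists>z\<in>carrier (C' (Suc i)). y \<ominus>\<^bsub>C' i\<^esub> F i x = d' i z"
      by blast
  qed
qed

section \<open>Tensor products with the trivial module\<close>

lemma (in module) submodule_span:
  assumes "X \<subseteq> carrier M"
  shows "submodule (submodule_span R M X) R M"
proof (rule submoduleI)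
  show "submodule_span R M X \<subseteq> carrier M"
    using assms carrier_is_submodule by (auto simp: submodule_span_def)
  show "\<zero>\<^bsub>M\<^esub> \<in> submodule_span R M X"
    using submodule.axioms(1) subgroup.one_closed by (fastforce simp: submodule_span_def)
qed (auto simp: submodule_span_def intro: submoduleE)

lemma submodule_span_superset: "X \<subseteq> submodule_span k M X"
  by (auto simp: submodule_span_def)

lemma submodule_span_least: "submodule H k M \<Longrightarrow> X \<subseteq> H \<Longrightarrow> submodule_span k M X \<subseteq> H"
  by (auto simp: submodule_span_def)

lemma (in cring) free_module_hom_ext:
  assumes N: "module R N" and f: "f \<in> module_hom R (free_module R X) N"
    and g: "g \<in> module_hom R (free_module R X) N"
    and eq: "\<And>p. p \<in> X \<Longrightarrow> f (delta R p) = g (delta R p)"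
    and u: "u \<in> fin_supp R X"
  shows "f u = g u"
  using u
proof (induction rule: fin_supp_induct)
  case zero
  show ?case
    using module_hom_zero[OF free_module_module N f] module_hom_zero[OF free_module_module N g] by simp
next
  case (single p c)
  have "single R p c = c \<odot>\<^bsub>free_module R X\<^esub> delta R p"
    using single by (auto simp: single_def delta_def)
  then show ?case
    using single eq module_hom_smult[OF f, of c "delta R p"] module_hom_smult[OF g, of c "delta R p"]
    by simp
next
  case (add x y)
  then show ?case
    using module_hom_add[OF f, of x y] module_hom_add[OF g, of x y] by simp
qed

lemma (in cring) free_map_eq_lin:
  assumes u: "u \<in> fin_supp R X" and h: "h \<in> X \<rightarrow> Y"
  shows "free_map R h u = lin R (\<lambda>s. delta R (h s)) u"
proof
  fix t
  have "free_map R h u t = (\<Oplus>s\<in>{s. u s \<noteq> \<zero>}. delta R (h s) t \<otimes> u s)"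
    unfolding free_map_def
    by (rule add.finprod_mono_neutral_cong_left)
      (auto simp: fin_supp_finite[OF u] fin_supp_closed[OF u] delta_def)
  then show "free_map R h u t = lin R (\<lambda>s. delta R (h s)) u t" by (simp add: lin_def)
qed

text \<open>\<open>N\<close> is \<open>k\<close> with \<open>A\<close> acting through
  \<open>\<eta>\<close>. The two scalar assumptions say that \<open>\<eta>\<close> splits the map
  from \<open>k\<close> to \<open>A\<close>, so that the scalar relations of the tensor product are
  respected in \<open>k\<close>.\<close>

locale augmented_algebra = augmented_ring A k \<eta>
  for A :: "('k, 'a) module" and k :: "('k, 'z) ring_scheme" and \<eta> :: "'a \<Rightarrow> 'k" +
  fixes N :: "('a, 'k) module"
  assumes scalar_closed: "c \<in> carrier k \<Longrightarrow> c \<odot>\<^bsub>A\<^esub> \<one>\<^bsub>A\<^esub> \<in> carrier A"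
    and \<eta>_scalar: "c \<in> carrier k \<Longrightarrow> \<eta> (c \<odot>\<^bsub>A\<^esub> \<one>\<^bsub>A\<^esub>) = c"
    and carrier_N: "carrier N = carrier k"
    and add_N: "x \<oplus>\<^bsub>N\<^esub> y = x \<oplus>\<^bsub>k\<^esub> y"
    and smult_N: "b \<in> carrier A \<Longrightarrow> x \<in> carrier k \<Longrightarrow> b \<odot>\<^bsub>N\<^esub> x = \<eta> b \<otimes>\<^bsub>k\<^esub> x"
begin

abbreviation "pairs S \<equiv> fin_supp A S \<times> carrier k"
abbreviation "F S \<equiv> free_module k (pairs S)"
abbreviation "K S \<equiv> tensor_kernel k A (free_module A S) N"
abbreviation "Tens S \<equiv> tensor k A (free_module A S) N"
abbreviation "e \<equiv> \<lambda>m x. delta k (m, x)"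

text \<open>Before relations are divided out, this is the isomorphism of \<open>A\<close>-vectors
  tensored with \<open>N\<close> onto \<open>k\<close>-vectors; \<open>embed_mat\<close> induces its
  inverse.\<close>

definition contract_mat :: "('s \<Rightarrow> 'a) \<times> 'k \<Rightarrow> 's \<Rightarrow> 'k" where
  "contract_mat = (\<lambda>(u, x) s. \<eta> (u s) \<otimes>\<^bsub>k\<^esub> x)"

abbreviation "contract \<equiv> lin k contract_mat"

definition embed_mat :: "'s \<Rightarrow> ('s \<Rightarrow> 'a) \<times> 'k \<Rightarrow> 'k" where
  "embed_mat s = delta k (delta A s, \<one>\<^bsub>k\<^esub>)"

lemma pairs: "tensor_pairs k (free_module A S) N = F S"
  by (simp add: tensor_pairs_def carrier_N)

lemma contract_mat: "contract_mat \<in> pairs S \<rightarrow> fin_supp k S"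
  using k.fin_supp_rmult[OF push] by (auto simp: contract_mat_def)

lemma embed_mat: "embed_mat \<in> S \<rightarrow> fin_supp k (pairs S)"
  by (auto simp: embed_mat_def)

lemma contract_delta: "p \<in> pairs S \<Longrightarrow> contract (delta k p) = contract_mat p"
  by (rule k.lin_delta, rule k.mat_closed[OF contract_mat])

lemma contract_embed:
  assumes y: "y \<in> fin_supp k S"
  shows "contract (lin k embed_mat y) = y"
proof -
  have "contract (lin k embed_mat y) = lin k (\<lambda>s. contract (embed_mat s)) y"
    by (rule k.lin_lin[OF y embed_mat contract_mat])
  also have "\<dots> = lin k (delta k) y"
  proof (rule k.lin_cong[OF y])
    fix s assume s: "s \<in> S"
    have "contract (embed_mat s) = contract_mat (delta A s, \<one>\<^bsub>k\<^esub>)"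
      unfolding embed_mat_def by (rule contract_delta[where S = S]) (use s in auto)
    also have "\<dots> = delta k s" by (auto simp: contract_mat_def delta_def)
    finally show "contract (embed_mat s) = delta k s" .
    show "delta k s t \<in> carrier k" for t by (simp add: delta_def)
  qed
  finally show ?thesis by (simp add: k.lin_id[OF y])
qed

lemma contract_hom: "contract \<in> module_hom k (F S) (free_module k S)"
  by (rule k.lin_module_hom[OF contract_mat])

lemma embed_hom: "lin k embed_mat \<in> module_hom k (free_module k S) (F S)"
  by (rule k.lin_module_hom[OF embed_mat])

text \<open>Operations of the free \<open>A\<close>-module are unfolded and those of
  \<open>F S\<close> are kept, so that rules for linear maps on \<open>F S\<close> still
  match.\<close>

lemma relatorsE:
  assumes "r \<in> tensor_relators k A (free_module A S) N"
  obtains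
    (add1) m m' x where "m \<in> fin_supp A S" "m' \<in> fin_supp A S" "x \<in> carrier k"
      "r = e (\<lambda>s. m s \<oplus>\<^bsub>A\<^esub> m' s) x \<ominus>\<^bsub>F S\<^esub> (e m x \<oplus>\<^bsub>F S\<^esub> e m' x)"
  | (add2) m x x' where "m \<in> fin_supp A S" "x \<in> carrier k" "x' \<in> carrier k"
      "r = e m (x \<oplus>\<^bsub>k\<^esub> x') \<ominus>\<^bsub>F S\<^esub> (e m x \<oplus>\<^bsub>F S\<^esub> e m x')"
  | (act) b m x where "b \<in> carrier A" "m \<in> fin_supp A S" "x \<in> carrier k"
      "r = e (\<lambda>s. m s \<otimes>\<^bsub>A\<^esub> b) x \<ominus>\<^bsub>F S\<^esub> e m (\<eta> b \<otimes>\<^bsub>k\<^esub> x)"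
  | (scalar) c m x where "c \<in> carrier k" "m \<in> fin_supp A S" "x \<in> carrier k"
      "r = c \<odot>\<^bsub>F S\<^esub> e m x \<ominus>\<^bsub>F S\<^esub> e (\<lambda>s. m s \<otimes>\<^bsub>A\<^esub> (c \<odot>\<^bsub>A\<^esub> \<one>\<^bsub>A\<^esub>)) x"
  using assms unfolding tensor_relators_def Let_def pairs
  by (auto simp: carrier_N add_N smult_N simp del: free_module_simps(3,4)
      simp add: free_module_simps(3,4)[of A])

lemma relators_intro:
  "\<lbrakk>m \<in> fin_supp A S; m' \<in> fin_supp A S; x \<in> carrier k\<rbrakk> \<Longrightarrow>
    e (\<lambda>s. m s \<oplus>\<^bsub>A\<^esub> m' s) x \<ominus>\<^bsub>F S\<^esub> (e m x \<oplus>\<^bsub>F S\<^esub> e m' x) \<in> tensor_relators k A (free_module A S) N"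
  "\<lbrakk>b \<in> carrier A; m \<in> fin_supp A S; x \<in> carrier k\<rbrakk> \<Longrightarrow>
    e (\<lambda>s. m s \<otimes>\<^bsub>A\<^esub> b) x \<ominus>\<^bsub>F S\<^esub> e m (\<eta> b \<otimes>\<^bsub>k\<^esub> x) \<in> tensor_relators k A (free_module A S) N"
  "\<lbrakk>c \<in> carrier k; m \<in> fin_supp A S; x \<in> carrier k\<rbrakk> \<Longrightarrow>
    c \<odot>\<^bsub>F S\<^esub> e m x \<ominus>\<^bsub>F S\<^esub> e (\<lambda>s. m s \<otimes>\<^bsub>A\<^esub> (c \<odot>\<^bsub>A\<^esub> \<one>\<^bsub>A\<^esub>)) x
      \<in> tensor_relators k A (free_module A S) N"
proof goal_cases
  case 1
  then show ?case
    unfolding tensor_relators_def Let_def pairs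
    by (intro UnI1 CollectI exI[of _ m] exI[of _ m'] exI[of _ x])
      (simp add: carrier_N del: free_module_simps(3), simp add: free_module_simps(3)[of A] del: free_module_simps(3))
next
  case 2
  then show ?case
    unfolding tensor_relators_def Let_def pairs
    by (intro UnI1 UnI2 CollectI exI[of _ b] exI[of _ m] exI[of _ x])
      (simp add: carrier_N smult_N)
next
  case 3
  then show ?case
    unfolding tensor_relators_def Let_def pairs
    by (intro UnI2 CollectI exI[of _ c] exI[of _ m] exI[of _ x])
      (simp add: carrier_N)
qed

lemma contract_mat_add1:
  "\<lbrakk>m \<in> fin_supp A S; m' \<in> fin_supp A S; x \<in> carrier k\<rbrakk> \<Longrightarrow>
    contract_mat (\<lambda>s. m s \<oplus>\<^bsub>A\<^esub> m' s, x) = (\<lambda>s. contract_mat (m, x) s \<oplus>\<^bsub>k\<^esub> contract_mat (m', x) s)"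
  by (simp add: contract_mat_def B.fin_supp_closed[of m S] B.fin_supp_closed[of m' S] k.l_distr)

lemma contract_mat_act:
  "\<lbrakk>b \<in> carrier A; m \<in> fin_supp A S; x \<in> carrier k\<rbrakk> \<Longrightarrow>
    contract_mat (\<lambda>s. m s \<otimes>\<^bsub>A\<^esub> b, x) = contract_mat (m, \<eta> b \<otimes>\<^bsub>k\<^esub> x)"
  by (simp add: contract_mat_def B.fin_supp_closed[of m S] k.m_assoc)

lemma relators_kernel:
  assumes "r \<in> tensor_relators k A (free_module A S) N"
  shows "r \<in> fin_supp k (pairs S) \<and> contract r = (\<lambda>_. \<zero>\<^bsub>k\<^esub>)"
proof -
  interpret F: module k "F S" by (rule k.free_module_module)
  interpret C: module k "free_module k S" by (rule k.free_module_module)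
  \<comment> \<open>Each relator is a difference, so it suffices that its two sides have the same
    contraction.\<close>
  have *: "x \<ominus>\<^bsub>F S\<^esub> y \<in> fin_supp k (pairs S) \<and> contract (x \<ominus>\<^bsub>F S\<^esub> y) = (\<lambda>_. \<zero>\<^bsub>k\<^esub>)"
    if "x \<in> carrier (F S)" "y \<in> carrier (F S)" "contract x = contract y" for x y
  proof -
    have "contract (x \<ominus>\<^bsub>F S\<^esub> y) = \<zero>\<^bsub>free_module k S\<^esub>"
      unfolding module_hom_minus[OF k.free_module_module k.free_module_module contract_hom that(1,2)]
      by (rule iffD2[OF C.M.minus_eq_zero_iff that(3)]; rule module_hom_closed[OF contract_hom]; fact that)
    moreover have "x \<ominus>\<^bsub>F S\<^esub> y \<in> carrier (F S)" by (rule F.M.minus_closed[OF that(1,2)])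
    ultimately show ?thesis by (simp only: free_module_simps)
  qed
  have ec: "e m x \<in> carrier (F S)" if "m \<in> fin_supp A S" "x \<in> carrier k" for m x
    using that by simp
  have ce: "contract (e m x) = contract_mat (m, x)" if "m \<in> fin_supp A S" "x \<in> carrier k" for m x
    by (rule contract_delta[where S = S]) (use that in auto)
  from assms show ?thesis
  proof (cases rule: relatorsE)
    case (add1 m m' x)
    note ec1 = ec[OF add1(1,3)] and ec2 = ec[OF add1(2,3)]
    have m: "(\<lambda>s. m s \<oplus>\<^bsub>A\<^esub> m' s) \<in> fin_supp A S" using add1(1,2) by (rule B.fin_supp_add)
    have eq: "contract (e (\<lambda>s. m s \<oplus>\<^bsub>A\<^esub> m' s) x) = contract (e m x \<oplus>\<^bsub>F S\<^esub> e m' x)"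
      unfolding module_hom_add[OF contract_hom ec1 ec2] ce[OF add1(1,3)] ce[OF add1(2,3)] ce[OF m add1(3)]
        contract_mat_add1[OF add1(1-3)] unfolding free_module_simps ..
    show ?thesis unfolding add1(4)
      by (rule *[OF ec[OF m add1(3)] F.M.a_closed[OF ec1 ec2] eq])
  next
    case (add2 m x x')
    note ec1 = ec[OF add2(1,2)] and ec2 = ec[OF add2(1,3)]
    have x: "x \<oplus>\<^bsub>k\<^esub> x' \<in> carrier k" using add2(2,3) by simp
    have "contract_mat (m, x \<oplus>\<^bsub>k\<^esub> x') = (\<lambda>s. contract_mat (m, x) s \<oplus>\<^bsub>k\<^esub> contract_mat (m, x') s)"
      using add2(2,3) by (simp add: contract_mat_def B.fin_supp_closed[OF add2(1)] k.r_distr)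
    then have eq: "contract (e m (x \<oplus>\<^bsub>k\<^esub> x')) = contract (e m x \<oplus>\<^bsub>F S\<^esub> e m x')"
      unfolding module_hom_add[OF contract_hom ec1 ec2] ce[OF add2(1,2)] ce[OF add2(1,3)] ce[OF add2(1) x]
      unfolding free_module_simps .
    show ?thesis unfolding add2(4)
      by (rule *[OF ec[OF add2(1) x] F.M.a_closed[OF ec1 ec2] eq])
  next
    case (act b m x)
    have m: "(\<lambda>s. m s \<otimes>\<^bsub>A\<^esub> b) \<in> fin_supp A S" and x: "\<eta> b \<otimes>\<^bsub>k\<^esub> x \<in> carrier k"
      using act(1-3) by simp_all
    have eq: "contract (e (\<lambda>s. m s \<otimes>\<^bsub>A\<^esub> b) x) = contract (e m (\<eta> b \<otimes>\<^bsub>k\<^esub> x))"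
      unfolding ce[OF m act(3)] ce[OF act(2) x] by (rule contract_mat_act[OF act(1-3)])
    show ?thesis unfolding act(4)
      by (rule *[OF ec[OF m act(3)] ec[OF act(2) x] eq])
  next
    case (scalar c m x)
    have m: "(\<lambda>s. m s \<otimes>\<^bsub>A\<^esub> (c \<odot>\<^bsub>A\<^esub> \<one>\<^bsub>A\<^esub>)) \<in> fin_supp A S"
      using scalar(2) scalar_closed[OF scalar(1)] by (rule B.fin_supp_rmult)
    have "contract (c \<odot>\<^bsub>F S\<^esub> e m x) = c \<odot>\<^bsub>free_module k S\<^esub> contract_mat (m, x)"
      unfolding module_hom_smult[OF contract_hom scalar(1) ec[OF scalar(2,3)]] ce[OF scalar(2,3)] ..
    also have "\<dots> = contract_mat (m, c \<otimes>\<^bsub>k\<^esub> x)"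
      using scalar(1-3) by (simp add: contract_mat_def B.fin_supp_closed[of m S] k.m_ac)
    also have "\<dots> = contract_mat (\<lambda>s. m s \<otimes>\<^bsub>A\<^esub> (c \<odot>\<^bsub>A\<^esub> \<one>\<^bsub>A\<^esub>), x)"
      using scalar(1-3) by (simp add: contract_mat_act[OF scalar_closed] \<eta>_scalar)
    also have "\<dots> = contract (e (\<lambda>s. m s \<otimes>\<^bsub>A\<^esub> (c \<odot>\<^bsub>A\<^esub> \<one>\<^bsub>A\<^esub>)) x)"
      by (rule ce[OF m scalar(3), symmetric])
    finally have eq: "contract (c \<odot>\<^bsub>F S\<^esub> e m x) = contract (e (\<lambda>s. m s \<otimes>\<^bsub>A\<^esub> (c \<odot>\<^bsub>A\<^esub> \<one>\<^bsub>A\<^esub>)) x)" .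
    show ?thesis unfolding scalar(4)
      by (rule *[OF F.smult_closed[OF scalar(1) ec[OF scalar(2,3)]] ec[OF m scalar(3)] eq])
  qed
qed

lemma quotient_by_kernel: "quotient_by_submodule k (F S) (K S)"
proof -
  interpret F: module k "F S" by (rule k.free_module_module)
  have "submodule (submodule_span k (F S) (tensor_relators k A (free_module A S) N)) k (F S)"
    by (rule F.submodule_span) (use relators_kernel in auto)
  then show ?thesis
    by (simp add: quotient_by_submodule_def F.module_axioms tensor_kernel_def pairs)
qed

text \<open>Modulo the relations, every \<open>u \<otimes> x\<close> equals the sum over the basis elements \<open>s\<close> of
  \<open>\<eta> (u s) x\<close> times \<open>s \<otimes> 1\<close>.\<close>

lemma kernel_eq: "K S = {U \<in> carrier (F S). contract U = \<zero>\<^bsub>free_module k S\<^esub>}"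
proof
  show "K S \<subseteq> {U \<in> carrier (F S). contract U = \<zero>\<^bsub>free_module k S\<^esub>}"
    unfolding tensor_kernel_def pairs
    by (rule submodule_span_least[OF kernel_submodule[OF k.free_module_module k.free_module_module contract_hom]])
      (use relators_kernel in auto)
  interpret Q: quotient_by_submodule k "F S" "K S" by (rule quotient_by_kernel)
  let ?Q = "quotient_module (F S) (K S)"
  interpret Q': module k ?Q by (rule Q.quotient_module)
  \<comment> \<open>Two linear maps into the quotient are compared on basis pairs: the projection
    \<open>q\<close>, and \<open>g\<close> after \<open>contract\<close>. Once they agree, zero
    contraction forces the zero coset.\<close>
  define q where "q U = K S +>\<^bsub>F S\<^esub> U" for U
  have q: "q \<in> module_hom k (F S) ?Q" unfolding q_def by (rule Q.coset_hom)
  define g where "g y = q (lin k embed_mat y)" for y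
  have g: "g \<in> module_hom k (free_module k S) ?Q"
    unfolding g_def by (rule module_hom_comp[OF embed_hom q])
  define f where "f m x = q (e m x)" for m x
  have ec: "e m x \<in> carrier (F S)" if "m \<in> fin_supp A S" "x \<in> carrier k" for m x
    using that by simp
  have fc: "f m x \<in> carrier ?Q" if "m \<in> fin_supp A S" "x \<in> carrier k" for m x
    unfolding f_def by (rule module_hom_closed[OF q ec[OF that]])
  have rel: "q x = q y" if "x \<ominus>\<^bsub>F S\<^esub> y \<in> tensor_relators k A (free_module A S) N"
    "x \<in> carrier (F S)" "y \<in> carrier (F S)" for x y
    unfolding q_def Q.coset_eq_iff[OF that(2,3)]
    using that(1) submodule_span_superset[of "tensor_relators k A (free_module A S) N" k "F S"]
    by (auto simp: tensor_kernel_def pairs)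
  have f_add: "f (\<lambda>s. m s \<oplus>\<^bsub>A\<^esub> m' s) x = f m x \<oplus>\<^bsub>?Q\<^esub> f m' x"
    if "m \<in> fin_supp A S" "m' \<in> fin_supp A S" "x \<in> carrier k" for m m' x
  proof -
    have "f (\<lambda>s. m s \<oplus>\<^bsub>A\<^esub> m' s) x = q (e m x \<oplus>\<^bsub>F S\<^esub> e m' x)"
      unfolding f_def
      by (rule rel[OF relators_intro(1)[OF that] ec Q.M.a_closed[OF ec ec]]) (use that in auto)
    also have "\<dots> = f m x \<oplus>\<^bsub>?Q\<^esub> f m' x"
      unfolding f_def using that by (intro module_hom_add[OF q ec ec])
    finally show ?thesis .
  qed
  have f_act: "f (\<lambda>s. m s \<otimes>\<^bsub>A\<^esub> b) x = f m (\<eta> b \<otimes>\<^bsub>k\<^esub> x)"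
    if "b \<in> carrier A" "m \<in> fin_supp A S" "x \<in> carrier k" for b m x
    unfolding f_def by (rule rel[OF relators_intro(2)[OF that] ec ec]) (use that in auto)
  have f_scalar: "c \<odot>\<^bsub>?Q\<^esub> f m x = f (\<lambda>s. m s \<otimes>\<^bsub>A\<^esub> (c \<odot>\<^bsub>A\<^esub> \<one>\<^bsub>A\<^esub>)) x"
    if "c \<in> carrier k" "m \<in> fin_supp A S" "x \<in> carrier k" for c m x
  proof -
    have "q (c \<odot>\<^bsub>F S\<^esub> e m x) = f (\<lambda>s. m s \<otimes>\<^bsub>A\<^esub> (c \<odot>\<^bsub>A\<^esub> \<one>\<^bsub>A\<^esub>)) x"
      unfolding f_def
      by (rule rel[OF relators_intro(3)[OF that] module.smult_closed[OF k.free_module_module that(1) ec] ec])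
        (use that scalar_closed in auto)
    then show ?thesis
      unfolding f_def module_hom_smult[OF q that(1) ec[OF that(2,3)]] .
  qed
  have fg: "f m x = g (contract_mat (m, x))" if m: "m \<in> fin_supp A S" and x: "x \<in> carrier k" for m x
    using m
  proof (induction rule: B.fin_supp_induct)
    case zero
    \<comment> \<open>Additivity of \<open>f\<close> in its first argument gives its value at zero
      through \<open>f 0 + f 0 = f 0\<close>.\<close>
    have "f (\<lambda>_. \<zero>\<^bsub>A\<^esub>) x \<oplus>\<^bsub>?Q\<^esub> f (\<lambda>_. \<zero>\<^bsub>A\<^esub>) x = f (\<lambda>_. \<zero>\<^bsub>A\<^esub>) x"
      using f_add[of "\<lambda>_. \<zero>\<^bsub>A\<^esub>" "\<lambda>_. \<zero>\<^bsub>A\<^esub>" x] x by simp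
    then have "f (\<lambda>_. \<zero>\<^bsub>A\<^esub>) x = \<zero>\<^bsub>?Q\<^esub>"
      using fc[OF B.fin_supp_zero x] by (metis Q'.M.add.r_cancel_one')
    moreover have "contract_mat (\<lambda>_. \<zero>\<^bsub>A\<^esub>, x) = \<zero>\<^bsub>free_module k S\<^esub>"
      using x by (simp add: contract_mat_def)
    ultimately show ?case
      using module_hom_zero[OF k.free_module_module Q'.module_axioms g] by simp
  next
    case (single s b)
    \<comment> \<open>The coefficient \<open>b\<close> crosses the tensor sign and becomes
      \<open>\<eta> b\<close> there; the resulting element \<open>c\<close> of \<open>k\<close> is
      then pulled out as a scalar by way of \<open>c \<odot> 1\<close>.\<close>
    define c where "c = \<eta> b \<otimes>\<^bsub>k\<^esub> x"
    have c: "c \<in> carrier k" using single x by (simp add: c_def)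
    have ds: "delta A s \<in> fin_supp A S" using single by simp
    have "f (single A s b) x = f (\<lambda>t. delta A s t \<otimes>\<^bsub>A\<^esub> b) x"
      using single by (intro arg_cong2[where f = f]) (auto simp: single_def delta_def)
    also have "\<dots> = f (delta A s) (\<eta> (c \<odot>\<^bsub>A\<^esub> \<one>\<^bsub>A\<^esub>) \<otimes>\<^bsub>k\<^esub> \<one>\<^bsub>k\<^esub>)"
      unfolding f_act[OF single(2) ds x] using c by (simp add: c_def[symmetric] \<eta>_scalar)
    also have "\<dots> = c \<odot>\<^bsub>?Q\<^esub> f (delta A s) \<one>\<^bsub>k\<^esub>"
      unfolding f_scalar[OF c ds k.one_closed] f_act[OF scalar_closed[OF c] ds k.one_closed] ..
    also have "\<dots> = c \<odot>\<^bsub>?Q\<^esub> g (delta k s)"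
      unfolding g_def f_def
      by (subst k.lin_delta) (simp_all add: embed_mat_def delta_def)
    also have "\<dots> = g (c \<odot>\<^bsub>free_module k S\<^esub> delta k s)"
      by (rule module_hom_smult[OF g c, symmetric]) (use single in simp)
    also have "c \<odot>\<^bsub>free_module k S\<^esub> delta k s = contract_mat (single A s b, x)"
      using c single x by (auto simp: contract_mat_def single_def delta_def c_def)
    finally show ?case .
  next
    case (add m m')
    have "g (contract_mat (\<lambda>s. m s \<oplus>\<^bsub>A\<^esub> m' s, x)) =
      g (contract_mat (m, x) \<oplus>\<^bsub>free_module k S\<^esub> contract_mat (m', x))"
      using contract_mat_add1[OF add.hyps x] by simp
    also have "\<dots> = g (contract_mat (m, x)) \<oplus>\<^bsub>?Q\<^esub> g (contract_mat (m', x))"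
      using add.hyps x contract_mat[of S] by (intro module_hom_add[OF g]) auto
    finally show ?case using add.IH f_add[OF add.hyps x] by simp
  qed
  have gc: "(\<lambda>U. g (contract U)) \<in> module_hom k (F S) ?Q"
    by (rule module_hom_comp[OF contract_hom g])
  have qg: "q U = g (contract U)" if "U \<in> fin_supp k (pairs S)" for U
  proof (rule k.free_module_hom_ext[OF Q'.module_axioms q gc _ that])
    fix p assume p: "p \<in> pairs S"
    then obtain m x where mx: "p = (m, x)" "m \<in> fin_supp A S" "x \<in> carrier k" by auto
    show "q (delta k p) = g (contract (delta k p))"
      unfolding contract_delta[OF p] using fg[OF mx(2,3)] by (simp add: f_def mx(1))
  qed
  show "{U \<in> carrier (F S). contract U = \<zero>\<^bsub>free_module k S\<^esub>} \<subseteq> K S"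
  proof
    fix U assume U: "U \<in> {U \<in> carrier (F S). contract U = \<zero>\<^bsub>free_module k S\<^esub>}"
    then have "q U = g \<zero>\<^bsub>free_module k S\<^esub>" using qg[of U] by simp
    also have "\<dots> = \<zero>\<^bsub>?Q\<^esub>"
      by (rule module_hom_zero[OF k.free_module_module Q'.module_axioms g])
    also have "\<dots> = K S" by (simp add: quotient_module_def)
    finally show "U \<in> K S" using U Q.coset_eq_zero_iff unfolding q_def by blast
  qed
qed

definition tensor_iso :: "(('s \<Rightarrow> 'a) \<times> 'k \<Rightarrow> 'k) set \<Rightarrow> 's \<Rightarrow> 'k" where
  "tensor_iso X = contract (SOME U. U \<in> X)"

lemma tensor_eq: "Tens S = quotient_module (F S) (K S)"
  by (simp add: tensor_def pairs)

lemma tensor_module: "module k (Tens S)"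
  unfolding tensor_eq by (rule quotient_by_submodule.quotient_module[OF quotient_by_kernel])

lemma tensor_iso: "tensor_iso \<in> module_iso k (Tens S) (free_module k S)"
  unfolding tensor_iso_def tensor_eq
proof (rule quotient_by_submodule.quotient_iso[OF quotient_by_kernel k.free_module_module contract_hom _ kernel_eq])
  fix y assume "y \<in> carrier (free_module k S)"
  then have y: "y \<in> fin_supp k S" by simp
  show "\<exists>x\<in>carrier (F S). contract x = y"
    using contract_embed[OF y] k.lin_closed[OF y embed_mat] by auto
qed

lemma tensor_iso_coset:
  "U \<in> carrier (F S) \<Longrightarrow> tensor_iso (K S +>\<^bsub>F S\<^esub> U) = contract U"
  unfolding tensor_iso_def
  by (rule quotient_by_submodule.coset_some_eq[OF quotient_by_kernel k.free_module_module contract_hom kernel_eq])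

text \<open>Independence of the representative comes from the third conclusion: elements of one
  coset have equal contractions, hence so do their images, and \<open>K T\<close> consists of the
  elements of contraction zero.\<close>

lemma tensor_map_coset:
  assumes v: "v \<in> S \<rightarrow> fin_supp A T" and U: "U \<in> carrier (F S)"
  shows "tensor_map k A (free_module A T) N (lin A v) (K S +>\<^bsub>F S\<^esub> U) =
      K T +>\<^bsub>F T\<^esub> free_map k (map_prod (lin A v) id) U" (is "?L = ?R")
    and "free_map k (map_prod (lin A v) id) U \<in> carrier (F T)"
    and "contract (free_map k (map_prod (lin A v) id) U) = lin k (\<lambda>s t. \<eta> (v s t)) (contract U)"
proof -
  let ?h = "map_prod (lin A v) id"
  have h: "?h \<in> pairs S \<rightarrow> pairs T"
    using B.lin_closed[OF _ v] by auto
  have hm: "(\<lambda>p. delta k (?h p)) \<in> pairs S \<rightarrow> fin_supp k (pairs T)"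
    using h k.fin_supp_delta by blast
  have fm: "free_map k ?h V = lin k (\<lambda>p. delta k (?h p)) V" if "V \<in> fin_supp k (pairs S)" for V
    by (rule k.free_map_eq_lin[OF that h])
  have fmc: "free_map k ?h V \<in> carrier (F T)" if "V \<in> fin_supp k (pairs S)" for V
    using k.lin_closed[OF that hm] fm[OF that] by simp
  have con: "contract (free_map k ?h V) = lin k (\<lambda>s t. \<eta> (v s t)) (contract V)"
    if V: "V \<in> fin_supp k (pairs S)" for V
    unfolding fm[OF V] k.lin_lin[OF V hm contract_mat] k.lin_lin[OF V contract_mat push_mat[OF v]]
  proof (rule k.lin_cong[OF V])
    fix p assume p: "p \<in> pairs S"
    then obtain u x where ux: "p = (u, x)" "u \<in> fin_supp A S" "x \<in> carrier k" by auto
    have "contract (delta k (?h p)) = contract_mat (?h p)"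
      using h p by (intro contract_delta[where S = T]) auto
    also have "\<dots> = (\<lambda>t. lin k (\<lambda>s t. \<eta> (v s t)) (\<lambda>s. \<eta> (u s)) t \<otimes>\<^bsub>k\<^esub> x)"
      unfolding lin_hom[OF ring_B k.ring_axioms \<eta> ux(2) v, symmetric] ux(1)
      by (simp add: contract_mat_def)
    also have "\<dots> = lin k (\<lambda>s t. \<eta> (v s t)) (contract_mat p)"
      unfolding ux(1) contract_mat_def prod.case
      by (rule ext, rule k.lin_rmult[OF push[OF ux(2)] push_mat[OF v] ux(3), symmetric])
    finally show "contract (delta k (?h p)) = lin k (\<lambda>s t. \<eta> (v s t)) (contract_mat p)" .
    show "lin k (\<lambda>s t. \<eta> (v s t)) (contract_mat p) t \<in> carrier k" for t
      by (rule k.fin_supp_closed[OF k.lin_closed[OF funcset_mem[OF contract_mat p] push_mat[OF v]]])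
  qed
  have U': "U \<in> fin_supp k (pairs S)" using U by simp
  show "free_map k ?h U \<in> carrier (F T)" by (rule fmc[OF U'])
  show "contract (free_map k ?h U) = lin k (\<lambda>s t. \<eta> (v s t)) (contract U)" by (rule con[OF U'])
  interpret Q: quotient_by_submodule k "F S" "K S" by (rule quotient_by_kernel)
  interpret Q': quotient_by_submodule k "F T" "K T" by (rule quotient_by_kernel)
  interpret CT: module k "free_module k T" by (rule k.free_module_module)
  have "K T +>\<^bsub>F T\<^esub> free_map k ?h V = ?R" if V: "V \<in> K S +>\<^bsub>F S\<^esub> U" for V
  proof -
    have VF: "V \<in> carrier (F S)" by (rule Q.a_elemrcos_carrier[OF U V])
    have V': "V \<in> fin_supp k (pairs S)" using VF by simp
    have "K S +>\<^bsub>F S\<^esub> U = K S +>\<^bsub>F S\<^esub> V" by (rule Q.a_repr_independence'[OF V U])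
    then have "contract U = contract V"
      using tensor_iso_coset[OF U] tensor_iso_coset[OF VF] by simp
    then have "contract (free_map k ?h V) = contract (free_map k ?h U)"
      by (simp only: con[OF V'] con[OF U'])
    then have "contract (free_map k ?h V \<ominus>\<^bsub>F T\<^esub> free_map k ?h U) = \<zero>\<^bsub>free_module k T\<^esub>"
      unfolding module_hom_minus[OF k.free_module_module k.free_module_module contract_hom fmc[OF V'] fmc[OF U']]
      by (rule iffD2[OF CT.M.minus_eq_zero_iff[OF module_hom_closed[OF contract_hom fmc[OF V']]
        module_hom_closed[OF contract_hom fmc[OF U']]]])
    moreover have "free_map k ?h V \<ominus>\<^bsub>F T\<^esub> free_map k ?h U \<in> carrier (F T)"
      by (rule Q'.M.minus_closed[OF fmc[OF V'] fmc[OF U']])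
    ultimately have "free_map k ?h V \<ominus>\<^bsub>F T\<^esub> free_map k ?h U \<in> K T"
      unfolding kernel_eq by blast
    then show ?thesis by (simp only: Q'.coset_eq_iff[OF fmc[OF V'] fmc[OF U']])
  qed
  moreover have "K S +>\<^bsub>F S\<^esub> U \<noteq> {}" using Q.a_rcos_self[OF U] by blast
  ultimately show "?L = ?R"
    unfolding tensor_map_def pairs by (intro SUP_eq_const)
qed

lemma tensor_complex:
  fixes S :: "nat \<Rightarrow> 's set"
  assumes v: "\<And>i. v i \<in> S (Suc i) \<rightarrow> fin_supp A (S i)"
    and C: "chain_complex k (\<lambda>i. free_module k (S i)) (\<lambda>i. lin k (\<lambda>s t. \<eta> (v i s t)))"
  defines "D \<equiv> \<lambda>i. tensor_map k A (free_module A (S i)) N (lin A (v i))"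
  shows "chain_complex k (\<lambda>i. Tens (S i)) D"
    and "graded_isomorphic k (homology (\<lambda>i. Tens (S i)) D)
      (homology (\<lambda>i. free_module k (S i)) (\<lambda>i. lin k (\<lambda>s t. \<eta> (v i s t))))"
proof -
  have *: "D i X \<in> carrier (Tens (S i)) \<and>
      tensor_iso (D i X) = lin k (\<lambda>s t. \<eta> (v i s t)) (tensor_iso X)"
    if X: "X \<in> carrier (Tens (S (Suc i)))" for i X
  proof -
    interpret Q: quotient_by_submodule k "F (S (Suc i))" "K (S (Suc i))" by (rule quotient_by_kernel)
    interpret Q': quotient_by_submodule k "F (S i)" "K (S i)" by (rule quotient_by_kernel)
    obtain U where U: "U \<in> carrier (F (S (Suc i)))" and XU: "X = K (S (Suc i)) +>\<^bsub>F (S (Suc i))\<^esub> U"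
      using X unfolding tensor_eq by (rule Q.carrier_quotientE)
    note m = tensor_map_coset[OF v U]
    show ?thesis
      unfolding D_def XU m(1) tensor_eq tensor_iso_coset[OF U] tensor_iso_coset[OF m(2)] m(3)
      using Q'.coset_in_carrier[OF m(2)] by simp
  qed
  show "chain_complex k (\<lambda>i. Tens (S i)) D"
    "graded_isomorphic k (homology (\<lambda>i. Tens (S i)) D)
      (homology (\<lambda>i. free_module k (S i)) (\<lambda>i. lin k (\<lambda>s t. \<eta> (v i s t))))"
    using transport_chain_complex[of k "\<lambda>i. free_module k (S i)" "\<lambda>i. lin k (\<lambda>s t. \<eta> (v i s t))"
      "\<lambda>i. Tens (S i)" "\<lambda>_. tensor_iso" D, OF C tensor_module tensor_iso] * by blast+
qed

end

section \<open>Twisted monoid algebras\<close>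

text \<open>Covers both algebras of the theorem: powers of \<open>\<epsilon>\<close> as weights for
  rook diagrams, weight one for group elements. The cocycle identity is associativity of the
  product, tested on basis elements.\<close>

locale twisted_monoid =
  fixes k :: "('k, 'z) ring_scheme" and D :: "'d set" and mul :: "'d \<Rightarrow> 'd \<Rightarrow> 'd"
    and w :: "'d \<Rightarrow> 'd \<Rightarrow> 'k" and e :: 'd
  assumes cring_k: "cring k"
    and mul_closed [simp]: "x \<in> D \<Longrightarrow> y \<in> D \<Longrightarrow> mul x y \<in> D"
    and mul_assoc: "\<lbrakk>x \<in> D; y \<in> D; z \<in> D\<rbrakk> \<Longrightarrow> mul (mul x y) z = mul x (mul y z)"
    and e_closed [simp]: "e \<in> D"
    and e_mul [simp]: "x \<in> D \<Longrightarrow> mul e x = x"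
    and mul_e [simp]: "x \<in> D \<Longrightarrow> mul x e = x"
    and w_closed [simp]: "x \<in> D \<Longrightarrow> y \<in> D \<Longrightarrow> w x y \<in> carrier k"
    and cocycle: "\<lbrakk>x \<in> D; y \<in> D; z \<in> D\<rbrakk> \<Longrightarrow>
      w x y \<otimes>\<^bsub>k\<^esub> w (mul x y) z = w y z \<otimes>\<^bsub>k\<^esub> w x (mul y z)"
    and w_e [simp]: "x \<in> D \<Longrightarrow> w e x = \<one>\<^bsub>k\<^esub>" "x \<in> D \<Longrightarrow> w x e = \<one>\<^bsub>k\<^esub>"
begin

sublocale k: cring k by (rule cring_k)

abbreviation "A \<equiv> basis_algebra k D mul w e"

lemma A_simps [simp]:
  "carrier A = fin_supp k D"
  "\<one>\<^bsub>A\<^esub> = single k e \<one>\<^bsub>k\<^esub>"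
  "\<zero>\<^bsub>A\<^esub> = (\<lambda>_. \<zero>\<^bsub>k\<^esub>)"
  "f \<oplus>\<^bsub>A\<^esub> g = (\<lambda>d. f d \<oplus>\<^bsub>k\<^esub> g d)"
  "c \<odot>\<^bsub>A\<^esub> f = (\<lambda>d. c \<otimes>\<^bsub>k\<^esub> f d)"
  by (simp_all add: basis_algebra_def delta_eq_single)

text \<open>The product is \<open>outer\<close> followed by this matrix, indexed by pairs, so its
  bilinearity reduces to additivity of \<open>lin\<close>.\<close>

definition basis_mult :: "'d \<times> 'd \<Rightarrow> 'd \<Rightarrow> 'k" where
  "basis_mult p = single k (mul (fst p) (snd p)) (w (fst p) (snd p))"

definition outer :: "('d \<Rightarrow> 'k) \<Rightarrow> ('d \<Rightarrow> 'k) \<Rightarrow> 'd \<times> 'd \<Rightarrow> 'k" where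
  "outer f g p = f (fst p) \<otimes>\<^bsub>k\<^esub> g (snd p)"

lemma basis_mult: "basis_mult \<in> D \<times> D \<rightarrow> fin_supp k D"
  by (auto simp: basis_mult_def)

lemma outer_closed:
  assumes f: "f \<in> fin_supp k D" and g: "g \<in> fin_supp k D"
  shows "outer f g \<in> fin_supp k (D \<times> D)"
proof (rule fin_suppI)
  show "finite ({s. f s \<noteq> \<zero>\<^bsub>k\<^esub>} \<times> {s. g s \<noteq> \<zero>\<^bsub>k\<^esub>})"
    using fin_supp_finite[OF f] fin_supp_finite[OF g] by simp
  show "{p. outer f g p \<noteq> \<zero>\<^bsub>k\<^esub>} \<subseteq> {s. f s \<noteq> \<zero>\<^bsub>k\<^esub>} \<times> {s. g s \<noteq> \<zero>\<^bsub>k\<^esub>}"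
    by (auto simp: outer_def k.fin_supp_closed[OF f] k.fin_supp_closed[OF g])
  fix p
  show "outer f g p \<in> carrier k"
    by (simp add: outer_def k.fin_supp_closed[OF f] k.fin_supp_closed[OF g])
  assume "p \<notin> D \<times> D"
  then have "f (fst p) = \<zero>\<^bsub>k\<^esub> \<or> g (snd p) = \<zero>\<^bsub>k\<^esub>"
    using fin_supp_outside[OF f] fin_supp_outside[OF g] by (cases p) auto
  then show "outer f g p = \<zero>\<^bsub>k\<^esub>"
    by (auto simp: outer_def k.fin_supp_closed[OF f] k.fin_supp_closed[OF g])
qed

lemma mult_eq_lin:
  assumes f: "f \<in> fin_supp k D" and g: "g \<in> fin_supp k D"
  shows "f \<otimes>\<^bsub>A\<^esub> g = lin k basis_mult (outer f g)"
proof
  fix d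
  let ?P = "{s. f s \<noteq> \<zero>\<^bsub>k\<^esub>} \<times> {s. g s \<noteq> \<zero>\<^bsub>k\<^esub>}"
  note [simp] = k.fin_supp_closed[OF f] k.fin_supp_closed[OF g]
  have P: "finite ?P" "?P \<subseteq> D \<times> D"
    using fin_supp_finite[OF f] fin_supp_finite[OF g] fin_supp_subset[OF f] fin_supp_subset[OF g] by auto
  have c: "w x y \<in> carrier k" if "f x \<noteq> \<zero>\<^bsub>k\<^esub>" "g y \<noteq> \<zero>\<^bsub>k\<^esub>" for x y
    using P that by auto
  have "(f \<otimes>\<^bsub>A\<^esub> g) d = (\<Oplus>\<^bsub>k\<^esub>p\<in>?P. basis_mult p d \<otimes>\<^bsub>k\<^esub> outer f g p)"
    unfolding basis_algebra_def monoid.simps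
    by (rule k.add.finprod_mono_neutral_cong_left[OF P(1)])
      (auto simp: basis_mult_def single_def outer_def Pi_iff c)
  also have "\<dots> = lin k basis_mult (outer f g) d"
    by (rule k.lin_eq[OF outer_closed[OF f g] basis_mult P(1) _ P(2), symmetric]) (auto simp: outer_def)
  finally show "(f \<otimes>\<^bsub>A\<^esub> g) d = lin k basis_mult (outer f g) d" .
qed

lemma mult_closed: "f \<in> fin_supp k D \<Longrightarrow> g \<in> fin_supp k D \<Longrightarrow> f \<otimes>\<^bsub>A\<^esub> g \<in> fin_supp k D"
  by (simp add: mult_eq_lin k.lin_closed[OF outer_closed basis_mult])

lemma mult_add_left:
  assumes "f \<in> fin_supp k D" "f' \<in> fin_supp k D" "g \<in> fin_supp k D"
  shows "(\<lambda>d. f d \<oplus>\<^bsub>k\<^esub> f' d) \<otimes>\<^bsub>A\<^esub> g = (\<lambda>d. (f \<otimes>\<^bsub>A\<^esub> g) d \<oplus>\<^bsub>k\<^esub> (f' \<otimes>\<^bsub>A\<^esub> g) d)"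
proof -
  note [simp] = assms[THEN k.fin_supp_closed]
  have "outer (\<lambda>d. f d \<oplus>\<^bsub>k\<^esub> f' d) g = (\<lambda>p. outer f g p \<oplus>\<^bsub>k\<^esub> outer f' g p)"
    by (simp add: outer_def fun_eq_iff k.l_distr)
  then show ?thesis
    using k.lin_add[OF outer_closed[OF assms(1,3)] outer_closed[OF assms(2,3)] basis_mult]
    by (simp add: mult_eq_lin assms)
qed

lemma mult_add_right:
  assumes "f \<in> fin_supp k D" "g \<in> fin_supp k D" "g' \<in> fin_supp k D"
  shows "f \<otimes>\<^bsub>A\<^esub> (\<lambda>d. g d \<oplus>\<^bsub>k\<^esub> g' d) = (\<lambda>d. (f \<otimes>\<^bsub>A\<^esub> g) d \<oplus>\<^bsub>k\<^esub> (f \<otimes>\<^bsub>A\<^esub> g') d)"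
proof -
  note [simp] = assms[THEN k.fin_supp_closed]
  have "outer f (\<lambda>d. g d \<oplus>\<^bsub>k\<^esub> g' d) = (\<lambda>p. outer f g p \<oplus>\<^bsub>k\<^esub> outer f g' p)"
    by (simp add: outer_def fun_eq_iff k.r_distr)
  then show ?thesis
    using k.lin_add[OF outer_closed[OF assms(1,2)] outer_closed[OF assms(1,3)] basis_mult]
    by (simp add: mult_eq_lin assms)
qed

lemma mult_zero:
  assumes f: "f \<in> fin_supp k D"
  shows "(\<lambda>_. \<zero>\<^bsub>k\<^esub>) \<otimes>\<^bsub>A\<^esub> f = (\<lambda>_. \<zero>\<^bsub>k\<^esub>)" "f \<otimes>\<^bsub>A\<^esub> (\<lambda>_. \<zero>\<^bsub>k\<^esub>) = (\<lambda>_. \<zero>\<^bsub>k\<^esub>)"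
proof -
  have "outer (\<lambda>_. \<zero>\<^bsub>k\<^esub>) f = (\<lambda>_. \<zero>\<^bsub>k\<^esub>)" "outer f (\<lambda>_. \<zero>\<^bsub>k\<^esub>) = (\<lambda>_. \<zero>\<^bsub>k\<^esub>)"
    by (simp_all add: outer_def k.fin_supp_closed[OF f] fun_eq_iff)
  then show "(\<lambda>_. \<zero>\<^bsub>k\<^esub>) \<otimes>\<^bsub>A\<^esub> f = (\<lambda>_. \<zero>\<^bsub>k\<^esub>)" "f \<otimes>\<^bsub>A\<^esub> (\<lambda>_. \<zero>\<^bsub>k\<^esub>) = (\<lambda>_. \<zero>\<^bsub>k\<^esub>)"
    by (simp_all add: mult_eq_lin f)
qed

lemma mult_single:
  assumes "x \<in> D" "y \<in> D" "a \<in> carrier k" "b \<in> carrier k"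
  shows "single k x a \<otimes>\<^bsub>A\<^esub> single k y b = single k (mul x y) (w x y \<otimes>\<^bsub>k\<^esub> (a \<otimes>\<^bsub>k\<^esub> b))"
proof -
  have "outer (single k x a) (single k y b) = single k (x, y) (a \<otimes>\<^bsub>k\<^esub> b)"
    using assms by (auto simp: outer_def single_def fun_eq_iff)
  then have "single k x a \<otimes>\<^bsub>A\<^esub> single k y b = lin k basis_mult (single k (x, y) (a \<otimes>\<^bsub>k\<^esub> b))"
    using assms by (simp add: mult_eq_lin)
  also have "\<dots> = (\<lambda>d. basis_mult (x, y) d \<otimes>\<^bsub>k\<^esub> (a \<otimes>\<^bsub>k\<^esub> b))"
    using assms by (intro ext k.lin_single k.mat_closed[OF basis_mult]) auto
  also have "\<dots> = single k (mul x y) (w x y \<otimes>\<^bsub>k\<^esub> (a \<otimes>\<^bsub>k\<^esub> b))"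
    using assms by (auto simp: basis_mult_def single_def)
  finally show ?thesis .
qed

lemma mult_smult:
  assumes c: "c \<in> carrier k" and f: "f \<in> fin_supp k D" and g: "g \<in> fin_supp k D"
  shows "(\<lambda>d. c \<otimes>\<^bsub>k\<^esub> f d) \<otimes>\<^bsub>A\<^esub> g = (\<lambda>d. c \<otimes>\<^bsub>k\<^esub> (f \<otimes>\<^bsub>A\<^esub> g) d)"
    and "f \<otimes>\<^bsub>A\<^esub> (\<lambda>d. c \<otimes>\<^bsub>k\<^esub> g d) = (\<lambda>d. c \<otimes>\<^bsub>k\<^esub> (f \<otimes>\<^bsub>A\<^esub> g) d)"
proof -
  note [simp] = k.fin_supp_closed[OF f] k.fin_supp_closed[OF g] c
  have o: "outer (\<lambda>d. c \<otimes>\<^bsub>k\<^esub> f d) g = (\<lambda>p. outer f g p \<otimes>\<^bsub>k\<^esub> c)"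
    "outer f (\<lambda>d. c \<otimes>\<^bsub>k\<^esub> g d) = (\<lambda>p. outer f g p \<otimes>\<^bsub>k\<^esub> c)"
    by (simp_all add: outer_def fun_eq_iff k.m_ac)
  have "lin k basis_mult (\<lambda>p. outer f g p \<otimes>\<^bsub>k\<^esub> c) = (\<lambda>d. c \<otimes>\<^bsub>k\<^esub> lin k basis_mult (outer f g) d)"
    using k.fin_supp_closed[OF k.lin_closed[OF outer_closed[OF f g] basis_mult]]
    by (intro ext) (simp add: k.lin_rmult[OF outer_closed[OF f g] basis_mult c] k.m_comm)
  then show "(\<lambda>d. c \<otimes>\<^bsub>k\<^esub> f d) \<otimes>\<^bsub>A\<^esub> g = (\<lambda>d. c \<otimes>\<^bsub>k\<^esub> (f \<otimes>\<^bsub>A\<^esub> g) d)"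
    "f \<otimes>\<^bsub>A\<^esub> (\<lambda>d. c \<otimes>\<^bsub>k\<^esub> g d) = (\<lambda>d. c \<otimes>\<^bsub>k\<^esub> (f \<otimes>\<^bsub>A\<^esub> g) d)"
    by (simp_all add: mult_eq_lin k.fin_supp_lmult[OF f c] k.fin_supp_lmult[OF g c] f g o)
qed

lemma mult_assoc_single:
  assumes "x \<in> D" "y \<in> D" "z \<in> D" "a \<in> carrier k" "b \<in> carrier k" "c \<in> carrier k"
  shows "(single k x a \<otimes>\<^bsub>A\<^esub> single k y b) \<otimes>\<^bsub>A\<^esub> single k z c =
    single k x a \<otimes>\<^bsub>A\<^esub> (single k y b \<otimes>\<^bsub>A\<^esub> single k z c)"
proof -
  have "w (mul x y) z \<otimes>\<^bsub>k\<^esub> ((w x y \<otimes>\<^bsub>k\<^esub> (a \<otimes>\<^bsub>k\<^esub> b)) \<otimes>\<^bsub>k\<^esub> c) =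
    (w x y \<otimes>\<^bsub>k\<^esub> w (mul x y) z) \<otimes>\<^bsub>k\<^esub> (a \<otimes>\<^bsub>k\<^esub> (b \<otimes>\<^bsub>k\<^esub> c))"
    using assms by (simp add: k.m_ac)
  also have "\<dots> = (w y z \<otimes>\<^bsub>k\<^esub> w x (mul y z)) \<otimes>\<^bsub>k\<^esub> (a \<otimes>\<^bsub>k\<^esub> (b \<otimes>\<^bsub>k\<^esub> c))"
    using assms by (simp only: cocycle)
  also have "\<dots> = w x (mul y z) \<otimes>\<^bsub>k\<^esub> (a \<otimes>\<^bsub>k\<^esub> (w y z \<otimes>\<^bsub>k\<^esub> (b \<otimes>\<^bsub>k\<^esub> c)))"
    using assms by (simp add: k.m_ac)
  finally show ?thesis using assms by (simp add: mult_single mul_assoc)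
qed

lemma mult_assoc:
  assumes f: "f \<in> fin_supp k D" and g: "g \<in> fin_supp k D" and h: "h \<in> fin_supp k D"
  shows "(f \<otimes>\<^bsub>A\<^esub> g) \<otimes>\<^bsub>A\<^esub> h = f \<otimes>\<^bsub>A\<^esub> (g \<otimes>\<^bsub>A\<^esub> h)"
proof -
  have 1: "(single k x a \<otimes>\<^bsub>A\<^esub> single k y b) \<otimes>\<^bsub>A\<^esub> h = single k x a \<otimes>\<^bsub>A\<^esub> (single k y b \<otimes>\<^bsub>A\<^esub> h)"
    if xy: "x \<in> D" "y \<in> D" "a \<in> carrier k" "b \<in> carrier k" for x y a b
    using h
  proof (induction rule: k.fin_supp_induct)
    case zero
    show ?case using xy by (simp add: mult_zero mult_closed)
  next
    case (single z c)
    then show ?case using xy by (intro mult_assoc_single)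
  next
    case (add h h')
    then show ?case using xy by (simp add: mult_add_right mult_closed)
  qed
  have 2: "(single k x a \<otimes>\<^bsub>A\<^esub> g) \<otimes>\<^bsub>A\<^esub> h = single k x a \<otimes>\<^bsub>A\<^esub> (g \<otimes>\<^bsub>A\<^esub> h)"
    if x: "x \<in> D" "a \<in> carrier k" for x a
    using g
  proof (induction rule: k.fin_supp_induct)
    case zero
    show ?case using x h by (simp add: mult_zero mult_closed)
  next
    case (single y b)
    then show ?case using x by (intro 1)
  next
    case (add g g')
    then show ?case using x h by (simp add: mult_add_right mult_add_left mult_closed)
  qed
  show ?thesis using f
  proof (induction rule: k.fin_supp_induct)
    case zero
    show ?case using g h by (simp add: mult_zero mult_closed)
  next
    case (single x a)
    then show ?case by (intro 2)
  next
    case (add f f')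
    then show ?case using g h by (simp add: mult_add_left mult_closed)
  qed
qed

lemma one_mult:
  assumes f: "f \<in> fin_supp k D"
  shows "single k e \<one>\<^bsub>k\<^esub> \<otimes>\<^bsub>A\<^esub> f = f" "f \<otimes>\<^bsub>A\<^esub> single k e \<one>\<^bsub>k\<^esub> = f"
proof -
  have "single k e \<one>\<^bsub>k\<^esub> \<otimes>\<^bsub>A\<^esub> f = f \<and> f \<otimes>\<^bsub>A\<^esub> single k e \<one>\<^bsub>k\<^esub> = f" using f
  proof (induction rule: k.fin_supp_induct)
    case zero
    show ?case by (simp add: mult_zero)
  next
    case (single x a)
    then show ?case by (simp add: mult_single)
  next
    case (add f f')
    then show ?case by (simp add: mult_add_left mult_add_right)
  qed
  then show "single k e \<one>\<^bsub>k\<^esub> \<otimes>\<^bsub>A\<^esub> f = f" "f \<otimes>\<^bsub>A\<^esub> single k e \<one>\<^bsub>k\<^esub> = f" by auto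
qed

lemma ring_A: "ring A"
proof (rule ringI)
  \<comment> \<open>The records differ in multiplication and scalar action, but being an abelian
    group depends only on \<open>add_monoid\<close>.\<close>
  have "add_monoid A = add_monoid (free_module k D)" by (simp add: fun_eq_iff)
  then show "abelian_group A"
    using k.free_module_abelian_group[of D]
    by (simp add: abelian_group_def abelian_monoid_def abelian_group_axioms_def)
  show "monoid A"
    by (rule monoidI) (simp_all add: mult_closed mult_assoc one_mult)
qed (simp_all add: mult_add_left mult_add_right)

sublocale A: ring A by (rule ring_A)

lemma scalar: "c \<in> carrier k \<Longrightarrow> c \<odot>\<^bsub>A\<^esub> \<one>\<^bsub>A\<^esub> = single k e c"
  by (auto simp: single_def)

text \<open>\<open>h\<close> is assumed additive and not \<open>k\<close>-linear, so
  multiplicativity is asked for monomials with arbitrary coefficients and then extended one factor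
  at a time.\<close>

lemma ring_hom_from_basis:
  assumes R: "ring R" and h: "\<And>f. f \<in> fin_supp k D \<Longrightarrow> h f \<in> carrier R"
    and add: "\<And>f g. \<lbrakk>f \<in> fin_supp k D; g \<in> fin_supp k D\<rbrakk> \<Longrightarrow> h (\<lambda>d. f d \<oplus>\<^bsub>k\<^esub> g d) = h f \<oplus>\<^bsub>R\<^esub> h g"
    and mult: "\<And>x y a b. \<lbrakk>x \<in> D; y \<in> D; a \<in> carrier k; b \<in> carrier k\<rbrakk> \<Longrightarrow>
      h (single k (mul x y) (w x y \<otimes>\<^bsub>k\<^esub> (a \<otimes>\<^bsub>k\<^esub> b))) = h (single k x a) \<otimes>\<^bsub>R\<^esub> h (single k y b)"
    and one: "h (single k e \<one>\<^bsub>k\<^esub>) = \<one>\<^bsub>R\<^esub>"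
  shows "h \<in> ring_hom A R"
proof -
  interpret R: ring R by fact
  have z: "h (\<lambda>_. \<zero>\<^bsub>k\<^esub>) \<in> carrier R" by (rule h) simp
  have "h (\<lambda>_. \<zero>\<^bsub>k\<^esub>) \<oplus>\<^bsub>R\<^esub> h (\<lambda>_. \<zero>\<^bsub>k\<^esub>) = h (\<lambda>_. \<zero>\<^bsub>k\<^esub>)"
    using add[of "\<lambda>_. \<zero>\<^bsub>k\<^esub>" "\<lambda>_. \<zero>\<^bsub>k\<^esub>"] by simp
  then have h_zero: "h (\<lambda>_. \<zero>\<^bsub>k\<^esub>) = \<zero>\<^bsub>R\<^esub>" using z by (metis R.add.r_cancel_one')
  have 1: "h (single k x a \<otimes>\<^bsub>A\<^esub> g) = h (single k x a) \<otimes>\<^bsub>R\<^esub> h g"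
    if x: "x \<in> D" "a \<in> carrier k" and g: "g \<in> fin_supp k D" for x a g
    using g
  proof (induction rule: k.fin_supp_induct)
    case zero
    show ?case using x h[OF k.fin_supp_single[OF x]] by (simp add: mult_zero h_zero)
  next
    case (single y b)
    then show ?case using x by (simp add: mult_single mult)
  next
    case (add g g')
    then show ?case using x by (simp add: mult_add_right mult_closed assms(3) h R.r_distr)
  qed
  have "h (f \<otimes>\<^bsub>A\<^esub> g) = h f \<otimes>\<^bsub>R\<^esub> h g" if f: "f \<in> fin_supp k D" and g: "g \<in> fin_supp k D" for f g
    using f
  proof (induction rule: k.fin_supp_induct)
    case zero
    show ?case using g by (simp add: mult_zero h h_zero)
  next
    case (single x a)
    then show ?case using g by (intro 1)
  next
    case (add f f')
    then show ?case using g by (simp add: mult_add_left mult_closed assms(3) h R.l_distr)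
  qed
  then show ?thesis using h add one by (intro ring_hom_memI) simp_all
qed

text \<open>The sum of the coefficients; when all weights are one, this is the usual augmentation of
  a monoid algebra.\<close>

definition total :: "('d \<Rightarrow> 'k) \<Rightarrow> 'k" where
  "total f = (\<Oplus>\<^bsub>k\<^esub>d\<in>{d \<in> D. f d \<noteq> \<zero>\<^bsub>k\<^esub>}. f d)"

lemma total_eq_lin:
  assumes "f \<in> fin_supp k D"
  shows "total f = lin k (\<lambda>_ (_::unit). \<one>\<^bsub>k\<^esub>) f ()"
proof -
  have eq: "{d \<in> D. f d \<noteq> \<zero>\<^bsub>k\<^esub>} = {d. f d \<noteq> \<zero>\<^bsub>k\<^esub>}" using assms by (auto simp: fin_supp_def)
  show ?thesis
    unfolding total_def lin_def eq
    by (rule k.add.finprod_cong') (auto simp: k.fin_supp_closed[OF assms])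
qed

lemma total_one_mat: "(\<lambda>_ (_::unit). \<one>\<^bsub>k\<^esub>) \<in> D \<rightarrow> fin_supp k UNIV"
  by (auto simp: fin_supp_def)

lemma total_single: "x \<in> D \<Longrightarrow> a \<in> carrier k \<Longrightarrow> total (single k x a) = a"
  by (simp add: total_eq_lin k.lin_single)

lemma total_closed: "f \<in> fin_supp k D \<Longrightarrow> total f \<in> carrier k"
  by (simp add: total_eq_lin k.fin_supp_closed[OF k.lin_closed[OF _ total_one_mat]])

lemma total_hom:
  assumes "\<And>x y. x \<in> D \<Longrightarrow> y \<in> D \<Longrightarrow> w x y = \<one>\<^bsub>k\<^esub>"
  shows "total \<in> ring_hom A k"
proof (rule ring_hom_from_basis[OF k.ring_axioms total_closed])
  show "total (\<lambda>d. f d \<oplus>\<^bsub>k\<^esub> g d) = total f \<oplus>\<^bsub>k\<^esub> total g"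
    if "f \<in> fin_supp k D" "g \<in> fin_supp k D" for f g
    using that by (simp add: total_eq_lin k.lin_add[OF that total_one_mat])
qed (simp_all add: total_single assms)

end

section \<open>Change of rings for the standard resolution\<close>

text \<open>A function can be stored in a \<open>Syz\<close> and recovered because its support is
  finite; \<open>Abs_fset\<close> is only meaningful on finite sets.\<close>

lemma syz_fun_syz:
  assumes "f \<in> fin_supp A S"
  shows "syz_fun A (syz A f) = f"
proof
  fix t
  have "{(s, f s) |s. f s \<noteq> \<zero>\<^bsub>A\<^esub>} = (\<lambda>s. (s, f s)) ` {s. f s \<noteq> \<zero>\<^bsub>A\<^esub>}" by auto
  then have "finite {(s, f s) |s. f s \<noteq> \<zero>\<^bsub>A\<^esub>}"
    using fin_supp_finite[OF assms] by simp
  then have "fset (Abs_fset {(s, f s) |s. f s \<noteq> \<zero>\<^bsub>A\<^esub>}) = {(s, f s) |s. f s \<noteq> \<zero>\<^bsub>A\<^esub>}"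
    by (simp add: Abs_fset_inverse)
  then show "syz_fun A (syz A f) t = f t"
    by (auto simp: syz_def)
qed

text \<open>Merges the two recursive clauses of \<open>res_gens\<close>, so that one equation
  describes the generators of every positive degree.\<close>

definition syz_cycle :: "('a, 'z) ring_scheme \<Rightarrow> ('a, 'm) module \<Rightarrow> nat
    \<Rightarrow> (('a, 'm) res_basis \<Rightarrow> 'a) \<Rightarrow> bool" where
  "syz_cycle A M i f \<longleftrightarrow>
    (case i of 0 \<Rightarrow> res_augment A M f = \<zero>\<^bsub>M\<^esub> | Suc j \<Rightarrow> res_diff A f = (\<lambda>_. \<zero>\<^bsub>A\<^esub>))"

lemma res_gens_Suc:
  "res_gens A M (Suc i) = syz A ` {f \<in> fin_supp A (res_gens A M i). syz_cycle A M i f}"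
  by (cases i) (simp_all add: syz_cycle_def)

lemma res_gensE:
  assumes "s \<in> res_gens A M (Suc i)"
  obtains f where "f \<in> fin_supp A (res_gens A M i)" "syz_cycle A M i f" "s = syz A f" "syz_fun A s = f"
  using assms syz_fun_syz unfolding res_gens_Suc by blast

lemma syz_fun_mat: "syz_fun A \<in> res_gens A M (Suc i) \<rightarrow> fin_supp A (res_gens A M i)"
  by (auto elim!: res_gensE)

lemma res_diff_eq_lin: "res_diff A = lin A (syz_fun A)"
  by (simp add: fun_eq_iff res_diff_def lin_def)

text \<open>The augmentation of the standard resolution on its basis of degree 0, where every
  element is a \<open>Gen\<close>; the value at \<open>Syz\<close> is a default.\<close>

fun gen_value :: "('k, 'z) ring_scheme \<Rightarrow> ('a, 'k) res_basis \<Rightarrow> 'k" where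
  "gen_value k (Gen m) = m"
| "gen_value k (Syz X) = \<zero>\<^bsub>k\<^esub>"

text \<open>Monoids suffice for the bar resolution, and in this generality inverse braids never have
  to be constructed.\<close>

locale monoid_algebra = H: monoid \<Gamma>
  for k :: "('k, 'z) ring_scheme" and \<Gamma> :: "('h, 'x) monoid_scheme" +
  assumes cring_scalars: "cring k"
begin

sublocale k: cring k by (rule cring_scalars)

sublocale B: twisted_monoid k "carrier \<Gamma>" "(\<otimes>\<^bsub>\<Gamma>\<^esub>)" "\<lambda>_ _. \<one>\<^bsub>k\<^esub>" "\<one>\<^bsub>\<Gamma>\<^esub>"
  by (rule twisted_monoid.intro) (simp_all add: H.m_assoc k.is_cring)

sublocale aug: augmented_ring B.A k B.total
  by (rule augmented_ring.intro[OF B.ring_A B.cring_k B.total_hom[OF refl]])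

end

text \<open>\<open>mul_U\<close> says two things at once: \<open>U\<close> is closed under products,
  and the complement of \<open>U\<close> spans a two-sided ideal. The maps \<open>\<iota>\<close>
  and \<open>f\<close> then describe the quotient by that ideal and an element that annihilates it
  from the right and is congruent to the unit.\<close>

locale split_algebra = monoid_algebra k \<Gamma> + twisted_monoid k D mul w e
  for k :: "('k, 'z) ring_scheme" and \<Gamma> :: "('h, 'x) monoid_scheme"
    and D :: "'d set" and mul w e +
  fixes U :: "'d set" and \<iota> :: "'h \<Rightarrow> 'd" and f :: "'d \<Rightarrow> 'k"
  assumes U: "U \<subseteq> D"
    and mul_U: "x \<in> D \<Longrightarrow> y \<in> D \<Longrightarrow> mul x y \<in> U \<longleftrightarrow> x \<in> U \<and> y \<in> U"
    and w_U: "x \<in> U \<Longrightarrow> y \<in> U \<Longrightarrow> w x y = \<one>\<^bsub>k\<^esub>"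
    and \<iota>: "bij_betw \<iota> (carrier \<Gamma>) U"
    and \<iota>_mult: "g \<in> carrier \<Gamma> \<Longrightarrow> h \<in> carrier \<Gamma> \<Longrightarrow> \<iota> (g \<otimes>\<^bsub>\<Gamma>\<^esub> h) = mul (\<iota> g) (\<iota> h)"
    and \<iota>_one: "\<iota> \<one>\<^bsub>\<Gamma>\<^esub> = e"
    and f: "f \<in> fin_supp k D"
    and f_U: "x \<in> U \<Longrightarrow> f x = (if x = e then \<one>\<^bsub>k\<^esub> else \<zero>\<^bsub>k\<^esub>)"
    and f_kill: "a \<in> fin_supp k D \<Longrightarrow> (\<And>u. u \<in> U \<Longrightarrow> a u = \<zero>\<^bsub>k\<^esub>) \<Longrightarrow> a \<otimes>\<^bsub>A\<^esub> f = \<zero>\<^bsub>A\<^esub>"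
begin

definition proj :: "('d \<Rightarrow> 'k) \<Rightarrow> 'h \<Rightarrow> 'k" where
  "proj a = (\<lambda>g. if g \<in> carrier \<Gamma> then a (\<iota> g) else \<zero>\<^bsub>k\<^esub>)"

text \<open>A section of \<open>proj\<close>, applied to coefficients of vectors. The matrices of
  the resolution keep their entries outside \<open>U\<close>, so a lifted cycle satisfies the cycle
  equation only modulo the kernel of \<open>proj\<close>.\<close>

definition lift :: "('h \<Rightarrow> 'k) \<Rightarrow> 'd \<Rightarrow> 'k" where
  "lift b = (\<lambda>d. if d \<in> U then b (inv_into (carrier \<Gamma>) \<iota> d) else \<zero>\<^bsub>k\<^esub>)"

lemma \<iota>_U: "g \<in> carrier \<Gamma> \<Longrightarrow> \<iota> g \<in> U"
  using \<iota> by (auto simp: bij_betw_def)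

lemma \<iota>_inj: "g \<in> carrier \<Gamma> \<Longrightarrow> h \<in> carrier \<Gamma> \<Longrightarrow> \<iota> g = \<iota> h \<longleftrightarrow> g = h"
  using \<iota> by (auto simp: bij_betw_def inj_on_def)

lemma UE: "u \<in> U \<Longrightarrow> (\<And>g. g \<in> carrier \<Gamma> \<Longrightarrow> u = \<iota> g \<Longrightarrow> thesis) \<Longrightarrow> thesis"
  using \<iota> by (auto simp: bij_betw_def)

lemma proj_closed:
  assumes a: "a \<in> fin_supp k D"
  shows "proj a \<in> fin_supp k (carrier \<Gamma>)"
proof (rule fin_suppI)
  show "finite {g \<in> carrier \<Gamma>. a (\<iota> g) \<noteq> \<zero>\<^bsub>k\<^esub>}"
  proof (rule inj_on_finite)
    show "inj_on \<iota> {g \<in> carrier \<Gamma>. a (\<iota> g) \<noteq> \<zero>\<^bsub>k\<^esub>}"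
      using \<iota>_inj by (auto simp: inj_on_def)
    show "\<iota> ` {g \<in> carrier \<Gamma>. a (\<iota> g) \<noteq> \<zero>\<^bsub>k\<^esub>} \<subseteq> {d. a d \<noteq> \<zero>\<^bsub>k\<^esub>}" by auto
    show "finite {d. a d \<noteq> \<zero>\<^bsub>k\<^esub>}" by (rule fin_supp_finite[OF a])
  qed
qed (auto simp: proj_def k.fin_supp_closed[OF a])

lemma lift_closed:
  assumes b: "b \<in> fin_supp k (carrier \<Gamma>)"
  shows "lift b \<in> fin_supp k D"
proof (rule fin_suppI)
  show "finite (\<iota> ` {g. b g \<noteq> \<zero>\<^bsub>k\<^esub>})" using fin_supp_finite[OF b] by simp
  show "{d. lift b d \<noteq> \<zero>\<^bsub>k\<^esub>} \<subseteq> \<iota> ` {g. b g \<noteq> \<zero>\<^bsub>k\<^esub>}"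
    using \<iota> by (auto simp: lift_def bij_betw_def f_inv_into_f image_iff intro!: exI[of _ "inv_into (carrier \<Gamma>) \<iota> _"] split: if_splits)
qed (use U in \<open>auto simp: lift_def k.fin_supp_closed[OF b]\<close>)

lemma proj_lift:
  assumes b: "b \<in> fin_supp k (carrier \<Gamma>)"
  shows "proj (lift b) = b"
proof
  fix g
  have "inv_into (carrier \<Gamma>) \<iota> (\<iota> g) = g" if "g \<in> carrier \<Gamma>"
    using \<iota> that by (simp add: bij_betw_def)
  then show "proj (lift b) g = b g"
    by (simp add: proj_def lift_def \<iota>_U fin_supp_outside[OF b])
qed

lemma proj_single:
  "g \<in> carrier \<Gamma> \<Longrightarrow> proj (single k (\<iota> g) a) = single k g a"
  "x \<notin> U \<Longrightarrow> proj (single k x a) = (\<lambda>_. \<zero>\<^bsub>k\<^esub>)"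
  using \<iota>_inj \<iota>_U by (auto simp: proj_def single_def fun_eq_iff)

lemma proj_add: "proj (\<lambda>d. a d \<oplus>\<^bsub>k\<^esub> b d) = (\<lambda>g. proj a g \<oplus>\<^bsub>k\<^esub> proj b g)"
  by (auto simp: proj_def)

lemma proj_hom: "proj \<in> ring_hom A B.A"
proof (rule ring_hom_from_basis[OF B.ring_A])
  show "proj f \<in> carrier B.A" if "f \<in> fin_supp k D" for f
    using proj_closed[OF that] by simp
  show "proj (\<lambda>d. f d \<oplus>\<^bsub>k\<^esub> g d) = proj f \<oplus>\<^bsub>B.A\<^esub> proj g" for f g
    by (simp add: proj_add)
  show "proj (single k e \<one>\<^bsub>k\<^esub>) = \<one>\<^bsub>B.A\<^esub>"
    unfolding \<iota>_one[symmetric] by (simp add: proj_single)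
  fix x y a b assume *: "x \<in> D" "y \<in> D" "a \<in> carrier k" "b \<in> carrier k"
  show "proj (single k (mul x y) (w x y \<otimes>\<^bsub>k\<^esub> (a \<otimes>\<^bsub>k\<^esub> b))) =
      proj (single k x a) \<otimes>\<^bsub>B.A\<^esub> proj (single k y b)"
  proof (cases "x \<in> U \<and> y \<in> U")
    case True
    then obtain g h where gh: "g \<in> carrier \<Gamma>" "h \<in> carrier \<Gamma>" "x = \<iota> g" "y = \<iota> h"
      by (auto elim!: UE)
    have "mul x y = \<iota> (g \<otimes>\<^bsub>\<Gamma>\<^esub> h)" and "w x y = \<one>\<^bsub>k\<^esub>"
      using True by (simp_all only: gh(3,4) \<iota>_mult[OF gh(1,2)] w_U)
    then have "proj (single k (mul x y) (w x y \<otimes>\<^bsub>k\<^esub> (a \<otimes>\<^bsub>k\<^esub> b))) =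
        single k (g \<otimes>\<^bsub>\<Gamma>\<^esub> h) (\<one>\<^bsub>k\<^esub> \<otimes>\<^bsub>k\<^esub> (a \<otimes>\<^bsub>k\<^esub> b))"
      by (simp only: proj_single(1)[OF H.m_closed[OF gh(1,2)]])
    also have "\<dots> = single k g a \<otimes>\<^bsub>B.A\<^esub> single k h b"
      by (rule B.mult_single[OF gh(1,2) *(3,4), symmetric])
    finally show ?thesis
      by (simp only: gh(3,4) proj_single(1)[OF gh(1)] proj_single(1)[OF gh(2)])
  next
    case False
    have z: "proj (single k z c) \<in> fin_supp k (carrier \<Gamma>)" if "z \<in> D" "c \<in> carrier k" for z c
      by (rule proj_closed[OF k.fin_supp_single[OF that]])
    \<comment> \<open>If a factor lies outside \<open>U\<close>, so does the product, and both sides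
      are zero.\<close>
    have "mul x y \<notin> U" using False mul_U[OF *(1,2)] by blast
    moreover have "proj (single k x a) \<otimes>\<^bsub>B.A\<^esub> proj (single k y b) = (\<lambda>_. \<zero>\<^bsub>k\<^esub>)"
    proof (cases "x \<in> U")
      case True
      then have "y \<notin> U" using False by blast
      then show ?thesis
        by (simp only: proj_single(2) B.mult_zero(2)[OF z[OF *(1,3)]] not_False_eq_True)
    next
      case False
      then show ?thesis
        by (simp only: proj_single(2) B.mult_zero(1)[OF z[OF *(2,4)]] not_False_eq_True)
    qed
    ultimately show ?thesis by (simp only: proj_single(2) not_False_eq_True)
  qed
qed

lemma proj_f: "proj f = \<one>\<^bsub>B.A\<^esub>"
  using f_U \<iota>_U \<iota>_one \<iota>_inj[OF _ H.one_closed]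
  by (auto simp: proj_def single_def)

lemma proj_mult_f:
  assumes "a \<in> fin_supp k D"
  shows "proj (a \<otimes>\<^bsub>A\<^esub> f) = proj a"
  using ring_hom_mult[OF proj_hom, of a f] assms f proj_f B.one_mult(2)[OF proj_closed[OF assms]]
  by simp

lemma kill: "x \<in> fin_supp k D \<Longrightarrow> proj x = (\<lambda>_. \<zero>\<^bsub>k\<^esub>) \<Longrightarrow> x \<otimes>\<^bsub>A\<^esub> f = (\<lambda>_. \<zero>\<^bsub>k\<^esub>)"
proof -
  assume x: "x \<in> fin_supp k D" and p: "proj x = (\<lambda>_. \<zero>\<^bsub>k\<^esub>)"
  have "x u = \<zero>\<^bsub>k\<^esub>" if uU: "u \<in> U" for u
  proof -
    obtain g where g: "g \<in> carrier \<Gamma>" "u = \<iota> g" using uU by (rule UE)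
    show ?thesis using fun_cong[OF p, of g] g by (simp add: proj_def)
  qed
  then show ?thesis using f_kill[OF x] by simp
qed

text \<open>This \<open>\<epsilon>\<close> is the augmentation of \<open>A\<close>, not the
  parameter of the rook algebra. It factors through \<open>proj\<close> by construction, so the
  complex computing \<open>Tor\<close> depends on the resolution only through its image under
  \<open>proj\<close>.\<close>

definition \<epsilon> :: "('d \<Rightarrow> 'k) \<Rightarrow> 'k" where
  "\<epsilon> a = B.total (proj a)"

abbreviation "M \<equiv> trivial_module k U"

lemma \<epsilon>_hom: "\<epsilon> \<in> ring_hom A k"
proof -
  have "B.total \<circ> proj \<in> ring_hom A k"
    by (rule ring_hom_trans[OF proj_hom aug.\<eta>])
  then show ?thesis by (simp add: \<epsilon>_def[abs_def] comp_def)
qed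

lemma \<epsilon>_eq:
  assumes a: "a \<in> fin_supp k D"
  shows "\<epsilon> a = (\<Oplus>\<^bsub>k\<^esub>d\<in>{d \<in> U. a d \<noteq> \<zero>\<^bsub>k\<^esub>}. a d)"
proof -
  let ?G = "{g \<in> carrier \<Gamma>. proj a g \<noteq> \<zero>\<^bsub>k\<^esub>}"
  have im: "{d \<in> U. a d \<noteq> \<zero>\<^bsub>k\<^esub>} = \<iota> ` ?G"
    by (auto elim!: UE simp: proj_def \<iota>_U)
  have "(\<Oplus>\<^bsub>k\<^esub>d\<in>\<iota> ` ?G. a d) = (\<Oplus>\<^bsub>k\<^esub>g\<in>?G. a (\<iota> g))"
    by (rule k.finsum_reindex) (auto simp: k.fin_supp_closed[OF a] inj_on_def \<iota>_inj)
  also have "\<dots> = (\<Oplus>\<^bsub>k\<^esub>g\<in>?G. proj a g)"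
    by (rule k.add.finprod_cong') (auto simp: proj_def k.fin_supp_closed[OF a])
  finally show ?thesis by (simp add: \<epsilon>_def B.total_def im)
qed

sublocale M: augmented_algebra A k \<epsilon> M
proof (intro augmented_algebra.intro augmented_algebra_axioms.intro augmented_ring.intro)
  show "ring A" "cring k" "\<epsilon> \<in> ring_hom A k" by (rule ring_A, rule cring_k, rule \<epsilon>_hom)
  show "c \<odot>\<^bsub>A\<^esub> \<one>\<^bsub>A\<^esub> \<in> carrier A" if "c \<in> carrier k" for c
    unfolding scalar[OF that] using that by simp
  show "\<epsilon> (c \<odot>\<^bsub>A\<^esub> \<one>\<^bsub>A\<^esub>) = c" if "c \<in> carrier k" for c
    using proj_single(1)[OF H.one_closed, of c] B.total_single[OF H.one_closed that]
    by (simp only: scalar[OF that] \<epsilon>_def \<iota>_one)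
  show "b \<odot>\<^bsub>M\<^esub> x = \<epsilon> b \<otimes>\<^bsub>k\<^esub> x" if "b \<in> carrier A" "x \<in> carrier k" for b x
    using that by (simp add: trivial_module_def \<epsilon>_eq)
qed (simp_all add: trivial_module_def)

abbreviation "S \<equiv> res_gens A M"

text \<open>The differential of the standard resolution after change of rings. One matrix serves all
  degrees because each basis element \<open>Syz X\<close> carries its own boundary.\<close>

definition V :: "(('d \<Rightarrow> 'k, 'k) res_basis) \<Rightarrow> (('d \<Rightarrow> 'k, 'k) res_basis) \<Rightarrow> 'h \<Rightarrow> 'k" where
  "V s t = proj (syz_fun A s t)"

lemma V_eq: "V = (\<lambda>s t. proj (syz_fun A s t))"
  by (intro ext) (simp only: V_def)

lemma proj_push: "u \<in> fin_supp A X \<Longrightarrow> (\<lambda>s. proj (u s)) \<in> fin_supp B.A X"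
  by (rule fin_supp_hom[OF ring_A B.ring_A proj_hom])

lemma proj_lin:
  "u \<in> fin_supp A X \<Longrightarrow> v \<in> X \<rightarrow> fin_supp A Y \<Longrightarrow>
    (\<lambda>t. proj (lin A v u t)) = lin B.A (\<lambda>s t. proj (v s t)) (\<lambda>s. proj (u s))"
  by (rule lin_hom[OF ring_A B.ring_A proj_hom])

lemma augment_eq:
  assumes u: "u \<in> fin_supp A (S 0)"
  shows "res_augment A M u = res_aug k B.total (gen_value k) (\<lambda>s. proj (u s))"
proof -
  define F where "F = {m. u (Gen m) \<noteq> \<zero>\<^bsub>A\<^esub>}"
  have S0: "S 0 = Gen ` carrier k" by (simp add: trivial_module_def)
  have Fk: "m \<in> carrier k" if "m \<in> F" for m
  proof -
    have "Gen m \<in> S 0" using fin_supp_subset[OF u] that unfolding F_def by blast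
    then show ?thesis unfolding S0 by auto
  qed
  have supp: "{s. u s \<noteq> \<zero>\<^bsub>A\<^esub>} = Gen ` F"
  proof
    show "{s. u s \<noteq> \<zero>\<^bsub>A\<^esub>} \<subseteq> Gen ` F"
      using fin_supp_subset[OF u] unfolding S0 F_def by blast
  qed (simp add: F_def image_subset_iff)
  have \<epsilon>u: "(\<lambda>s. \<epsilon> (u s)) \<in> fin_supp k (S 0)" by (rule M.push[OF u])
  have c: "\<epsilon> (u s) \<in> carrier k" for s by (rule k.fin_supp_closed[OF \<epsilon>u])
  have uA: "u s \<in> carrier A" for s by (rule A.fin_supp_closed[OF u])
  have gv: "(\<lambda>s (_::unit). gen_value k s) \<in> S 0 \<rightarrow> fin_supp k UNIV"
    by (rule M.aug_mat) (simp add: trivial_module_def Pi_iff)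
  have "res_augment A M u = finsum M (\<lambda>m. u (Gen m) \<odot>\<^bsub>M\<^esub> m) F"
    unfolding res_augment_def F_def ..
  \<comment> \<open>A finite sum depends only on carrier, zero and addition, and these are the same
    in \<open>M\<close> and in \<open>k\<close>.\<close>
  also have "\<dots> = finsum k (\<lambda>m. u (Gen m) \<odot>\<^bsub>M\<^esub> m) F"
    unfolding finsum_def finprod_def by (simp add: trivial_module_def)
  also have "\<dots> = (\<Oplus>\<^bsub>k\<^esub>m\<in>F. m \<otimes>\<^bsub>k\<^esub> \<epsilon> (u (Gen m)))"
  proof (rule k.add.finprod_cong'[OF refl])
    show "(\<lambda>m. m \<otimes>\<^bsub>k\<^esub> \<epsilon> (u (Gen m))) \<in> F \<rightarrow> carrier k"
      using Fk c by simp
    fix m assume m: "m \<in> F"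
    show "u (Gen m) \<odot>\<^bsub>M\<^esub> m = m \<otimes>\<^bsub>k\<^esub> \<epsilon> (u (Gen m))"
      unfolding M.smult_N[OF uA Fk[OF m]] by (rule k.m_comm[OF c Fk[OF m]])
  qed
  also have "\<dots> = (\<Oplus>\<^bsub>k\<^esub>s\<in>{s. u s \<noteq> \<zero>\<^bsub>A\<^esub>}. gen_value k s \<otimes>\<^bsub>k\<^esub> \<epsilon> (u s))"
    unfolding supp by (subst k.finsum_reindex) (use Fk c in \<open>simp_all add: inj_on_def image_subset_iff Pi_iff\<close>)
  also have "\<dots> = lin k (\<lambda>s (_::unit). gen_value k s) (\<lambda>s. \<epsilon> (u s)) ()"
  proof (rule k.lin_eq[OF \<epsilon>u gv, symmetric])
    show "finite {s. u s \<noteq> \<zero>\<^bsub>A\<^esub>}" by (rule fin_supp_finite[OF u])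
    have "\<epsilon> \<zero>\<^bsub>A\<^esub> = \<zero>\<^bsub>k\<^esub>" by (rule M.\<eta>.hom_zero)
    then show "{s. \<epsilon> (u s) \<noteq> \<zero>\<^bsub>k\<^esub>} \<subseteq> {s. u s \<noteq> \<zero>\<^bsub>A\<^esub>}" by force
    show "{s. u s \<noteq> \<zero>\<^bsub>A\<^esub>} \<subseteq> S 0" by (rule fin_supp_subset[OF u])
  qed
  finally show ?thesis by (simp only: res_aug_def \<epsilon>_def)
qed

lemma syz_cycle_proj:
  assumes u: "u \<in> fin_supp A (S i)" and c: "syz_cycle A M i u"
  shows "(\<lambda>s. proj (u s)) \<in> res_cycles B.A k B.total S (\<lambda>_. V) (gen_value k) i"
proof (cases i)
  case 0
  then show ?thesis
    using u c proj_push[OF u] augment_eq[of u]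
    by (simp add: res_cycles_def syz_cycle_def trivial_module_def)
next
  case (Suc j)
  have u': "u \<in> fin_supp A (S (Suc j))" using u Suc by simp
  have "lin B.A V (\<lambda>s. proj (u s)) = (\<lambda>t. proj (lin A (syz_fun A) u t))"
    unfolding V_eq by (rule proj_lin[OF u' syz_fun_mat, symmetric])
  also have "\<dots> = (\<lambda>_. \<zero>\<^bsub>B.A\<^esub>)"
    using c Suc by (simp add: syz_cycle_def res_diff_eq_lin proj_def)
  finally show ?thesis using Suc proj_push[OF u] by (simp add: res_cycles_def)
qed

lemma V_mat: "V \<in> S (Suc i) \<rightarrow> fin_supp B.A (S i)"
  unfolding V_eq by (rule funcsetI) (rule proj_push[OF funcset_mem[OF syz_fun_mat]])

text \<open>Exactness is inherited: a lift of a cycle becomes a cycle after multiplication with \<open>f\<close>,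
  which annihilates the kernel of \<open>proj\<close> and is mapped to \<open>1\<close>.\<close>

lemma resolution: "free_resolution B.A k B.total S (\<lambda>_. V) (gen_value k)"
proof (intro free_resolution.intro free_resolution_axioms.intro)
  show "augmented_ring B.A k B.total" ..
  show "V \<in> S (Suc i) \<rightarrow> fin_supp B.A (S i)" for i by (rule V_mat)
  show "gen_value k \<in> S 0 \<rightarrow> carrier k" by (auto simp: trivial_module_def)
  show "V s \<in> res_cycles B.A k B.total S (\<lambda>_. V) (gen_value k) i" if s: "s \<in> S (Suc i)" for s i
  proof -
    obtain u where u: "u \<in> fin_supp A (S i)" "syz_cycle A M i u" "syz_fun A s = u"
      using s by (rule res_gensE)
    then have "V s = (\<lambda>t. proj (u t))" by (simp add: V_eq)
    then show ?thesis using syz_cycle_proj[OF u(1,2)] by simp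
  qed
  show "\<exists>u\<in>fin_supp B.A (S 0). res_aug k B.total (gen_value k) u = c" if c: "c \<in> carrier k" for c
  proof (rule bexI)
    show "res_aug k B.total (gen_value k) (single B.A (Gen c) \<one>\<^bsub>B.A\<^esub>) = c"
      using c by (subst aug.res_aug_single) (simp_all add: B.total_single)
    show "single B.A (Gen c) \<one>\<^bsub>B.A\<^esub> \<in> fin_supp B.A (S 0)"
      using c by (intro B.A.fin_supp_single) (auto simp: trivial_module_def)
  qed
  fix u i assume u: "u \<in> res_cycles B.A k B.total S (\<lambda>_. V) (gen_value k) i"
  have u': "u \<in> fin_supp B.A (S i)" using u by (simp add: res_cycles_def)
  have us: "u s \<in> fin_supp k (carrier \<Gamma>)" for s
    using B.A.fin_supp_closed[OF u', of s] by simp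
  define p where "p s = lift (u s)" for s
  have proj_p: "(\<lambda>s. proj (p s)) = u" by (simp add: p_def proj_lift[OF us])
  have p: "p \<in> fin_supp A (S i)"
  proof (rule fin_suppI[OF _ _ fin_supp_finite[OF u']])
    show "p s \<in> carrier A" for s by (simp add: p_def lift_closed[OF us])
    have z: "lift \<zero>\<^bsub>B.A\<^esub> = \<zero>\<^bsub>A\<^esub>" by (simp add: lift_def fun_eq_iff)
    show "p s = \<zero>\<^bsub>A\<^esub>" if "s \<notin> S i" for s
      using fin_supp_outside[OF u' that] z by (simp add: p_def)
    show "{s. p s \<noteq> \<zero>\<^bsub>A\<^esub>} \<subseteq> {s. u s \<noteq> \<zero>\<^bsub>B.A\<^esub>}"
      using z by (auto simp: p_def)
  qed
  have ps: "p s \<in> fin_supp k D" for s using A.fin_supp_closed[OF p, of s] by simp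
  define q where "q s = p s \<otimes>\<^bsub>A\<^esub> f" for s
  have q: "q \<in> fin_supp A (S i)"
    unfolding q_def using p f by (intro A.fin_supp_rmult) simp_all
  have proj_q: "(\<lambda>s. proj (q s)) = u"
    unfolding q_def proj_mult_f[OF ps] by (rule proj_p)
  have "syz_cycle A M i q"
  proof (cases i)
    case 0
    then show ?thesis
      using q augment_eq[of q] u by (simp add: syz_cycle_def proj_q res_cycles_def trivial_module_def)
  next
    case (Suc j)
    have p': "p \<in> fin_supp A (S (Suc j))" using p Suc by simp
    have c: "lin A (syz_fun A) p t \<in> fin_supp k D" for t
      using A.fin_supp_closed[OF A.lin_closed[OF p' syz_fun_mat], of t] by simp
    have "(\<lambda>t. proj (lin A (syz_fun A) p t)) = lin B.A V u"
      unfolding proj_lin[OF p' syz_fun_mat] proj_p V_eq ..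
    also have "\<dots> = (\<lambda>_. \<zero>\<^bsub>B.A\<^esub>)" using u Suc by (simp add: res_cycles_def)
    finally have z: "proj (lin A (syz_fun A) p t) = (\<lambda>_. \<zero>\<^bsub>k\<^esub>)" for t
      by (simp add: fun_eq_iff)
    \<comment> \<open>\<open>f\<close> stands to the right of the coefficients, so it passes through
      the differential and meets a boundary lying in the kernel of \<open>proj\<close>.\<close>
    have "lin A (syz_fun A) q t = lin A (syz_fun A) p t \<otimes>\<^bsub>A\<^esub> f" for t
      unfolding q_def by (rule A.lin_rmult[OF p' syz_fun_mat]) (simp add: f)
    then have "lin A (syz_fun A) q = (\<lambda>_. \<zero>\<^bsub>A\<^esub>)"
      using kill[OF c z] by (simp add: fun_eq_iff)
    then show ?thesis using Suc by (simp add: syz_cycle_def res_diff_eq_lin)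
  qed
  \<comment> \<open>Every cycle is a boundary of a generator in the standard resolution; hence the
    corrected lift \<open>q\<close> is the boundary of a single basis element, and \<open>u\<close>
    is the image of that element.\<close>
  then have s: "syz A q \<in> S (Suc i)" unfolding res_gens_Suc using q by blast
  have "lin B.A V (delta B.A (syz A q)) = V (syz A q)"
    by (rule B.A.lin_delta) (rule B.A.mat_closed[OF V_mat s])
  also have "\<dots> = u" unfolding V_eq syz_fun_syz[OF q] by (rule proj_q)
  finally show "\<exists>x\<in>fin_supp B.A (S (Suc i)). lin B.A V x = u"
    using B.A.fin_supp_delta[OF s] by blast
qed

lemma Tor_iso:
  shows "graded_isomorphic k (Tor k A M M)
      (homology (\<lambda>i. free_module k (S i)) (\<lambda>i. lin k (\<lambda>s t. B.total (V s t))))"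
    and "module k (Tor k A M M i)"
proof -
  have eq: "\<epsilon> (syz_fun A s t) = B.total (V s t)" for s t by (simp add: \<epsilon>_def V_eq)
  have C: "chain_complex k (\<lambda>i. free_module k (S i)) (\<lambda>i. lin k (\<lambda>s t. \<epsilon> (syz_fun A s t)))"
    unfolding eq by (rule free_resolution.chain_complex_reduction[OF resolution])
  have T: "Tor k A M M = homology (\<lambda>i. tensor k A (free_module A (S i)) M)
    (\<lambda>i. tensor_map k A (free_module A (S i)) M (lin A (syz_fun A)))"
    by (simp add: Tor_def std_resolution_def res_diff_eq_lin)
  note tc = M.tensor_complex[of "\<lambda>_. syz_fun A" S, OF syz_fun_mat C]
  show "graded_isomorphic k (Tor k A M M)
      (homology (\<lambda>i. free_module k (S i)) (\<lambda>i. lin k (\<lambda>s t. B.total (V s t))))"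
    using tc(2) unfolding T eq .
  show "module k (Tor k A M M i)"
    unfolding T by (rule chain_complex.module_homology[OF tc(1)])
qed

end

section \<open>The bar resolution\<close>

lemma homology_cong:
  assumes "\<And>i x. x \<in> carrier (C (Suc i)) \<Longrightarrow> d i x = d' i x"
  shows "homology C d = homology C d'"
proof
  fix i
  have "cycles C d i = cycles C d' i"
    using assms by (auto simp: cycles_def split: nat.splits)
  moreover have "d i ` carrier (C (Suc i)) = d' i ` carrier (C (Suc i))"
    using assms by (intro image_cong) auto
  ultimately show "homology C d i = homology C d' i" by (simp add: homology_def)
qed

lemma (in abelian_group) eq_add_imp_zero:
  assumes "x = y \<oplus> x" "x \<in> carrier G" "y \<in> carrier G"
  shows "y = \<zero>"
proof -
  have "y = (y \<oplus> x) \<ominus> x"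
    using assms(2,3) by (simp add: a_minus_def a_assoc r_neg)
  then show ?thesis
    using assms(2) by (simp add: assms(1)[symmetric] minus_eq_zero_iff)
qed

text \<open>The contraction of the bar complex appends a letter at the end; these faces do not see
  it. The face that does is treated by \<open>bar_face_append_last\<close>.\<close>

lemma bar_face_append:
  assumes "j < length xs"
  shows "bar_face H j (xs @ [g]) = bar_face H j xs @ [g]"
proof (cases "j = 0")
  case True
  then show ?thesis using assms by (cases xs) (simp_all add: bar_face_def)
next
  case False
  then have "j - 1 < length xs" using assms by simp
  then show ?thesis using assms False by (simp add: bar_face_def nth_append)
qed

lemma bar_face_append_last:
  assumes "xs \<noteq> []"
  shows "bar_face H (length xs) (xs @ [g]) = butlast xs @ [last xs \<otimes>\<^bsub>H\<^esub> g]"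
  using assms by (simp add: bar_face_def nth_append butlast_conv_take last_conv_nth)

lemma bar_face_length: "xs \<noteq> [] \<Longrightarrow> bar_face H (length xs) xs = butlast xs"
  by (simp add: bar_face_def)

context monoid_algebra
begin

section \<open>The bar complex and its contraction\<close>

abbreviation "B \<equiv> B.A"

definition bar_gens :: "nat \<Rightarrow> 'h list set" where
  "bar_gens i = {xs. set xs \<subseteq> carrier \<Gamma> \<and> length xs = i}"

definition sg :: "nat \<Rightarrow> 'k" where
  "sg j = (\<ominus>\<^bsub>k\<^esub> \<one>\<^bsub>k\<^esub>) [^]\<^bsub>k\<^esub> j"

text \<open>Only the last face acts on the coefficients, namely by the letter that it drops.\<close>

definition bar_act :: "nat \<Rightarrow> nat \<Rightarrow> 'h list \<Rightarrow> 'h" where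
  "bar_act i j xs = (if j = Suc i then last xs else \<one>\<^bsub>\<Gamma>\<^esub>)"

definition bar_mat :: "nat \<Rightarrow> 'h list \<Rightarrow> 'h list \<Rightarrow> 'h \<Rightarrow> 'k" where
  "bar_mat i xs = (\<lambda>t. \<Oplus>\<^bsub>B\<^esub>j\<in>{..Suc i}.
     single B (bar_face \<Gamma> j xs) (single k (bar_act i j xs) (sg j)) t)"

text \<open>The sign makes \<open>bar_htpy\<close> a contraction of the augmented complex.\<close>

definition bar_htpy :: "nat \<Rightarrow> ('h list \<Rightarrow> 'h \<Rightarrow> 'k) \<Rightarrow> 'h list \<Rightarrow> 'h \<Rightarrow> 'k" where
  "bar_htpy i u zs =
     single k \<one>\<^bsub>\<Gamma>\<^esub> (if zs = [] then \<zero>\<^bsub>k\<^esub> else sg (Suc i) \<otimes>\<^bsub>k\<^esub> u (butlast zs) (last zs))"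

lemma sg_closed [simp]: "sg j \<in> carrier k"
  by (simp add: sg_def)

lemma sg_0: "sg 0 = \<one>\<^bsub>k\<^esub>"
  by (simp add: sg_def)

lemma sg_Suc: "sg (Suc j) = \<ominus>\<^bsub>k\<^esub> sg j"
  by (simp add: sg_def k.r_minus)

lemma sg_sg: "sg j \<otimes>\<^bsub>k\<^esub> sg j = \<one>\<^bsub>k\<^esub>"
  by (induction j) (simp_all add: sg_0 sg_Suc k.l_minus k.r_minus)

lemma bar_face_gens:
  assumes xs: "xs \<in> bar_gens (Suc i)" and j: "j \<le> Suc i"
  shows "bar_face \<Gamma> j xs \<in> bar_gens i"
proof -
  have x: "set xs \<subseteq> carrier \<Gamma>" "length xs = Suc i" using xs by (auto simp: bar_gens_def)
  consider "j = 0" | "j = Suc i" | "0 < j" "j < Suc i" using j by linarith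
  then show ?thesis
  proof cases
    case 1
    then show ?thesis using x by (cases xs) (auto simp: bar_face_def bar_gens_def)
  next
    case 2
    then show ?thesis using x by (auto simp: bar_face_def bar_gens_def dest: in_set_butlastD)
  next
    case 3
    then have "j - 1 < length xs" "j < length xs" using x by simp_all
    then have "xs ! (j - 1) \<in> carrier \<Gamma>" "xs ! j \<in> carrier \<Gamma>"
      using x(1) nth_mem by blast+
    moreover have "set (take (j - 1) xs) \<subseteq> carrier \<Gamma>" "set (drop (j + 1) xs) \<subseteq> carrier \<Gamma>"
      using x(1) set_take_subset set_drop_subset by (metis order_trans)+
    ultimately show ?thesis using x(2) 3 by (simp add: bar_face_def bar_gens_def)
  qed
qed

lemma bar_act_closed: "xs \<in> bar_gens (Suc i) \<Longrightarrow> bar_act i j xs \<in> carrier \<Gamma>"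
  by (cases xs rule: rev_cases) (auto simp: bar_act_def bar_gens_def)

lemma bar_term:
  assumes "xs \<in> bar_gens (Suc i)" "j \<le> Suc i" "c \<in> carrier k"
  shows "single B (bar_face \<Gamma> j xs) (single k (bar_act i j xs) c) \<in> fin_supp B (bar_gens i)"
proof (rule B.A.fin_supp_single)
  show "bar_face \<Gamma> j xs \<in> bar_gens i" by (rule bar_face_gens[OF assms(1,2)])
  show "single k (bar_act i j xs) c \<in> carrier B"
    using k.fin_supp_single[OF bar_act_closed[OF assms(1)] assms(3)] by simp
qed

lemma bar_mat: "bar_mat i \<in> bar_gens (Suc i) \<rightarrow> fin_supp B (bar_gens i)"
proof (rule funcsetI)
  fix xs assume xs: "xs \<in> bar_gens (Suc i)"
  show "bar_mat i xs \<in> fin_supp B (bar_gens i)"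
    unfolding bar_mat_def by (rule B.A.fin_supp_finsum[OF _ bar_term[OF xs _ sg_closed]]) simp_all
qed

lemma monomial_closed: "g \<in> carrier \<Gamma> \<Longrightarrow> c \<in> carrier k \<Longrightarrow> single k g c \<in> carrier B"
  unfolding B.A_simps(1) by (rule k.fin_supp_single)

lemma mono_closed: "xs \<in> bar_gens i \<Longrightarrow> g \<in> carrier \<Gamma> \<Longrightarrow> c \<in> carrier k \<Longrightarrow>
    single B xs (single k g c) \<in> fin_supp B (bar_gens i)"
  by (rule B.A.fin_supp_single[OF _ monomial_closed])

lemma face_closed:
  assumes "xs \<in> bar_gens (Suc i)" "j \<le> Suc i" "h \<in> carrier \<Gamma>" "c \<in> carrier k"
  shows "single B (bar_face \<Gamma> j xs) (single k h c) \<in> fin_supp B (bar_gens i)"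
    and "single B (bar_face \<Gamma> j xs) (single k h c) t \<in> carrier B"
proof -
  show *: "single B (bar_face \<Gamma> j xs) (single k h c) \<in> fin_supp B (bar_gens i)"
    by (rule mono_closed[OF bar_face_gens[OF assms(1,2)] assms(3,4)])
  show "single B (bar_face \<Gamma> j xs) (single k h c) t \<in> carrier B"
    by (rule B.A.fin_supp_closed[OF *])
qed

text \<open>The contraction is additive but not linear over \<open>B\<close>, so vectors have to be
  decomposed beyond entries in \<open>B\<close>, down to scalar multiples of single monoid
  elements.\<close>

lemma mono_induct [consumes 1, case_names zero mono add]:
  assumes u: "u \<in> fin_supp B X"
    and zero: "P (\<lambda>_. \<zero>\<^bsub>B\<^esub>)"
    and mono: "\<And>s g c. s \<in> X \<Longrightarrow> g \<in> carrier \<Gamma> \<Longrightarrow> c \<in> carrier k \<Longrightarrow> P (single B s (single k g c))"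
    and add: "\<And>f g. \<lbrakk>f \<in> fin_supp B X; g \<in> fin_supp B X; P f; P g\<rbrakk> \<Longrightarrow> P (\<lambda>s. f s \<oplus>\<^bsub>B\<^esub> g s)"
  shows "P u"
  using u
proof (induction rule: B.A.fin_supp_induct)
  case zero
  show ?case by (rule assms(2))
next
  case (single s b)
  have "b \<in> fin_supp k (carrier \<Gamma>)" using single(2) unfolding B.A_simps(1) .
  then show ?case
  proof (induction rule: k.fin_supp_induct)
    case zero
    have "single B s (\<lambda>_. \<zero>\<^bsub>k\<^esub>) = (\<lambda>_. \<zero>\<^bsub>B\<^esub>)" by (simp add: single_def fun_eq_iff)
    then show ?case using assms(2) by simp
  next
    case (single g c)
    then show ?case using \<open>s \<in> X\<close> by (intro mono)
  next
    case (add b b')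
    have "single B s (\<lambda>g. b g \<oplus>\<^bsub>k\<^esub> b' g) = (\<lambda>t. single B s b t \<oplus>\<^bsub>B\<^esub> single B s b' t)"
      by (auto simp: single_def fun_eq_iff)
    moreover have "single B s b \<in> fin_supp B X" "single B s b' \<in> fin_supp B X"
      using add.hyps unfolding B.A_simps(1)[symmetric] by (simp_all only: B.A.fin_supp_single[OF \<open>s \<in> X\<close>])
    ultimately show ?case using assms(4)[OF _ _ add.IH] by (simp only:)
  qed
next
  case (add f g)
  then show ?case by (rule assms(4))
qed

lemma single_mult:
  assumes "h \<in> carrier \<Gamma>" "h' \<in> carrier \<Gamma>" "c \<in> carrier k" "c' \<in> carrier k"
  shows "single B z (single k h c) t \<otimes>\<^bsub>B\<^esub> single k h' c' =
    single B z (single k (h \<otimes>\<^bsub>\<Gamma>\<^esub> h') (c \<otimes>\<^bsub>k\<^esub> c')) t"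
proof -
  have z: "(\<lambda>_. \<zero>\<^bsub>k\<^esub>) \<otimes>\<^bsub>B\<^esub> single k h' c' = (\<lambda>_. \<zero>\<^bsub>k\<^esub>)"
    by (rule B.mult_zero(1)[OF k.fin_supp_single[OF assms(2,4)]])
  have "single k h c \<otimes>\<^bsub>B\<^esub> single k h' c' = single k (h \<otimes>\<^bsub>\<Gamma>\<^esub> h') (c \<otimes>\<^bsub>k\<^esub> c')"
    using B.mult_single[OF assms] assms(3,4) by (simp only: k.l_one k.m_closed)
  then show ?thesis
    using z by (cases "t = z") (simp_all only: single_def[of B] B.A_simps(3) if_True if_False simp_thms)
qed

lemma bar_mat_mono:
  assumes xs: "xs \<in> bar_gens (Suc i)" and g: "g \<in> carrier \<Gamma>" and c: "c \<in> carrier k"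
  shows "lin B (bar_mat i) (single B xs (single k g c)) = (\<lambda>t. \<Oplus>\<^bsub>B\<^esub>j\<in>{..Suc i}.
    single B (bar_face \<Gamma> j xs) (single k (bar_act i j xs \<otimes>\<^bsub>\<Gamma>\<^esub> g) (sg j \<otimes>\<^bsub>k\<^esub> c)) t)"
proof
  fix t
  have b: "single k g c \<in> carrier B" by (rule monomial_closed[OF g c])
  have "lin B (bar_mat i) (single B xs (single k g c)) t = bar_mat i xs t \<otimes>\<^bsub>B\<^esub> single k g c"
    by (rule B.A.lin_single[where v = "bar_mat i" and s = xs, OF B.A.mat_closed[OF bar_mat xs] b])
  also have "\<dots> = (\<Oplus>\<^bsub>B\<^esub>j\<in>{..Suc i}. single B (bar_face \<Gamma> j xs) (single k (bar_act i j xs) (sg j)) t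
      \<otimes>\<^bsub>B\<^esub> single k g c)"
    unfolding bar_mat_def
    by (rule B.A.finsum_ldistr[OF finite_atMost b], rule funcsetI,
      rule B.A.fin_supp_closed[OF bar_term[OF xs _ sg_closed]]) simp
  also have "\<dots> = (\<Oplus>\<^bsub>B\<^esub>j\<in>{..Suc i}. single B (bar_face \<Gamma> j xs)
      (single k (bar_act i j xs \<otimes>\<^bsub>\<Gamma>\<^esub> g) (sg j \<otimes>\<^bsub>k\<^esub> c)) t)"
    by (simp only: single_mult[OF bar_act_closed[OF xs] g sg_closed c])
  finally show "lin B (bar_mat i) (single B xs (single k g c)) t = (\<Oplus>\<^bsub>B\<^esub>j\<in>{..Suc i}.
    single B (bar_face \<Gamma> j xs) (single k (bar_act i j xs \<otimes>\<^bsub>\<Gamma>\<^esub> g) (sg j \<otimes>\<^bsub>k\<^esub> c)) t)" .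
qed

lemma bar_htpy_closed:
  assumes u: "u \<in> fin_supp B (bar_gens i)"
  shows "bar_htpy i u \<in> fin_supp B (bar_gens (Suc i))"
proof (rule fin_suppI)
  have us: "u s \<in> fin_supp k (carrier \<Gamma>)" for s using B.A.fin_supp_closed[OF u, of s] by simp
  note c = k.fin_supp_closed[OF us]
  show "bar_htpy i u zs \<in> carrier B" for zs by (simp add: bar_htpy_def c)
  have z: "single k \<one>\<^bsub>\<Gamma>\<^esub> \<zero>\<^bsub>k\<^esub> = \<zero>\<^bsub>B\<^esub>" by (simp add: single_def fun_eq_iff)
  have nz: "zs \<noteq> []" "u (butlast zs) (last zs) \<noteq> \<zero>\<^bsub>k\<^esub>" if "bar_htpy i u zs \<noteq> \<zero>\<^bsub>B\<^esub>" for zs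
    using that z by (auto simp: bar_htpy_def)
  show "bar_htpy i u zs = \<zero>\<^bsub>B\<^esub>" if "zs \<notin> bar_gens (Suc i)" for zs
  proof (rule ccontr)
    assume "bar_htpy i u zs \<noteq> \<zero>\<^bsub>B\<^esub>"
    note n = nz[OF this]
    have "butlast zs \<in> bar_gens i"
    proof (rule ccontr)
      assume "butlast zs \<notin> bar_gens i"
      then have "u (butlast zs) = \<zero>\<^bsub>B\<^esub>" by (rule fin_supp_outside[OF u])
      then show False using n(2) by simp
    qed
    moreover have "last zs \<in> carrier \<Gamma>"
      using n(2) fin_supp_outside[OF us] by blast
    ultimately have "butlast zs @ [last zs] \<in> bar_gens (Suc i)"
      by (simp add: bar_gens_def)
    then show False using that n(1) by simp
  qed
  \<comment> \<open>The support consists of lists \<open>s @ [g]\<close> with \<open>s\<close> in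
    the support of \<open>u\<close> and \<open>g\<close> in that of \<open>u s\<close>.\<close>
  let ?F = "(\<lambda>(s, g). s @ [g]) ` (SIGMA s : {s. u s \<noteq> \<zero>\<^bsub>B\<^esub>}. {g. u s g \<noteq> \<zero>\<^bsub>k\<^esub>})"
  show "finite ?F"
    using fin_supp_finite[OF u] fin_supp_finite[OF us] by (intro finite_imageI finite_SigmaI) auto
  show "{zs. bar_htpy i u zs \<noteq> \<zero>\<^bsub>B\<^esub>} \<subseteq> ?F"
  proof
    fix zs assume "zs \<in> {zs. bar_htpy i u zs \<noteq> \<zero>\<^bsub>B\<^esub>}"
    then have n: "zs \<noteq> []" "u (butlast zs) (last zs) \<noteq> \<zero>\<^bsub>k\<^esub>" using nz by auto
    then have "u (butlast zs) \<noteq> \<zero>\<^bsub>B\<^esub>" by auto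
    then show "zs \<in> ?F"
      using n by (intro image_eqI[of _ _ "(butlast zs, last zs)"]) auto
  qed
qed

lemma bar_htpy_zero: "bar_htpy i (\<lambda>_. \<zero>\<^bsub>B\<^esub>) = (\<lambda>_. \<zero>\<^bsub>B\<^esub>)"
  by (simp add: bar_htpy_def single_def fun_eq_iff)

lemma bar_htpy_add:
  assumes u: "u \<in> fin_supp B X" and w: "w \<in> fin_supp B X"
  shows "bar_htpy i (\<lambda>s. u s \<oplus>\<^bsub>B\<^esub> w s) = (\<lambda>zs. bar_htpy i u zs \<oplus>\<^bsub>B\<^esub> bar_htpy i w zs)"
proof -
  have "u s g \<in> carrier k" "w s g \<in> carrier k" for s g
    using B.A.fin_supp_closed[OF u, of s] B.A.fin_supp_closed[OF w, of s]
    by (simp_all add: k.fin_supp_closed)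
  then show ?thesis by (simp add: bar_htpy_def single_def fun_eq_iff k.r_distr)
qed

lemma bar_htpy_finsum:
  assumes "finite J" "\<And>j. j \<in> J \<Longrightarrow> f j \<in> fin_supp B X"
  shows "bar_htpy i (\<lambda>t. \<Oplus>\<^bsub>B\<^esub>j\<in>J. f j t) = (\<lambda>t. \<Oplus>\<^bsub>B\<^esub>j\<in>J. bar_htpy i (f j) t)"
  using assms
proof (induction J rule: finite_induct)
  case empty
  show ?case using bar_htpy_zero by simp
next
  case (insert j J)
  have c: "f l t \<in> carrier B" if "l \<in> insert j J" for l t
    by (rule B.A.fin_supp_closed[OF insert.prems[OF that]])
  have hc: "bar_htpy i (f l) t \<in> carrier B" if "l \<in> insert j J" for l t
    using c[OF that, of "butlast t"] by (simp add: bar_htpy_def k.fin_supp_closed)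
  have "(\<lambda>t. \<Oplus>\<^bsub>B\<^esub>l\<in>insert j J. f l t) = (\<lambda>t. f j t \<oplus>\<^bsub>B\<^esub> (\<Oplus>\<^bsub>B\<^esub>l\<in>J. f l t))"
    by (intro ext B.A.finsum_insert) (use insert.hyps c in auto)
  moreover have "(\<Oplus>\<^bsub>B\<^esub>l\<in>insert j J. bar_htpy i (f l) t) =
      bar_htpy i (f j) t \<oplus>\<^bsub>B\<^esub> (\<Oplus>\<^bsub>B\<^esub>l\<in>J. bar_htpy i (f l) t)" for t
    by (intro B.A.finsum_insert) (use insert.hyps hc in auto)
  moreover have "(\<lambda>t. \<Oplus>\<^bsub>B\<^esub>l\<in>J. f l t) \<in> fin_supp B X"
    using insert by (intro B.A.fin_supp_finsum) auto
  ultimately show ?case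
    using insert bar_htpy_add[of "f j" X "\<lambda>t. \<Oplus>\<^bsub>B\<^esub>l\<in>J. f l t" i] by simp
qed

text \<open>The contraction moves the monoid element \<open>g\<close> from the coefficient into the
  list, as its last letter; this is why it is not linear over \<open>B\<close>.\<close>

lemma bar_htpy_mono:
  assumes c: "c \<in> carrier k"
  shows "bar_htpy i (single B xs (single k g c)) =
    single B (xs @ [g]) (single k \<one>\<^bsub>\<Gamma>\<^esub> (sg (Suc i) \<otimes>\<^bsub>k\<^esub> c))"
proof (intro ext)
  fix zs h
  have "zs = xs @ [g] \<longleftrightarrow> zs \<noteq> [] \<and> butlast zs = xs \<and> last zs = g"
    by (cases zs rule: rev_cases) auto
  then show "bar_htpy i (single B xs (single k g c)) zs h =
    single B (xs @ [g]) (single k \<one>\<^bsub>\<Gamma>\<^esub> (sg (Suc i) \<otimes>\<^bsub>k\<^esub> c)) zs h"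
    using c by (auto simp: bar_htpy_def single_def)
qed

text \<open>A face followed by appending the new coefficient is a face of the longer list. For the
  last face, the letter acting on the coefficient becomes the letter merged with \<open>g\<close>.
  This matches the terms that cancel in \<open>contraction_Suc_mono\<close>.\<close>

lemma bar_face_act:
  assumes xs: "xs \<in> bar_gens (Suc m)" and j: "j \<le> Suc m" and g: "g \<in> carrier \<Gamma>"
  shows "bar_face \<Gamma> j xs @ [bar_act m j xs \<otimes>\<^bsub>\<Gamma>\<^esub> g] = bar_face \<Gamma> j (xs @ [g])"
proof (cases "j = Suc m")
  case True
  have "length xs = j" "xs \<noteq> []" using xs True by (auto simp: bar_gens_def)
  then show ?thesis
    using True bar_face_append_last[of xs \<Gamma> g] bar_face_length[of xs \<Gamma>] by (simp add: bar_act_def)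
next
  case False
  then have "j < length xs" using xs j by (simp add: bar_gens_def)
  then show ?thesis using False g by (simp add: bar_act_def bar_face_append)
qed

text \<open>The last face undoes the contraction and returns the given monomial, its sign cancelling
  the one in \<open>bar_htpy\<close>. It is split off because the remaining faces have to cancel
  against the other half of the homotopy identity.\<close>

lemma bar_mat_htpy_mono:
  assumes xs: "xs \<in> bar_gens i" and g: "g \<in> carrier \<Gamma>" and c: "c \<in> carrier k"
  shows "lin B (bar_mat i) (bar_htpy i (single B xs (single k g c))) = (\<lambda>t.
    (\<Oplus>\<^bsub>B\<^esub>j\<in>{..i}. single B (bar_face \<Gamma> j (xs @ [g]))
      (single k \<one>\<^bsub>\<Gamma>\<^esub> (sg j \<otimes>\<^bsub>k\<^esub> (sg (Suc i) \<otimes>\<^bsub>k\<^esub> c))) t) \<oplus>\<^bsub>B\<^esub> single B xs (single k g c) t)"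
proof
  fix t
  let ?ys = "xs @ [g]" and ?c = "sg (Suc i) \<otimes>\<^bsub>k\<^esub> c"
  have ys: "?ys \<in> bar_gens (Suc i)" using xs g by (simp add: bar_gens_def)
  have c': "?c \<in> carrier k" using c by simp
  let ?s = "\<lambda>j. single B (bar_face \<Gamma> j ?ys)
    (single k (bar_act i j ?ys \<otimes>\<^bsub>\<Gamma>\<^esub> \<one>\<^bsub>\<Gamma>\<^esub>) (sg j \<otimes>\<^bsub>k\<^esub> ?c)) t"
  have sc: "?s j \<in> carrier B" if "j \<le> Suc i" for j
    by (rule face_closed(2)[OF ys that H.m_closed[OF bar_act_closed[OF ys] H.one_closed]
      k.m_closed[OF sg_closed c']])
  have "lin B (bar_mat i) (bar_htpy i (single B xs (single k g c))) t = (\<Oplus>\<^bsub>B\<^esub>j\<in>{..Suc i}. ?s j)"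
    unfolding bar_htpy_mono[OF c] bar_mat_mono[OF ys H.one_closed c'] ..
  also have "\<dots> = ?s (Suc i) \<oplus>\<^bsub>B\<^esub> (\<Oplus>\<^bsub>B\<^esub>j\<in>{..i}. ?s j)"
    by (rule B.A.finsum_Suc) (rule funcsetI, rule sc, simp)
  also have "(\<Oplus>\<^bsub>B\<^esub>j\<in>{..i}. ?s j) = (\<Oplus>\<^bsub>B\<^esub>j\<in>{..i}. single B (bar_face \<Gamma> j ?ys)
      (single k \<one>\<^bsub>\<Gamma>\<^esub> (sg j \<otimes>\<^bsub>k\<^esub> ?c)) t)"
  proof (rule B.A.add.finprod_cong'[OF refl, symmetric])
    show "?s \<in> {..i} \<rightarrow> carrier B" by (rule funcsetI, rule sc) simp
    show "single B (bar_face \<Gamma> j ?ys) (single k \<one>\<^bsub>\<Gamma>\<^esub> (sg j \<otimes>\<^bsub>k\<^esub> ?c)) t = ?s j" if "j \<in> {..i}" for j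
      using that by (simp add: bar_act_def)
  qed
  also have "?s (Suc i) = single B xs (single k g c) t"
  proof -
    have "length ?ys = Suc i" using xs by (simp add: bar_gens_def)
    then have f: "bar_face \<Gamma> (Suc i) ?ys = xs"
      unfolding bar_face_def by (simp only: nat.simps if_False if_True butlast_snoc simp_thms)
    have a: "bar_act i (Suc i) ?ys \<otimes>\<^bsub>\<Gamma>\<^esub> \<one>\<^bsub>\<Gamma>\<^esub> = g"
      unfolding bar_act_def by (simp only: if_True last_snoc H.r_one[OF g] simp_thms)
    have s: "sg (Suc i) \<otimes>\<^bsub>k\<^esub> ?c = c"
      by (simp only: k.m_assoc[OF sg_closed sg_closed c, symmetric] sg_sg k.l_one[OF c])
    show ?thesis unfolding f a s ..
  qed
  also have "single B xs (single k g c) t \<oplus>\<^bsub>B\<^esub>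
      (\<Oplus>\<^bsub>B\<^esub>j\<in>{..i}. single B (bar_face \<Gamma> j ?ys) (single k \<one>\<^bsub>\<Gamma>\<^esub> (sg j \<otimes>\<^bsub>k\<^esub> ?c)) t) =
    (\<Oplus>\<^bsub>B\<^esub>j\<in>{..i}. single B (bar_face \<Gamma> j ?ys) (single k \<one>\<^bsub>\<Gamma>\<^esub> (sg j \<otimes>\<^bsub>k\<^esub> ?c)) t)
      \<oplus>\<^bsub>B\<^esub> single B xs (single k g c) t"
  proof (rule B.A.a_comm)
    show "single B xs (single k g c) t \<in> carrier B" by (rule B.A.fin_supp_closed[OF mono_closed[OF xs g c]])
    show "(\<Oplus>\<^bsub>B\<^esub>j\<in>{..i}. single B (bar_face \<Gamma> j ?ys) (single k \<one>\<^bsub>\<Gamma>\<^esub> (sg j \<otimes>\<^bsub>k\<^esub> ?c)) t) \<in> carrier B"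
    proof (rule B.A.finsum_closed, rule funcsetI)
      fix j assume "j \<in> {..i}"
      then have "j \<le> Suc i" by simp
      then show "single B (bar_face \<Gamma> j ?ys) (single k \<one>\<^bsub>\<Gamma>\<^esub> (sg j \<otimes>\<^bsub>k\<^esub> ?c)) t \<in> carrier B"
        by (rule face_closed(2)[OF ys _ H.one_closed k.m_closed[OF sg_closed c']])
    qed
  qed
  finally show "lin B (bar_mat i) (bar_htpy i (single B xs (single k g c))) t =
    (\<Oplus>\<^bsub>B\<^esub>j\<in>{..i}. single B (bar_face \<Gamma> j ?ys) (single k \<one>\<^bsub>\<Gamma>\<^esub> (sg j \<otimes>\<^bsub>k\<^esub> ?c)) t)
      \<oplus>\<^bsub>B\<^esub> single B xs (single k g c) t" .
qed

lemma contraction_Suc_mono: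
  assumes xs: "xs \<in> bar_gens (Suc m)" and g: "g \<in> carrier \<Gamma>" and c: "c \<in> carrier k"
  defines "y \<equiv> single B xs (single k g c)"
  shows "(\<lambda>t. lin B (bar_mat (Suc m)) (bar_htpy (Suc m) y) t \<oplus>\<^bsub>B\<^esub>
    bar_htpy m (lin B (bar_mat m) y) t) = y"
proof
  fix t
  let ?ys = "xs @ [g]"
  have ys: "?ys \<in> bar_gens (Suc (Suc m))" using xs g by (simp add: bar_gens_def)
  let ?a = "\<lambda>j. single B (bar_face \<Gamma> j ?ys) (single k \<one>\<^bsub>\<Gamma>\<^esub> (sg j \<otimes>\<^bsub>k\<^esub> (sg (Suc (Suc m)) \<otimes>\<^bsub>k\<^esub> c))) t"
  let ?b = "\<lambda>j. single B (bar_face \<Gamma> j ?ys) (single k \<one>\<^bsub>\<Gamma>\<^esub> (sg (Suc m) \<otimes>\<^bsub>k\<^esub> (sg j \<otimes>\<^bsub>k\<^esub> c))) t"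
  let ?f = "\<lambda>j. single B (bar_face \<Gamma> j xs) (single k (bar_act m j xs \<otimes>\<^bsub>\<Gamma>\<^esub> g) (sg j \<otimes>\<^bsub>k\<^esub> c))"
  have t: "single B (bar_face \<Gamma> j xs) (single k (bar_act m j xs \<otimes>\<^bsub>\<Gamma>\<^esub> g) (sg j \<otimes>\<^bsub>k\<^esub> c))
      \<in> fin_supp B (bar_gens m)" if "j \<in> {..Suc m}" for j
    using that by (intro face_closed(1)[OF xs] H.m_closed bar_act_closed[OF xs] g k.m_closed sg_closed c) simp
  have ac: "?a j \<in> carrier B" if "j \<in> {..Suc m}" for j
    using that by (intro face_closed(2)[OF ys] H.one_closed k.m_closed sg_closed c) simp
  have bc: "?b j \<in> carrier B" if "j \<in> {..Suc m}" for j
    using that by (intro face_closed(2)[OF ys] H.one_closed k.m_closed sg_closed c) simp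
  have "bar_htpy m (lin B (bar_mat m) y) t = (\<Oplus>\<^bsub>B\<^esub>j\<in>{..Suc m}. bar_htpy m
      (single B (bar_face \<Gamma> j xs) (single k (bar_act m j xs \<otimes>\<^bsub>\<Gamma>\<^esub> g) (sg j \<otimes>\<^bsub>k\<^esub> c))) t)"
    unfolding y_def bar_mat_mono[OF xs g c]
    by (rule fun_cong[OF bar_htpy_finsum[where f = ?f, OF finite_atMost t]])
  also have "\<dots> = (\<Oplus>\<^bsub>B\<^esub>j\<in>{..Suc m}. ?b j)"
  proof (rule B.A.add.finprod_cong'[OF refl])
    show "?b \<in> {..Suc m} \<rightarrow> carrier B" using bc by (rule funcsetI)
    fix j assume "j \<in> {..Suc m}"
    then have "bar_face \<Gamma> j xs @ [bar_act m j xs \<otimes>\<^bsub>\<Gamma>\<^esub> g] = bar_face \<Gamma> j ?ys"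
      by (intro bar_face_act[OF xs _ g]) simp
    then show "bar_htpy m (single B (bar_face \<Gamma> j xs)
        (single k (bar_act m j xs \<otimes>\<^bsub>\<Gamma>\<^esub> g) (sg j \<otimes>\<^bsub>k\<^esub> c))) t = ?b j"
      by (simp only: bar_htpy_mono[OF k.m_closed[OF sg_closed c]])
  qed
  finally have 1: "bar_htpy m (lin B (bar_mat m) y) t = (\<Oplus>\<^bsub>B\<^esub>j\<in>{..Suc m}. ?b j)" .
  have 2: "lin B (bar_mat (Suc m)) (bar_htpy (Suc m) y) t = (\<Oplus>\<^bsub>B\<^esub>j\<in>{..Suc m}. ?a j) \<oplus>\<^bsub>B\<^esub> y t"
    unfolding y_def bar_mat_htpy_mono[OF xs g c] ..
  have yc: "y t \<in> carrier B"
    unfolding y_def by (rule B.A.fin_supp_closed[OF mono_closed[OF xs g c]])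
  \<comment> \<open>The contraction enters in two consecutive degrees, so its signs
    \<open>sg (Suc (Suc m))\<close> and \<open>sg (Suc m)\<close> are opposite and the terms cancel
    face by face.\<close>
  have ab: "?a j \<oplus>\<^bsub>B\<^esub> ?b j = \<zero>\<^bsub>B\<^esub>" for j
  proof -
    have "sg j \<otimes>\<^bsub>k\<^esub> (sg (Suc (Suc m)) \<otimes>\<^bsub>k\<^esub> c) = \<ominus>\<^bsub>k\<^esub> (sg (Suc m) \<otimes>\<^bsub>k\<^esub> (sg j \<otimes>\<^bsub>k\<^esub> c))"
      using c by (simp add: sg_Suc[of "Suc m"] k.l_minus k.r_minus k.m_lcomm)
    then show ?thesis using c by (simp add: single_def fun_eq_iff k.l_neg)
  qed
  have s: "(\<Oplus>\<^bsub>B\<^esub>j\<in>{..Suc m}. ?a j) \<in> carrier B" "(\<Oplus>\<^bsub>B\<^esub>j\<in>{..Suc m}. ?b j) \<in> carrier B"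
    by (rule B.A.finsum_closed, rule funcsetI, erule ac, rule B.A.finsum_closed, rule funcsetI, erule bc)
  have "(\<Oplus>\<^bsub>B\<^esub>j\<in>{..Suc m}. ?a j) \<oplus>\<^bsub>B\<^esub> (\<Oplus>\<^bsub>B\<^esub>j\<in>{..Suc m}. ?b j) = (\<Oplus>\<^bsub>B\<^esub>j\<in>{..Suc m}. ?a j \<oplus>\<^bsub>B\<^esub> ?b j)"
    by (rule B.A.finsum_addf[symmetric]; rule funcsetI; erule ac bc)
  also have "\<dots> = \<zero>\<^bsub>B\<^esub>"
    unfolding ab by (rule B.A.finsum_zero)
  finally have z: "(\<Oplus>\<^bsub>B\<^esub>j\<in>{..Suc m}. ?a j) \<oplus>\<^bsub>B\<^esub> (\<Oplus>\<^bsub>B\<^esub>j\<in>{..Suc m}. ?b j) = \<zero>\<^bsub>B\<^esub>" .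
  have "((\<Oplus>\<^bsub>B\<^esub>j\<in>{..Suc m}. ?a j) \<oplus>\<^bsub>B\<^esub> y t) \<oplus>\<^bsub>B\<^esub> (\<Oplus>\<^bsub>B\<^esub>j\<in>{..Suc m}. ?b j) =
    ((\<Oplus>\<^bsub>B\<^esub>j\<in>{..Suc m}. ?a j) \<oplus>\<^bsub>B\<^esub> (\<Oplus>\<^bsub>B\<^esub>j\<in>{..Suc m}. ?b j)) \<oplus>\<^bsub>B\<^esub> y t"
    using s yc by (simp only: B.A.a_assoc B.A.a_comm[of "y t"])
  then show "lin B (bar_mat (Suc m)) (bar_htpy (Suc m) y) t \<oplus>\<^bsub>B\<^esub>
    bar_htpy m (lin B (bar_mat m) y) t = y t"
    unfolding 1 2 z by (simp only: B.A.l_zero[OF yc])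
qed

lemma add_swap:
  assumes "a \<in> carrier B" "b \<in> carrier B" "c \<in> carrier B" "d \<in> carrier B"
  shows "(a \<oplus>\<^bsub>B\<^esub> b) \<oplus>\<^bsub>B\<^esub> (c \<oplus>\<^bsub>B\<^esub> d) = (a \<oplus>\<^bsub>B\<^esub> c) \<oplus>\<^bsub>B\<^esub> (b \<oplus>\<^bsub>B\<^esub> d)"
  using assms by (simp only: B.A.a_assoc B.A.a_lcomm[of b c d] B.A.a_closed)

lemma contraction_Suc:
  assumes u: "u \<in> fin_supp B (bar_gens (Suc m))"
  shows "(\<lambda>t. lin B (bar_mat (Suc m)) (bar_htpy (Suc m) u) t \<oplus>\<^bsub>B\<^esub>
    bar_htpy m (lin B (bar_mat m) u) t) = u"
  using u
proof (induction rule: mono_induct)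
  case zero
  show ?case
    unfolding bar_htpy_zero B.A.lin_zero by (simp only: B.A.l_zero[OF B.A.zero_closed])
next
  case (mono xs g c)
  then show ?case by (rule contraction_Suc_mono)
next
  case (add f g)
  note f = add.hyps(1) and g = add.hyps(2)
  note hf = bar_htpy_closed[OF f] and hg = bar_htpy_closed[OF g]
  note lf = B.A.lin_closed[OF f bar_mat] and lg = B.A.lin_closed[OF g bar_mat]
  show ?case
    unfolding bar_htpy_add[OF f g] B.A.lin_add[OF f g bar_mat] B.A.lin_add[OF hf hg bar_mat]
      bar_htpy_add[OF lf lg]
      add_swap[OF B.A.fin_supp_closed[OF B.A.lin_closed[OF hf bar_mat]]
        B.A.fin_supp_closed[OF B.A.lin_closed[OF hg bar_mat]]
        B.A.fin_supp_closed[OF bar_htpy_closed[OF lf]] B.A.fin_supp_closed[OF bar_htpy_closed[OF lg]]]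
      fun_cong[OF add.IH(1)] fun_cong[OF add.IH(2)] ..
qed

section \<open>Exactness of the bar complex\<close>

abbreviation "bar_aug \<equiv> res_aug k B.total (\<lambda>_. \<one>\<^bsub>k\<^esub>)"

lemma one_mat: "(\<lambda>_. \<one>\<^bsub>k\<^esub>) \<in> X \<rightarrow> carrier k"
  by simp

lemma bar_aug_mono: "g \<in> carrier \<Gamma> \<Longrightarrow> c \<in> carrier k \<Longrightarrow> bar_aug (single B xs (single k g c)) = c"
  using aug.res_aug_single[where a = "\<lambda>_. \<one>\<^bsub>k\<^esub>" and s = xs, OF k.one_closed monomial_closed[of g c]]
  by (simp only: B.total_single k.l_one)

lemma unit_gens: "[] \<in> bar_gens 0"
  by (simp add: bar_gens_def)

text \<open>In degree 0 the lower half of the contraction is the unit map from \<open>k\<close>,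
  which sends a scalar to its multiple of the empty list.\<close>

lemma contraction_0:
  assumes u: "u \<in> fin_supp B (bar_gens 0)"
  shows "(\<lambda>t. lin B (bar_mat 0) (bar_htpy 0 u) t \<oplus>\<^bsub>B\<^esub>
    single B [] (single k \<one>\<^bsub>\<Gamma>\<^esub> (bar_aug u)) t) = u"
  using u
proof (induction rule: mono_induct)
  case zero
  have "single B ([] :: 'h list) (single k \<one>\<^bsub>\<Gamma>\<^esub> \<zero>\<^bsub>k\<^esub>) = (\<lambda>_. \<zero>\<^bsub>B\<^esub>)" by (simp add: single_def fun_eq_iff)
  then show ?case
    unfolding bar_htpy_zero B.A.lin_zero aug.res_aug_zero by (simp only: B.A.l_zero[OF B.A.zero_closed])
next
  case (mono xs g c)
  then have xs: "xs = []" by (simp add: bar_gens_def)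
  show ?case
  proof
    fix t
    let ?y = "single B ([] :: 'h list) (single k g c) t"
    let ?a = "single B ([] :: 'h list) (single k \<one>\<^bsub>\<Gamma>\<^esub> (\<ominus>\<^bsub>k\<^esub> c)) t" and ?b = "single B ([] :: 'h list) (single k \<one>\<^bsub>\<Gamma>\<^esub> c) t"
    have cl: "?a \<in> carrier B" "?b \<in> carrier B" "?y \<in> carrier B"
      using mono(2,3) by (intro B.A.fin_supp_closed[OF mono_closed[OF unit_gens]]; simp)+
    have ab: "?a \<oplus>\<^bsub>B\<^esub> ?b = \<zero>\<^bsub>B\<^esub>" using mono(3) by (simp add: single_def fun_eq_iff k.l_neg)
    have "{..0::nat} = {0}" by auto
    moreover have "bar_face \<Gamma> 0 [g] = []" by (simp add: bar_face_def)
    moreover have "sg 0 \<otimes>\<^bsub>k\<^esub> (sg (Suc 0) \<otimes>\<^bsub>k\<^esub> c) = \<ominus>\<^bsub>k\<^esub> c"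
      using mono(3) by (simp add: sg_0 sg_Suc k.l_minus)
    ultimately have "lin B (bar_mat 0) (bar_htpy 0 (single B [] (single k g c))) t = ?a \<oplus>\<^bsub>B\<^esub> ?y"
      unfolding bar_mat_htpy_mono[OF unit_gens mono(2,3)] using cl(1)
      by (simp only: append_Nil B.A.finsum_insert[OF finite.emptyI] B.A.finsum_empty
        empty_iff Pi_empty UNIV_I B.A.r_zero simp_thms)
    then have "lin B (bar_mat 0) (bar_htpy 0 (single B [] (single k g c))) t \<oplus>\<^bsub>B\<^esub> ?b = ?y"
      using cl ab by (simp only: B.A.a_assoc B.A.a_comm[of ?y ?b] B.A.a_assoc[symmetric] B.A.l_zero)
    then show "lin B (bar_mat 0) (bar_htpy 0 (single B xs (single k g c))) t \<oplus>\<^bsub>B\<^esub>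
        single B [] (single k \<one>\<^bsub>\<Gamma>\<^esub> (bar_aug (single B xs (single k g c)))) t =
      single B xs (single k g c) t"
      unfolding bar_aug_mono[OF mono(2,3)] xs .
  qed
next
  case (add f g)
  note f = add.hyps(1) and g = add.hyps(2)
  note hf = bar_htpy_closed[OF f] and hg = bar_htpy_closed[OF g]
  note cf = aug.res_aug_closed[OF f one_mat] and cg = aug.res_aug_closed[OF g one_mat]
  have s: "single B ([] :: 'h list) (single k \<one>\<^bsub>\<Gamma>\<^esub> (bar_aug f \<oplus>\<^bsub>k\<^esub> bar_aug g)) =
    (\<lambda>t. single B [] (single k \<one>\<^bsub>\<Gamma>\<^esub> (bar_aug f)) t \<oplus>\<^bsub>B\<^esub> single B [] (single k \<one>\<^bsub>\<Gamma>\<^esub> (bar_aug g)) t)"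
    using cf cg by (simp add: single_def fun_eq_iff)
  show ?case
    unfolding bar_htpy_add[OF f g] B.A.lin_add[OF hf hg bar_mat] aug.res_aug_add[OF f g one_mat] s
      add_swap[OF B.A.fin_supp_closed[OF B.A.lin_closed[OF hf bar_mat]]
        B.A.fin_supp_closed[OF B.A.lin_closed[OF hg bar_mat]]
        B.A.fin_supp_closed[OF mono_closed[OF unit_gens H.one_closed cf]]
        B.A.fin_supp_closed[OF mono_closed[OF unit_gens H.one_closed cg]]]
      fun_cong[OF add.IH(1)] fun_cong[OF add.IH(2)] ..
qed

abbreviation "bar_cycles \<equiv> res_cycles B k B.total bar_gens bar_mat (\<lambda>_. \<one>\<^bsub>k\<^esub>)"

lemma bar_cycles_closed: "u \<in> bar_cycles i \<Longrightarrow> u \<in> fin_supp B (bar_gens i)"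
  by (simp add: res_cycles_def)

text \<open>On a cycle, one of the two summands of the contraction identity vanishes.\<close>

lemma bar_exact:
  assumes u: "u \<in> bar_cycles i"
  shows "lin B (bar_mat i) (bar_htpy i u) = u"
proof -
  note u' = bar_cycles_closed[OF u]
  have c: "lin B (bar_mat i) (bar_htpy i u) t \<in> carrier B" for t
    by (rule B.A.fin_supp_closed[OF B.A.lin_closed[OF bar_htpy_closed[OF u'] bar_mat]])
  show ?thesis
  proof (cases i)
    case 0
    have "bar_aug u = \<zero>\<^bsub>k\<^esub>" using u 0 by (simp add: res_cycles_def)
    then have "single B ([] :: 'h list) (single k \<one>\<^bsub>\<Gamma>\<^esub> (bar_aug u)) = (\<lambda>_. \<zero>\<^bsub>B\<^esub>)"
      by (simp add: single_def fun_eq_iff)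
    then show ?thesis
      using contraction_0[OF u'[unfolded 0]] c unfolding 0 by (simp only: B.A.r_zero)
  next
    case (Suc m)
    have "lin B (bar_mat m) u = (\<lambda>_. \<zero>\<^bsub>B\<^esub>)" using u Suc by (simp only: res_cycles_def) simp
    then show ?thesis
      using contraction_Suc[OF u'[unfolded Suc]] c unfolding Suc by (simp only: bar_htpy_zero B.A.r_zero)
  qed
qed

text \<open>Every basis element is a value of the contraction, so the contraction identity gives
  access to its boundary.\<close>

lemma bar_mat_eq_lin:
  assumes s: "s \<in> bar_gens (Suc i)"
  obtains y where "y \<in> fin_supp B (bar_gens i)" "bar_mat i s = lin B (bar_mat i) (bar_htpy i y)"
proof
  define xs g where "xs = butlast s" and "g = last s"
  \<comment> \<open>The coefficient cancels the sign in \<open>bar_htpy\<close>, so that the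
    contraction of \<open>y\<close> is the basis element \<open>s\<close>.\<close>
  define y where "y = single B xs (single k g (sg (Suc i)))"
  have ne: "s \<noteq> []" using s by (auto simp: bar_gens_def)
  have sx: "s = xs @ [g]" using ne by (simp add: xs_def g_def)
  have xs: "xs \<in> bar_gens i" and g: "g \<in> carrier \<Gamma>" using s unfolding sx by (simp_all add: bar_gens_def)
  show "y \<in> fin_supp B (bar_gens i)" unfolding y_def by (rule mono_closed[OF xs g sg_closed])
  have "bar_htpy i y = delta B s"
    unfolding y_def bar_htpy_mono[OF sg_closed] sg_sg sx delta_eq_single B.A_simps(2) ..
  then show "bar_mat i s = lin B (bar_mat i) (bar_htpy i y)"
    using B.A.lin_delta[where v = "bar_mat i" and s = s, OF B.A.mat_closed[OF bar_mat s]] by simp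
qed

text \<open>The simplicial identities are avoided: with \<open>d\<close> the differential and
  \<open>h\<close> the contraction, \<open>d h = 1 - h d\<close> gives
  \<open>d d h = d - d h d\<close>. This is zero because \<open>d h\<close> is the identity on
  cycles and values of the lower \<open>d\<close> are cycles by induction. In degree 0 the
  augmentation replaces the lower differential.\<close>

lemma bar_mat_cycle: "s \<in> bar_gens (Suc i) \<Longrightarrow> bar_mat i s \<in> bar_cycles i"
proof (induction i arbitrary: s)
  case 0
  obtain y where y: "y \<in> fin_supp B (bar_gens 0)" and s: "bar_mat 0 s = lin B (bar_mat 0) (bar_htpy 0 y)"
    using 0 by (rule bar_mat_eq_lin)
  have l: "bar_mat 0 s \<in> fin_supp B (bar_gens 0)" using bar_mat 0 by auto
  note a = aug.res_aug_closed[OF y one_mat]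
  have "bar_aug y = bar_aug (\<lambda>t. bar_mat 0 s t \<oplus>\<^bsub>B\<^esub> single B [] (single k \<one>\<^bsub>\<Gamma>\<^esub> (bar_aug y)) t)"
    unfolding s contraction_0[OF y] ..
  also have "\<dots> = bar_aug (bar_mat 0 s) \<oplus>\<^bsub>k\<^esub> bar_aug y"
    unfolding aug.res_aug_add[OF l mono_closed[OF unit_gens H.one_closed a] one_mat]
      bar_aug_mono[OF H.one_closed a] ..
  finally have "bar_aug (bar_mat 0 s) = \<zero>\<^bsub>k\<^esub>"
    by (rule k.eq_add_imp_zero[OF _ a aug.res_aug_closed[OF l one_mat]])
  then show ?case using l by (simp only: res_cycles_def mem_Collect_eq nat.case simp_thms)
next
  case (Suc i)
  obtain y where y: "y \<in> fin_supp B (bar_gens (Suc i))"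
    and s: "bar_mat (Suc i) s = lin B (bar_mat (Suc i)) (bar_htpy (Suc i) y)"
    using Suc.prems by (rule bar_mat_eq_lin)
  have l: "bar_mat (Suc i) s \<in> fin_supp B (bar_gens (Suc i))" using bar_mat Suc.prems by auto
  define z where "z = lin B (bar_mat i) y"
  have zc: "z \<in> bar_cycles i"
    unfolding z_def by (rule aug.boundary_cycles[OF bar_mat one_mat Suc.IH y])
  note z = bar_cycles_closed[OF zc]
  \<comment> \<open>The differential is applied to the contraction identity of \<open>y\<close>;
    \<open>z\<close> reappears on the right because \<open>d h\<close> fixes it, and cancelling it
    leaves the claim.\<close>
  have "z = lin B (bar_mat i) (\<lambda>t. bar_mat (Suc i) s t \<oplus>\<^bsub>B\<^esub> bar_htpy i z t)"
    unfolding s z_def contraction_Suc[OF y] ..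
  also have "\<dots> = (\<lambda>t. lin B (bar_mat i) (bar_mat (Suc i) s) t \<oplus>\<^bsub>B\<^esub> z t)"
    unfolding B.A.lin_add[OF l bar_htpy_closed[OF z] bar_mat] bar_exact[OF zc] ..
  finally have eq: "z t = lin B (bar_mat i) (bar_mat (Suc i) s) t \<oplus>\<^bsub>B\<^esub> z t" for t
    by (rule fun_cong)
  have "lin B (bar_mat i) (bar_mat (Suc i) s) t = \<zero>\<^bsub>B\<^esub>" for t
    by (rule B.A.eq_add_imp_zero[OF eq B.A.fin_supp_closed[OF z]
      B.A.fin_supp_closed[OF B.A.lin_closed[OF l bar_mat]]])
  then show ?case using l by (simp only: res_cycles_def mem_Collect_eq nat.case simp_thms fun_eq_iff)
qed

lemma bar_resolution: "free_resolution B k B.total bar_gens bar_mat (\<lambda>_. \<one>\<^bsub>k\<^esub>)"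
proof (intro free_resolution.intro free_resolution_axioms.intro)
  show "augmented_ring B k B.total" by (rule aug.augmented_ring_axioms)
  show "bar_mat i \<in> bar_gens (Suc i) \<rightarrow> fin_supp B (bar_gens i)" for i by (rule bar_mat)
  show "(\<lambda>_. \<one>\<^bsub>k\<^esub>) \<in> bar_gens 0 \<rightarrow> carrier k" by (rule one_mat)
  show "bar_mat i s \<in> bar_cycles i" if "s \<in> bar_gens (Suc i)" for s i by (rule bar_mat_cycle[OF that])
  show "\<exists>x\<in>fin_supp B (bar_gens (Suc i)). lin B (bar_mat i) x = u" if "u \<in> bar_cycles i" for u i
    by (rule bexI[where P = "\<lambda>x. lin B (bar_mat i) x = u", OF bar_exact[OF that] bar_htpy_closed[OF bar_cycles_closed[OF that]]])
  show "\<exists>u\<in>fin_supp B (bar_gens 0). bar_aug u = c" if "c \<in> carrier k" for c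
    by (rule bexI[where P = "\<lambda>u. bar_aug u = c", OF bar_aug_mono[OF H.one_closed that] mono_closed[OF unit_gens H.one_closed that]])
qed

text \<open>The augmentation sends every monoid element to one, so the last face loses its action on
  coefficients and the alternating sum of faces remains.\<close>

lemma bar_mat_total:
  assumes xs: "xs \<in> bar_gens (Suc i)"
  shows "B.total (bar_mat i xs t) = (\<Oplus>\<^bsub>k\<^esub>j\<in>{..Suc i}. sg j \<otimes>\<^bsub>k\<^esub> delta k (bar_face \<Gamma> j xs) t)"
proof -
  have "B.total (\<Oplus>\<^bsub>B\<^esub>j\<in>J. single B (bar_face \<Gamma> j xs) (single k (bar_act i j xs) (sg j)) t) =
      (\<Oplus>\<^bsub>k\<^esub>j\<in>J. sg j \<otimes>\<^bsub>k\<^esub> delta k (bar_face \<Gamma> j xs) t)" if "finite J" "J \<subseteq> {..Suc i}" for J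
    using that
  proof (induction J rule: finite_induct)
    case empty
    show ?case by (simp only: B.A.finsum_empty k.finsum_empty aug.\<eta>.hom_zero)
  next
    case (insert j J)
    have c: "single B (bar_face \<Gamma> l xs) (single k (bar_act i l xs) (sg l)) t \<in> carrier B" if "l \<in> insert j J" for l
    proof -
      have "l \<le> Suc i" using that insert.prems by blast
      then show ?thesis by (rule face_closed(2)[OF xs _ bar_act_closed[OF xs] sg_closed])
    qed
    have t: "B.total (single B (bar_face \<Gamma> j xs) (single k (bar_act i j xs) (sg j)) t) =
        sg j \<otimes>\<^bsub>k\<^esub> delta k (bar_face \<Gamma> j xs) t"
    proof (cases "t = bar_face \<Gamma> j xs")
      case True
      then show ?thesis
        using B.total_single[OF bar_act_closed[OF xs] sg_closed, of j j]
        by (simp add: single_def[of B] delta_def)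
    next
      case False
      have "B.total \<zero>\<^bsub>B\<^esub> = \<zero>\<^bsub>k\<^esub>" by (rule aug.\<eta>.hom_zero)
      then show ?thesis using False by (simp add: single_def[of B] delta_def)
    qed
    have s: "(\<Oplus>\<^bsub>B\<^esub>l\<in>J. single B (bar_face \<Gamma> l xs) (single k (bar_act i l xs) (sg l)) t) \<in> carrier B"
      using c by (intro B.A.finsum_closed funcsetI) blast
    have e: "(\<Oplus>\<^bsub>B\<^esub>l\<in>insert j J. single B (bar_face \<Gamma> l xs) (single k (bar_act i l xs) (sg l)) t) =
      single B (bar_face \<Gamma> j xs) (single k (bar_act i j xs) (sg j)) t \<oplus>\<^bsub>B\<^esub>
      (\<Oplus>\<^bsub>B\<^esub>l\<in>J. single B (bar_face \<Gamma> l xs) (single k (bar_act i l xs) (sg l)) t)"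
      using insert.hyps c by (intro B.A.finsum_insert funcsetI) blast+
    have "(\<Oplus>\<^bsub>k\<^esub>l\<in>insert j J. sg l \<otimes>\<^bsub>k\<^esub> delta k (bar_face \<Gamma> l xs) t) =
      sg j \<otimes>\<^bsub>k\<^esub> delta k (bar_face \<Gamma> j xs) t \<oplus>\<^bsub>k\<^esub> (\<Oplus>\<^bsub>k\<^esub>l\<in>J. sg l \<otimes>\<^bsub>k\<^esub> delta k (bar_face \<Gamma> l xs) t)"
      using insert.hyps by (intro k.finsum_insert funcsetI) (auto simp: delta_def)
    moreover have "J \<subseteq> {..Suc i}" using insert.prems by blast
    ultimately show ?case
      unfolding e aug.\<eta>.hom_add[OF c[OF insertI1] s] t insert.IH[OF \<open>J \<subseteq> {..Suc i}\<close>] by simp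
  qed
  then show ?thesis unfolding bar_mat_def by simp
qed

lemma bar_diff_eq:
  assumes u: "u \<in> fin_supp k (bar_gens (Suc i))"
  shows "bar_diff k \<Gamma> i u = lin k (\<lambda>s t. B.total (bar_mat i s t)) u"
proof -
  let ?m = "\<lambda>j xs. delta k (bar_face \<Gamma> j xs)"
  have m: "?m j \<in> bar_gens (Suc i) \<rightarrow> fin_supp k (bar_gens i)" if "j \<in> {..Suc i}" for j
    using that bar_face_gens[of _ i j] by (intro funcsetI k.fin_supp_delta) simp
  have M: "(\<lambda>s t. B.total (bar_mat i s t)) \<in> bar_gens (Suc i) \<rightarrow> fin_supp k (bar_gens i)"
    by (rule aug.push_mat[OF bar_mat])
  \<comment> \<open>\<open>bar_diff\<close> as a signed sum of matrices, additive in
    \<open>u\<close>; \<open>lin_ext_eq\<close> then compares it with the reduced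
    \<open>bar_mat\<close> on chains with one entry.\<close>
  define h where "h u = (\<lambda>t. \<Oplus>\<^bsub>k\<^esub>j\<in>{..Suc i}. sg j \<otimes>\<^bsub>k\<^esub> lin k (?m j) u t)" for u
  have lc: "lin k (?m j) f t \<in> carrier k" if "f \<in> fin_supp k (bar_gens (Suc i))" "j \<in> {..Suc i}" for f j t
    by (rule k.fin_supp_closed[OF k.lin_closed[OF that(1) m[OF that(2)]]])
  have "bar_diff k \<Gamma> i u = h u"
  proof
    fix t
    show "bar_diff k \<Gamma> i u t = h u t"
      unfolding bar_diff_def h_def sg_def[symmetric]
    proof (rule k.add.finprod_cong'[OF refl])
      show "(\<lambda>j. sg j \<otimes>\<^bsub>k\<^esub> lin k (?m j) u t) \<in> {..Suc i} \<rightarrow> carrier k"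
        using lc[OF u] by (intro funcsetI k.m_closed sg_closed)
      fix j assume "j \<in> {..Suc i}"
      then have "bar_face \<Gamma> j \<in> bar_gens (Suc i) \<rightarrow> bar_gens i" using bar_face_gens by (intro funcsetI) simp
      then show "sg j \<otimes>\<^bsub>k\<^esub> free_map k (bar_face \<Gamma> j) u t = sg j \<otimes>\<^bsub>k\<^esub> lin k (?m j) u t"
        by (simp only: k.free_map_eq_lin[OF u])
    qed
  qed
  also have "h u = lin k (\<lambda>s t. B.total (bar_mat i s t)) u"
  proof (rule k.lin_ext_eq[OF u _ _ _ M])
    show "h (\<lambda>_. \<zero>\<^bsub>k\<^esub>) = (\<lambda>_. \<zero>\<^bsub>k\<^esub>)"
      unfolding h_def k.lin_zero by (simp only: k.r_null[OF sg_closed] k.finsum_zero)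
  next
    fix f g assume f: "f \<in> fin_supp k (bar_gens (Suc i))" and g: "g \<in> fin_supp k (bar_gens (Suc i))"
    show "h (\<lambda>s. f s \<oplus>\<^bsub>k\<^esub> g s) = (\<lambda>t. h f t \<oplus>\<^bsub>k\<^esub> h g t)"
    proof
      fix t
      have "h (\<lambda>s. f s \<oplus>\<^bsub>k\<^esub> g s) t =
        (\<Oplus>\<^bsub>k\<^esub>j\<in>{..Suc i}. sg j \<otimes>\<^bsub>k\<^esub> lin k (?m j) f t \<oplus>\<^bsub>k\<^esub> sg j \<otimes>\<^bsub>k\<^esub> lin k (?m j) g t)"
        unfolding h_def
      proof (rule k.add.finprod_cong'[OF refl])
        fix j assume j: "j \<in> {..Suc i}"
        show "sg j \<otimes>\<^bsub>k\<^esub> lin k (?m j) (\<lambda>s. f s \<oplus>\<^bsub>k\<^esub> g s) t =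
          sg j \<otimes>\<^bsub>k\<^esub> lin k (?m j) f t \<oplus>\<^bsub>k\<^esub> sg j \<otimes>\<^bsub>k\<^esub> lin k (?m j) g t"
          unfolding k.lin_add[OF f g m[OF j]] by (rule k.r_distr[OF lc[OF f j] lc[OF g j] sg_closed])
      qed (intro funcsetI k.a_closed k.m_closed sg_closed lc f g)
      also have "\<dots> = h f t \<oplus>\<^bsub>k\<^esub> h g t"
        unfolding h_def by (rule k.finsum_addf; intro funcsetI k.m_closed sg_closed lc f g)
      finally show "h (\<lambda>s. f s \<oplus>\<^bsub>k\<^esub> g s) t = h f t \<oplus>\<^bsub>k\<^esub> h g t" .
    qed
  next
    fix s a assume s: "s \<in> bar_gens (Suc i)" and a: "a \<in> carrier k"
    show "h (single k s a) = (\<lambda>t. B.total (bar_mat i s t) \<otimes>\<^bsub>k\<^esub> a)"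
    proof
      fix t :: "'h list"
      have d: "delta k x t \<in> carrier k" for x by (simp add: delta_def)
      have "h (single k s a) t = (\<Oplus>\<^bsub>k\<^esub>j\<in>{..Suc i}. (sg j \<otimes>\<^bsub>k\<^esub> delta k (bar_face \<Gamma> j s) t) \<otimes>\<^bsub>k\<^esub> a)"
        unfolding h_def
        by (rule k.add.finprod_cong'[OF refl]) (simp_all add: k.lin_single d a k.m_assoc)
      also have "\<dots> = B.total (bar_mat i s t) \<otimes>\<^bsub>k\<^esub> a"
        unfolding bar_mat_total[OF s] by (rule k.finsum_ldistr[symmetric]) (simp_all add: d a)
      finally show "h (single k s a) t = B.total (bar_mat i s t) \<otimes>\<^bsub>k\<^esub> a" .
    qed
  qed
  finally show ?thesis .
qed

lemma group_homology_eq: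
  "group_homology k \<Gamma> = homology (\<lambda>i. free_module k (bar_gens i)) (\<lambda>i. lin k (\<lambda>s t. B.total (bar_mat i s t)))"
proof -
  have "bar_chains k \<Gamma> = (\<lambda>i. free_module k (bar_gens i))"
    by (simp add: fun_eq_iff bar_chains_def bar_gens_def)
  then show ?thesis
    unfolding group_homology_def by (simp only:) (rule homology_cong, simp add: bar_diff_eq)
qed

end

theorem (in split_algebra) Tor_group_homology:
  "graded_isomorphic k (Tor k A M M) (group_homology k \<Gamma>)"
  unfolding group_homology_eq
  by (rule graded_isomorphic_trans[OF Tor_iso(1) resolution_comparison[OF resolution bar_resolution]])

section \<open>Partial braids\<close>

text \<open>One continuous map for two purposes: with \<open>\<sigma> = id\<close> it forgets
  strands, and with \<open>\<sigma> = right_node b\<close> it renames the strands of a second factor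
  by the left nodes of the first.\<close>

definition relabel :: "nat set \<Rightarrow> (nat \<Rightarrow> nat) \<Rightarrow> (nat \<Rightarrow> complex) \<Rightarrow> nat \<Rightarrow> complex" where
  "relabel K \<sigma> z = (\<lambda>i. if i \<in> K then z (\<sigma> i) else 0)"

lemma continuous_relabel: "continuous_on S (relabel K \<sigma>)"
proof (rule continuous_on_coordinatewise_then_product)
  fix i
  show "continuous_on S (\<lambda>z. relabel K \<sigma> z i)"
    by (cases "i \<in> K")
      (simp_all add: relabel_def continuous_on_subset[OF continuous_on_product_coordinates])
qed

text \<open>Injectivity of \<open>\<sigma>\<close> keeps the strands disjoint: different new names
  then belong to different old strands.\<close>

lemma relabel_in_configs:
  assumes "\<sigma> ` K \<subseteq> I" "inj_on \<sigma> K" "z \<in> strand_configs I"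
  shows "relabel K \<sigma> z \<in> strand_configs K"
proof -
  have "inj_on z (\<sigma> ` K)" using assms by (auto simp: strand_configs_def intro: inj_on_subset)
  then have "inj_on (z \<circ> \<sigma>) K" using assms(2) by (rule comp_inj_on[rotated])
  then have "inj_on (relabel K \<sigma> z) K" by (auto simp: relabel_def inj_on_def)
  then show ?thesis by (auto simp: strand_configs_def relabel_def)
qed

lemma relabel_relabel: "\<tau> ` L \<subseteq> K \<Longrightarrow> relabel L \<tau> \<circ> (relabel K \<sigma> \<circ> p) = relabel L (\<sigma> \<circ> \<tau>) \<circ> p"
  by (auto simp: relabel_def fun_eq_iff)

lemma relabel_cong: "(\<And>i. i \<in> K \<Longrightarrow> \<sigma> i = \<tau> i) \<Longrightarrow> relabel K \<sigma> \<circ> p = relabel K \<tau> \<circ> p"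
  by (auto simp: relabel_def fun_eq_iff)

lemma relabel_self: "z \<in> strand_configs I \<Longrightarrow> relabel I id z = z"
  by (auto simp: relabel_def strand_configs_def fun_eq_iff)

lemma relabel_path:
  assumes "path p" "path_image p \<subseteq> strand_configs I" "\<sigma> ` K \<subseteq> I" "inj_on \<sigma> K"
  shows "path (relabel K \<sigma> \<circ> p)" "path_image (relabel K \<sigma> \<circ> p) \<subseteq> strand_configs K"
proof -
  show "path (relabel K \<sigma> \<circ> p)"
    by (rule path_continuous_image[OF assms(1) continuous_relabel])
  show "path_image (relabel K \<sigma> \<circ> p) \<subseteq> strand_configs K"
    unfolding path_image_compose using assms(2) relabel_in_configs[OF assms(3,4)] by blast
qed

lemma homotopic_relabel:
  assumes "homotopic_paths (strand_configs I) p q" "\<sigma> ` K \<subseteq> I" "inj_on \<sigma> K"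
  shows "homotopic_paths (strand_configs K) (relabel K \<sigma> \<circ> p) (relabel K \<sigma> \<circ> q)"
  by (rule homotopic_paths_continuous_image[OF assms(1) continuous_relabel])
    (use relabel_in_configs[OF assms(2,3)] in blast)

section \<open>Isotopy classes and their representatives\<close>

lemma isotopy_class_eq:
  assumes "homotopic_paths (strand_configs I) p q"
  shows "isotopy_class I p = isotopy_class I q"
proof -
  have "homotopic_paths (strand_configs I) p r \<longleftrightarrow> homotopic_paths (strand_configs I) q r" for r
    using assms homotopic_paths_sym homotopic_paths_trans by metis
  then show ?thesis by (simp add: isotopy_class_def)
qed

text \<open>Partial braids are classes; all computations with them are done on a chosen
  path.\<close>

definition represents :: "nat \<Rightarrow> pbraid \<Rightarrow> (real \<Rightarrow> nat \<Rightarrow> complex) \<Rightarrow> bool" where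
  "represents n b p \<longleftrightarrow> geometric_braid n (strands b) p \<and> snd b = isotopy_class (strands b) p"

lemma represents_exists:
  assumes "b \<in> partial_braids n"
  obtains p where "represents n b p"
  using assms by (auto simp: partial_braids_def represents_def)

lemma represents_partial_braid: "represents n b p \<Longrightarrow> b \<in> partial_braids n"
  by (cases b) (auto simp: partial_braids_def represents_def)

lemma representsD:
  assumes "represents n b p"
  shows "strands b \<subseteq> {..<n}" "path p" "path_image p \<subseteq> strand_configs (strands b)"
    "\<And>i. i \<in> strands b \<Longrightarrow> pathstart p i = of_nat i"
  using assms by (auto simp: represents_def geometric_braid_def)

lemma represents_in_class: "represents n b p \<Longrightarrow> p \<in> snd b"
  by (auto simp: represents_def isotopy_class_def geometric_braid_def)

lemma represents_homotopic:
  "represents n b p \<Longrightarrow> q \<in> snd b \<longleftrightarrow> homotopic_paths (strand_configs (strands b)) p q"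
  by (auto simp: represents_def isotopy_class_def)

text \<open>Isotopies fix endpoints, so all paths of the class end at the same configuration and the
  description in \<open>right_node\<close> has a unique solution.\<close>

lemma right_node_eq:
  assumes p: "represents n b p" and i: "i \<in> strands b" and j: "pathfinish p i = of_nat j"
  shows "right_node b i = j"
  unfolding right_node_def
proof (rule the_equality)
  show "\<forall>p\<in>snd b. pathfinish p i = of_nat j"
    using represents_homotopic[OF p] homotopic_paths_imp_pathfinish j by metis
  show "j' = j" if "\<forall>p\<in>snd b. pathfinish p i = of_nat j'" for j'
    using that represents_in_class[OF p] j by force
qed

lemma represents_finish:
  assumes p: "represents n b p" and i: "i \<in> strands b"
  shows "pathfinish p i = of_nat (right_node b i)" "right_node b i < n"
proof -
  obtain j where j: "j < n" "pathfinish p i = of_nat j"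
    using p i by (auto simp: represents_def geometric_braid_def)
  then have "right_node b i = j" by (intro right_node_eq[OF p i])
  then show "pathfinish p i = of_nat (right_node b i)" "right_node b i < n" using j by auto
qed

lemma strands_subset: "b \<in> partial_braids n \<Longrightarrow> strands b \<subseteq> {..<n}"
  using representsD(1) represents_exists by metis

lemma finite_strands: "b \<in> partial_braids n \<Longrightarrow> finite (strands b)"
  using strands_subset finite_subset by blast

lemma right_node_less: "b \<in> partial_braids n \<Longrightarrow> i \<in> strands b \<Longrightarrow> right_node b i < n"
  using represents_finish(2) represents_exists by metis

text \<open>The end of a path in the configuration space is itself a configuration of distinct
  points.\<close>

lemma right_node_inj:
  assumes "b \<in> partial_braids n"
  shows "inj_on (right_node b) (strands b)"
proof -
  obtain p where p: "represents n b p" using assms by (rule represents_exists)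
  have "pathfinish p \<in> strand_configs (strands b)"
    using representsD(3)[OF p] pathfinish_in_path_image by blast
  then have "inj_on (pathfinish p) (strands b)" by (simp add: strand_configs_def)
  then show ?thesis
    using represents_finish(1)[OF p] by (auto simp: inj_on_def)
qed

lemma representsI:
  assumes "K \<subseteq> {..<n}" "path p" "path_image p \<subseteq> strand_configs K"
    "\<And>i. i \<in> K \<Longrightarrow> pathstart p i = of_nat i"
    "\<And>i. i \<in> K \<Longrightarrow> pathfinish p i = of_nat (f i) \<and> f i < n"
  shows "represents n (K, isotopy_class K p) p" "\<And>i. i \<in> K \<Longrightarrow> right_node (K, isotopy_class K p) i = f i"
proof -
  show *: "represents n (K, isotopy_class K p) p"
    using assms by (auto simp: represents_def geometric_braid_def)
  show "right_node (K, isotopy_class K p) i = f i" if "i \<in> K" for i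
    by (rule right_node_eq[OF *]) (use that assms in auto)
qed

section \<open>Products of partial braids\<close>

definition common_strands :: "pbraid \<Rightarrow> pbraid \<Rightarrow> nat set" where
  "common_strands b c = {i \<in> strands b. right_node b i \<in> strands c}"

definition concat_path ::
    "pbraid \<Rightarrow> pbraid \<Rightarrow> (real \<Rightarrow> nat \<Rightarrow> complex) \<Rightarrow> (real \<Rightarrow> nat \<Rightarrow> complex) \<Rightarrow> real \<Rightarrow> nat \<Rightarrow> complex" where
  "concat_path b c p q =
    (relabel (common_strands b c) id \<circ> p) +++ (relabel (common_strands b c) (right_node b) \<circ> q)"

lemma pbraid_mult:
  assumes p: "represents n b p" and q: "represents n c q"
  shows "pbraid_mult b c = (common_strands b c, isotopy_class (common_strands b c) (concat_path b c p q))"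
    and "represents n (pbraid_mult b c) (concat_path b c p q)"
    and "strands (pbraid_mult b c) = common_strands b c"
    and "\<And>i. i \<in> common_strands b c \<Longrightarrow> right_node (pbraid_mult b c) i = right_node c (right_node b i)"
proof -
  let ?K = "common_strands b c" and ?\<sigma> = "right_node b"
  have K: "id ` ?K \<subseteq> strands b" "?\<sigma> ` ?K \<subseteq> strands c" "?K \<subseteq> {..<n}"
    using representsD(1)[OF p] by (auto simp: common_strands_def)
  have inj: "inj_on id ?K" "inj_on ?\<sigma> ?K"
    using right_node_inj[OF represents_partial_braid[OF p]]
    by (auto simp: common_strands_def inj_on_def)
  note rp = relabel_path[OF representsD(2,3)[OF p] K(1) inj(1)]
  note rq = relabel_path[OF representsD(2,3)[OF q] K(2) inj(2)]
  \<comment> \<open>Strand \<open>i\<close> of the first factor ends where the strand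
    \<open>right_node b i\<close> of the second begins, so the renaming makes the two paths
    composable.\<close>
  have meet: "pathfinish (relabel ?K id \<circ> p) = pathstart (relabel ?K ?\<sigma> \<circ> q)"
    using represents_finish(1)[OF p] representsD(4)[OF q]
    by (auto simp: pathfinish_compose pathstart_compose relabel_def common_strands_def fun_eq_iff)
  \<comment> \<open>Homotopies of the factors can be relabelled and joined, so the double union in
    \<open>pbraid_mult\<close> is a union of copies of a single class.\<close>
  have cls: "isotopy_class ?K (concat_path b c p' q') = isotopy_class ?K (concat_path b c p q)"
    if "p' \<in> snd b" "q' \<in> snd c" for p' q'
  proof -
    have "homotopic_paths (strand_configs ?K) (concat_path b c p q) (concat_path b c p' q')"
      unfolding concat_path_def
      using that by (intro homotopic_paths_join homotopic_relabel[OF _ K(1) inj(1)]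
        homotopic_relabel[OF _ K(2) inj(2)] meet) (simp_all add: represents_homotopic[OF p] represents_homotopic[OF q])
    then show ?thesis by (rule isotopy_class_eq[symmetric])
  qed
  have "pbraid_mult b c = (?K, \<Union>p\<in>snd b. \<Union>q\<in>snd c. isotopy_class ?K (concat_path b c p q))"
    by (simp add: pbraid_mult_def Let_def common_strands_def concat_path_def relabel_def comp_def id_def)
  also have "(\<Union>p\<in>snd b. \<Union>q\<in>snd c. isotopy_class ?K (concat_path b c p q)) =
      isotopy_class ?K (concat_path b c p q)"
    using cls represents_in_class[OF p] represents_in_class[OF q] by blast
  finally show eq: "pbraid_mult b c = (?K, isotopy_class ?K (concat_path b c p q))" .
  then show "strands (pbraid_mult b c) = ?K" by simp
  have fin: "pathfinish (concat_path b c p q) i = of_nat (right_node c (right_node b i)) \<and>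
      right_node c (right_node b i) < n" if "i \<in> ?K" for i
    using that represents_finish[OF q, of "right_node b i"]
    by (auto simp: concat_path_def pathfinish_compose relabel_def common_strands_def)
  have st: "pathstart (concat_path b c p q) i = of_nat i" if "i \<in> ?K" for i
    using that representsD(4)[OF p, of i]
    by (auto simp: concat_path_def pathstart_compose relabel_def common_strands_def)
  have "path (concat_path b c p q)" "path_image (concat_path b c p q) \<subseteq> strand_configs ?K"
    unfolding concat_path_def using rp rq meet by (simp_all add: path_image_join)
  note R = representsI[OF K(3) this st fin]
  show "represents n (pbraid_mult b c) (concat_path b c p q)" unfolding eq by (rule R(1))
  show "\<And>i. i \<in> ?K \<Longrightarrow> right_node (pbraid_mult b c) i = right_node c (right_node b i)"
    unfolding eq by (rule R(2))
qed

lemma pbraid_mult_closed: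
  "b \<in> partial_braids n \<Longrightarrow> c \<in> partial_braids n \<Longrightarrow> pbraid_mult b c \<in> partial_braids n"
  using pbraid_mult(2) represents_exists represents_partial_braid by metis

lemma strands_mult:
  assumes "b \<in> partial_braids n" "c \<in> partial_braids n"
  shows "strands (pbraid_mult b c) = {i \<in> strands b. right_node b i \<in> strands c}"
proof -
  obtain p q where "represents n b p" "represents n c q" using assms represents_exists by metis
  from pbraid_mult(3)[OF this] show ?thesis by (simp add: common_strands_def)
qed

lemma right_node_mult:
  assumes "b \<in> partial_braids n" "c \<in> partial_braids n" "i \<in> strands b" "right_node b i \<in> strands c"
  shows "right_node (pbraid_mult b c) i = right_node c (right_node b i)"
proof -
  obtain p q where "represents n b p" "represents n c q" using assms represents_exists by metis
  from pbraid_mult(4)[OF this] show ?thesis using assms by (simp add: common_strands_def)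
qed

text \<open>Both products become joins of the same three relabelled paths with different bracketing,
  and joining is associative up to homotopy.\<close>

lemma pbraid_mult_assoc:
  assumes "a \<in> partial_braids n" "b \<in> partial_braids n" "c \<in> partial_braids n"
  shows "pbraid_mult (pbraid_mult a b) c = pbraid_mult a (pbraid_mult b c)"
proof -
  obtain p where p: "represents n a p" using assms(1) by (rule represents_exists)
  obtain q where q: "represents n b q" using assms(2) by (rule represents_exists)
  obtain r where r: "represents n c r" using assms(3) by (rule represents_exists)
  note ab = pbraid_mult[OF p q] and bc = pbraid_mult[OF q r]
  note abc = pbraid_mult(1)[OF ab(2) r] and abc' = pbraid_mult(1)[OF p bc(2)]
  \<comment> \<open>The strands that survive both gluings, named by their left nodes in
    \<open>a\<close>; this is the strand set of either product.\<close>
  define L where "L = common_strands (pbraid_mult a b) c"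
  let ?\<sigma> = "right_node a" and ?\<tau> = "right_node b"
  have L: "L = {i \<in> strands a. ?\<sigma> i \<in> strands b \<and> ?\<tau> (?\<sigma> i) \<in> strands c}"
    using ab(4) by (auto simp: L_def common_strands_def ab(3))
  have L': "common_strands a (pbraid_mult b c) = L"
    by (auto simp: L common_strands_def bc(3))
  have s\<sigma>: "?\<sigma> ` L \<subseteq> strands b" "(?\<tau> \<circ> ?\<sigma>) ` L \<subseteq> strands c" "id ` L \<subseteq> strands a"
    "id ` L \<subseteq> common_strands a b" "?\<sigma> ` L \<subseteq> common_strands b c"
    by (auto simp: L common_strands_def)
  have i\<sigma>: "inj_on ?\<sigma> L"
    using right_node_inj[OF assms(1)] by (auto simp: L inj_on_def)
  have i\<tau>: "inj_on (?\<tau> \<circ> ?\<sigma>) L"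
    using i\<sigma> right_node_inj[OF assms(2)] s\<sigma>(1) by (intro comp_inj_on) (auto intro: inj_on_subset)
  let ?P = "relabel L id \<circ> p" and ?Q = "relabel L ?\<sigma> \<circ> q" and ?R = "relabel L (?\<tau> \<circ> ?\<sigma>) \<circ> r"
  have "relabel L id \<circ> concat_path a b p q = ?P +++ ?Q"
    unfolding concat_path_def path_compose_join relabel_relabel[OF s\<sigma>(4)] by simp
  moreover have "relabel L (right_node (pbraid_mult a b)) \<circ> r = ?R"
    by (rule relabel_cong) (use ab(4) in \<open>auto simp: L common_strands_def\<close>)
  ultimately have 1: "concat_path (pbraid_mult a b) c (concat_path a b p q) r = (?P +++ ?Q) +++ ?R"
    unfolding concat_path_def[of "pbraid_mult a b"] L_def[symmetric] by simp
  have 2: "concat_path a (pbraid_mult b c) p (concat_path b c q r) = ?P +++ (?Q +++ ?R)"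
    unfolding concat_path_def[of a "pbraid_mult b c"] L' unfolding concat_path_def path_compose_join
      relabel_relabel[OF s\<sigma>(5)] by simp
  note P = relabel_path[OF representsD(2,3)[OF p] s\<sigma>(3) inj_on_id]
  note Q = relabel_path[OF representsD(2,3)[OF q] s\<sigma>(1) i\<sigma>]
  note R = relabel_path[OF representsD(2,3)[OF r] s\<sigma>(2) i\<tau>]
  have m1: "pathfinish ?P = pathstart ?Q"
    using represents_finish(1)[OF p] representsD(4)[OF q]
    by (auto simp: pathfinish_compose pathstart_compose relabel_def L fun_eq_iff)
  have m2: "pathfinish ?Q = pathstart ?R"
    using represents_finish(1)[OF q] representsD(4)[OF r]
    by (auto simp: pathfinish_compose pathstart_compose relabel_def L fun_eq_iff)
  have "isotopy_class L (?P +++ (?Q +++ ?R)) = isotopy_class L ((?P +++ ?Q) +++ ?R)"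
    by (rule isotopy_class_eq[OF homotopic_paths_assoc[OF P Q R m1 m2]])
  then show ?thesis unfolding abc abc' L' L_def[symmetric] 1 2 by simp
qed

text \<open>The library joins with constant paths only in the form of \<open>linepath\<close>, hence only in real normed
  vector spaces, and \<open>nat \<Rightarrow> complex\<close> is none.\<close>

lemma homotopic_join_const_right:
  assumes "path p" "path_image p \<subseteq> S"
  shows "homotopic_paths S p (p +++ (\<lambda>_. pathfinish p))"
proof (rule homotopic_paths_reparametrize[OF assms])
  \<comment> \<open>The reparametrization runs through the path at double speed and then rests at
    its end.\<close>
  show "continuous_on {0..1} (\<lambda>t::real. if t \<le> 1/2 then 2 * t else 1)"
    by (rule continuous_on_cases_1) (auto intro!: continuous_intros)
qed (auto simp: joinpaths_def pathfinish_def)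

lemma homotopic_join_const_left:
  assumes "path p" "path_image p \<subseteq> S"
  shows "homotopic_paths S p ((\<lambda>_. pathstart p) +++ p)"
proof (rule homotopic_paths_reparametrize[OF assms])
  show "continuous_on {0..1} (\<lambda>t::real. if t \<le> 1/2 then 0 else 2 * t - 1)"
    by (rule continuous_on_cases_1) (auto intro!: continuous_intros)
qed (auto simp: joinpaths_def pathstart_def)

text \<open>The identity braid and the braids underlying \<open>omit\<close> are both of this form,
  so unit laws and absorption come from the same lemmas.\<close>

definition partial_identity :: "nat set \<Rightarrow> pbraid" where
  "partial_identity J = (J, isotopy_class J (\<lambda>t i. if i \<in> J then of_nat i else 0))"

lemma pbraid_one_eq: "pbraid_one n = partial_identity {..<n}"
  by (simp add: pbraid_one_def partial_identity_def)

lemma partial_identity: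
  assumes "J \<subseteq> {..<n}"
  shows "represents n (partial_identity J) (\<lambda>t i. if i \<in> J then of_nat i else 0)"
    and "\<And>i. i \<in> J \<Longrightarrow> right_node (partial_identity J) i = i"
proof -
  have *: "path (\<lambda>t i. if i \<in> J then of_nat i else (0::complex))"
    by (simp add: path_def)
  have **: "path_image (\<lambda>t i. if i \<in> J then of_nat i else (0::complex)) \<subseteq> strand_configs J"
    by (auto simp: path_image_def strand_configs_def inj_on_def)
  have 1: "pathstart (\<lambda>t i. if i \<in> J then of_nat i else (0::complex)) i = of_nat i" if "i \<in> J" for i
    using that by (simp add: pathstart_def)
  have 2: "pathfinish (\<lambda>t i. if i \<in> J then of_nat i else (0::complex)) i = of_nat i \<and> i < n"
    if "i \<in> J" for i
    using that assms by (auto simp: pathfinish_def)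
  note R = representsI[OF assms * ** 1 2]
  show "represents n (partial_identity J) (\<lambda>t i. if i \<in> J then of_nat i else 0)"
    unfolding partial_identity_def by (rule R(1))
  show "\<And>i. i \<in> J \<Longrightarrow> right_node (partial_identity J) i = i"
    unfolding partial_identity_def by (rule R(2))
qed

lemma strands_partial_identity [simp]: "strands (partial_identity J) = J"
  by (simp add: partial_identity_def)

lemma partial_identity_closed: "J \<subseteq> {..<n} \<Longrightarrow> partial_identity J \<in> partial_braids n"
  using partial_identity(1) represents_partial_braid by blast

text \<open>A path is arbitrary outside the unit interval, so it may differ from its relabelling as
  a function; inside the interval they agree.\<close>

lemma homotopic_relabel_self:
  assumes "path p" "path_image p \<subseteq> strand_configs I"
  shows "homotopic_paths (strand_configs I) p (relabel I id \<circ> p)"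
proof (rule homotopic_paths_eq[OF assms])
  fix t :: real assume "t \<in> {0..1}"
  then have "p t \<in> strand_configs I" using assms(2) by (auto simp: path_image_def)
  then show "p t = (relabel I id \<circ> p) t" by (simp add: relabel_self)
qed

text \<open>A partial identity containing all right ends of \<open>b\<close> only appends a pause.
  With \<open>J\<close> all nodes this is the right unit law, with one node removed it is absorption
  by \<open>omit\<close>.\<close>

lemma mult_partial_identity:
  assumes b: "b \<in> partial_braids n" and J: "J \<subseteq> {..<n}" and sub: "right_node b ` strands b \<subseteq> J"
  shows "pbraid_mult b (partial_identity J) = b"
proof -
  obtain p where p: "represents n b p" using b by (rule represents_exists)
  let ?I = "strands b"
  have K: "common_strands b (partial_identity J) = ?I"
    using sub by (auto simp: common_strands_def)
  have end_cfg: "pathfinish p \<in> strand_configs ?I"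
    using representsD(3)[OF p] pathfinish_in_path_image by blast
  \<comment> \<open>Renamed by \<open>right_node b\<close>, the constant path rests at the end point
    of \<open>p\<close>.\<close>
  have const: "relabel ?I (right_node b) \<circ> (\<lambda>t i. if i \<in> J then of_nat i else 0) = (\<lambda>_. pathfinish p)"
    using sub represents_finish(1)[OF p] end_cfg
    by (auto simp: relabel_def fun_eq_iff strand_configs_def image_subset_iff)
  have c: "concat_path b (partial_identity J) p (\<lambda>t i. if i \<in> J then of_nat i else 0) =
      (relabel ?I id \<circ> p) +++ (\<lambda>_. pathfinish p)"
    unfolding concat_path_def K const ..
  have "homotopic_paths (strand_configs ?I) (\<lambda>_::real. pathfinish p) (\<lambda>_. pathfinish p)"
    using end_cfg by (auto simp: path_def path_image_def)
  then have "homotopic_paths (strand_configs ?I) (p +++ (\<lambda>_. pathfinish p))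
      ((relabel ?I id \<circ> p) +++ (\<lambda>_. pathfinish p))"
    by (intro homotopic_paths_join homotopic_relabel_self[OF representsD(2,3)[OF p]])
      (simp_all add: pathstart_def)
  then have "homotopic_paths (strand_configs ?I) p ((relabel ?I id \<circ> p) +++ (\<lambda>_. pathfinish p))"
    by (rule homotopic_paths_trans[OF homotopic_join_const_right[OF representsD(2,3)[OF p]]])
  then have "isotopy_class ?I p = isotopy_class ?I ((relabel ?I id \<circ> p) +++ (\<lambda>_. pathfinish p))"
    by (rule isotopy_class_eq)
  then have "pbraid_mult b (partial_identity J) = (?I, isotopy_class ?I p)"
    unfolding pbraid_mult(1)[OF p partial_identity(1)[OF J]] K c by simp
  then show ?thesis using p by (cases b) (simp add: represents_def)
qed

lemma partial_identity_mult:
  assumes b: "b \<in> partial_braids n" and J: "J \<subseteq> {..<n}" and sub: "strands b \<subseteq> J"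
  shows "pbraid_mult (partial_identity J) b = b"
proof -
  obtain p where p: "represents n b p" using b by (rule represents_exists)
  let ?I = "strands b" and ?c = "\<lambda>(t::real) i. if i \<in> J then of_nat i else (0::complex)"
  have K: "common_strands (partial_identity J) b = ?I"
    using sub partial_identity(2)[OF J] by (auto simp: common_strands_def)
  have start_cfg: "pathstart p \<in> strand_configs ?I"
    using representsD(3)[OF p] pathstart_in_path_image by blast
  have const: "relabel ?I id \<circ> ?c = (\<lambda>_. pathstart p)"
    using sub representsD(4)[OF p] start_cfg
    by (auto simp: relabel_def fun_eq_iff strand_configs_def)
  have "relabel ?I (right_node (partial_identity J)) \<circ> p = relabel ?I id \<circ> p"
    by (rule relabel_cong) (use sub partial_identity(2)[OF J] in auto)
  then have c: "concat_path (partial_identity J) b ?c p = (\<lambda>_. pathstart p) +++ (relabel ?I id \<circ> p)"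
    unfolding concat_path_def K const by simp
  have "homotopic_paths (strand_configs ?I) (\<lambda>_::real. pathstart p) (\<lambda>_. pathstart p)"
    using start_cfg by (auto simp: path_def path_image_def)
  then have "homotopic_paths (strand_configs ?I) ((\<lambda>_. pathstart p) +++ p)
      ((\<lambda>_. pathstart p) +++ (relabel ?I id \<circ> p))"
    by (intro homotopic_paths_join homotopic_relabel_self[OF representsD(2,3)[OF p]])
      (simp_all add: pathfinish_def)
  then have "homotopic_paths (strand_configs ?I) p ((\<lambda>_. pathstart p) +++ (relabel ?I id \<circ> p))"
    by (rule homotopic_paths_trans[OF homotopic_join_const_left[OF representsD(2,3)[OF p]]])
  then have "isotopy_class ?I p = isotopy_class ?I ((\<lambda>_. pathstart p) +++ (relabel ?I id \<circ> p))"
    by (rule isotopy_class_eq)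
  then have "pbraid_mult (partial_identity J) b = (?I, isotopy_class ?I p)"
    unfolding pbraid_mult(1)[OF partial_identity(1)[OF J] p] K c by simp
  then show ?thesis using p by (cases b) (simp add: represents_def)
qed

section \<open>The braided rook algebra\<close>

context twisted_monoid
begin

lemma single_smult: "a \<in> carrier k \<Longrightarrow> single k x a = (\<lambda>d. a \<otimes>\<^bsub>k\<^esub> single k x \<one>\<^bsub>k\<^esub> d)"
  by (auto simp: single_def)

text \<open>Products starting with an element outside \<open>U\<close> stay outside
  \<open>U\<close>. So the correction terms in \<open>annihilator\<close> do not disturb the
  coefficients on \<open>U\<close>.\<close>

lemma single_mult_vanishes:
  assumes U: "\<And>x y. x \<in> D \<Longrightarrow> y \<in> D \<Longrightarrow> mul x y \<in> U \<Longrightarrow> x \<in> U"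
    and y: "y \<in> D" "y \<notin> U" "a \<in> carrier k" and f: "f \<in> fin_supp k D" and d: "d \<in> U"
  shows "(single k y a \<otimes>\<^bsub>A\<^esub> f) d = \<zero>\<^bsub>k\<^esub>"
  using f
proof (induction rule: k.fin_supp_induct)
  case zero
  show ?case unfolding mult_zero(2)[OF k.fin_supp_single[OF y(1,3)]] ..
next
  case (single x b)
  have "mul y x \<notin> U" using U[OF y(1) single(1)] y(2) by blast
  then have "d \<noteq> mul y x" using d by blast
  then show ?case unfolding mult_single[OF y(1) single(1) y(3) single(2)] by (simp add: single_def)
next
  case (add f g)
  then show ?case
    unfolding mult_add_right[OF k.fin_supp_single[OF y(1,3)] add.hyps] by simp
qed

text \<open>The witness is the product of the factors \<open>1 - \<delta> \<cdot> E m\<close>. Multiplied from the right, such a factor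
  kills the basis elements \<open>x\<close> with \<open>m \<notin> R x\<close>, and it never enlarges \<open>R x\<close> for the others.\<close>

lemma annihilator:
  fixes n :: nat and R :: "'d \<Rightarrow> nat set"
  assumes U: "U \<subseteq> D" and mul_U: "\<And>x y. x \<in> D \<Longrightarrow> y \<in> D \<Longrightarrow> mul x y \<in> U \<longleftrightarrow> x \<in> U \<and> y \<in> U"
    and E: "\<And>m. m < n \<Longrightarrow> E m \<in> D" "\<And>m. m < n \<Longrightarrow> E m \<notin> U"
    and \<delta>: "\<delta> \<in> carrier k"
    and absorb: "\<And>m x. m < n \<Longrightarrow> x \<in> D \<Longrightarrow> m \<notin> R x \<Longrightarrow> mul x (E m) = x \<and> w x (E m) \<otimes>\<^bsub>k\<^esub> \<delta> = \<one>\<^bsub>k\<^esub>"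
    and mono: "\<And>m x. m < n \<Longrightarrow> x \<in> D \<Longrightarrow> R (mul x (E m)) \<subseteq> R x"
    and outside: "\<And>x. x \<in> D \<Longrightarrow> x \<notin> U \<Longrightarrow> \<exists>j<n. j \<notin> R x"
  shows "\<exists>f\<in>fin_supp k D. (\<forall>x\<in>U. f x = (if x = e then \<one>\<^bsub>k\<^esub> else \<zero>\<^bsub>k\<^esub>)) \<and>
    (\<forall>a\<in>fin_supp k D. (\<forall>u\<in>U. a u = \<zero>\<^bsub>k\<^esub>) \<longrightarrow> a \<otimes>\<^bsub>A\<^esub> f = (\<lambda>_. \<zero>\<^bsub>k\<^esub>))"
proof -
  have "\<exists>f\<in>fin_supp k D. (\<forall>x\<in>U. f x = (if x = e then \<one>\<^bsub>k\<^esub> else \<zero>\<^bsub>k\<^esub>)) \<and>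
    (\<forall>x\<in>D. (\<exists>j<m. j \<notin> R x) \<longrightarrow> single k x \<one>\<^bsub>k\<^esub> \<otimes>\<^bsub>A\<^esub> f = (\<lambda>_. \<zero>\<^bsub>k\<^esub>))" if "m \<le> n" for m
    using that
  proof (induction m)
    case 0
    show ?case
      by (rule bexI[of _ "single k e \<one>\<^bsub>k\<^esub>"]) (simp_all add: single_def[abs_def] k.fin_supp_single[unfolded single_def])
  next
    case (Suc m)
    then have m: "m < n" by simp
    obtain f where f: "f \<in> fin_supp k D" and fU: "\<And>x. x \<in> U \<Longrightarrow> f x = (if x = e then \<one>\<^bsub>k\<^esub> else \<zero>\<^bsub>k\<^esub>)"
      and kill: "\<And>x j. x \<in> D \<Longrightarrow> j < m \<Longrightarrow> j \<notin> R x \<Longrightarrow> single k x \<one>\<^bsub>k\<^esub> \<otimes>\<^bsub>A\<^esub> f = (\<lambda>_. \<zero>\<^bsub>k\<^esub>)"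
      using Suc by (auto simp: Bex_def)
    have s1: "single k x \<one>\<^bsub>k\<^esub> \<in> fin_supp k D" if "x \<in> D" for x
      by (rule k.fin_supp_single[OF that k.one_closed])
    note Es = k.fin_supp_single[OF E(1)[OF m] \<delta>]
    \<comment> \<open>The new factor is placed on the left,
      \<open>f' = (1 - \<delta> E m) f\<close>, so that it meets \<open>x\<close> before the factors
      already treated.\<close>
    define g where "g = single k (E m) \<delta> \<otimes>\<^bsub>A\<^esub> f"
    have g: "g \<in> fin_supp k D" unfolding g_def by (rule mult_closed[OF Es f])
    have gneg: "(\<lambda>d. \<ominus>\<^bsub>k\<^esub> g d) \<in> fin_supp k D" by (rule k.fin_supp_neg[OF g])
    define f' where "f' = (\<lambda>d. f d \<oplus>\<^bsub>k\<^esub> \<ominus>\<^bsub>k\<^esub> g d)"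
    have f': "f' \<in> fin_supp k D" unfolding f'_def by (rule k.fin_supp_add[OF f gneg])
    have gU: "g x = \<zero>\<^bsub>k\<^esub>" if "x \<in> U" for x
      unfolding g_def
      by (rule single_mult_vanishes[OF _ E(1)[OF m] E(2)[OF m] \<delta> f that]) (use mul_U in blast)
    have f'U: "f' x = (if x = e then \<one>\<^bsub>k\<^esub> else \<zero>\<^bsub>k\<^esub>)" if "x \<in> U" for x
      using gU[OF that] fU[OF that] by (simp add: f'_def)
    have f'kill: "single k x \<one>\<^bsub>k\<^esub> \<otimes>\<^bsub>A\<^esub> f' = (\<lambda>_. \<zero>\<^bsub>k\<^esub>)" if x: "x \<in> D" and j: "j < Suc m" "j \<notin> R x" for x j
    proof -
      let ?X = "single k x \<one>\<^bsub>k\<^esub>"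
      note X = s1[OF x]
      have xE: "mul x (E m) \<in> D" by (rule mul_closed[OF x E(1)[OF m]])
      have wc: "w x (E m) \<otimes>\<^bsub>k\<^esub> \<delta> \<in> carrier k" by (rule k.m_closed[OF w_closed[OF x E(1)[OF m]] \<delta>])
      have "?X \<otimes>\<^bsub>A\<^esub> g = (?X \<otimes>\<^bsub>A\<^esub> single k (E m) \<delta>) \<otimes>\<^bsub>A\<^esub> f"
        unfolding g_def by (rule mult_assoc[OF X Es f, symmetric])
      also have "?X \<otimes>\<^bsub>A\<^esub> single k (E m) \<delta> = single k (mul x (E m)) (w x (E m) \<otimes>\<^bsub>k\<^esub> \<delta>)"
        unfolding mult_single[OF x E(1)[OF m] k.one_closed \<delta>] k.l_one[OF \<delta>] ..
      finally have Xg: "?X \<otimes>\<^bsub>A\<^esub> g = single k (mul x (E m)) (w x (E m) \<otimes>\<^bsub>k\<^esub> \<delta>) \<otimes>\<^bsub>A\<^esub> f" .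
      \<comment> \<open>Either \<open>E m\<close> absorbs \<open>x\<close>, or a node
        \<open>j < m\<close> is missed by \<open>x\<close> and by \<open>mul x (E m)\<close> alike
        and \<open>f\<close> kills both.\<close>
      have eq: "?X \<otimes>\<^bsub>A\<^esub> f = ?X \<otimes>\<^bsub>A\<^esub> g"
      proof (cases "m \<in> R x")
        case False
        show ?thesis unfolding Xg using absorb[OF m x False] by simp
      next
        case True
        then have j': "j < m" using j less_Suc_eq by auto
        have "j \<notin> R (mul x (E m))" using mono[OF m x] j(2) by blast
        then have z: "single k (mul x (E m)) \<one>\<^bsub>k\<^esub> \<otimes>\<^bsub>A\<^esub> f = (\<lambda>_. \<zero>\<^bsub>k\<^esub>)" by (rule kill[OF xE j'])
        have "?X \<otimes>\<^bsub>A\<^esub> g = (\<lambda>_. \<zero>\<^bsub>k\<^esub>)"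
          unfolding Xg single_smult[OF wc] mult_smult(1)[OF wc s1[OF xE] f] z k.r_null[OF wc] ..
        then show ?thesis using kill[OF x j' j(2)] by simp
      qed
      have c: "(?X \<otimes>\<^bsub>A\<^esub> g) d \<in> carrier k" for d by (rule k.fin_supp_closed[OF mult_closed[OF X g]])
      have neg: "?X \<otimes>\<^bsub>A\<^esub> (\<lambda>d. \<ominus>\<^bsub>k\<^esub> g d) = (\<lambda>d. \<ominus>\<^bsub>k\<^esub> (?X \<otimes>\<^bsub>A\<^esub> g) d)"
      proof -
        have "(\<lambda>d. \<ominus>\<^bsub>k\<^esub> g d) = (\<lambda>d. (\<ominus>\<^bsub>k\<^esub> \<one>\<^bsub>k\<^esub>) \<otimes>\<^bsub>k\<^esub> g d)"
          by (simp add: k.l_minus k.fin_supp_closed[OF g])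
        then show ?thesis
          using mult_smult(2)[OF _ X g, of "\<ominus>\<^bsub>k\<^esub> \<one>\<^bsub>k\<^esub>"] c by (simp add: k.l_minus)
      qed
      show ?thesis
        unfolding f'_def mult_add_right[OF X f gneg] neg eq by (simp only: k.r_neg[OF c])
    qed
    show ?case by (rule bexI[OF _ f']) (use f'U f'kill in blast)
  qed
  from this[OF order_refl] obtain f where f: "f \<in> fin_supp k D"
    and fU: "\<And>x. x \<in> U \<Longrightarrow> f x = (if x = e then \<one>\<^bsub>k\<^esub> else \<zero>\<^bsub>k\<^esub>)"
    and kill: "\<And>x. x \<in> D \<Longrightarrow> \<exists>j<n. j \<notin> R x \<Longrightarrow> single k x \<one>\<^bsub>k\<^esub> \<otimes>\<^bsub>A\<^esub> f = (\<lambda>_. \<zero>\<^bsub>k\<^esub>)"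
    by blast
  have "a \<otimes>\<^bsub>A\<^esub> f = (\<lambda>_. \<zero>\<^bsub>k\<^esub>)" if a: "a \<in> fin_supp k D" "\<forall>u\<in>U. a u = \<zero>\<^bsub>k\<^esub>" for a
  proof -
    have sub: "b \<in> fin_supp k D" if "b \<in> fin_supp k (D - U)" for b
      using that by (auto simp: fin_supp_def)
    \<comment> \<open>Regarding \<open>a\<close> as supported on \<open>D - U\<close>, the induction
      meets only basis elements that \<open>f\<close> kills.\<close>
    have "a \<in> fin_supp k (D - U)" using a by (auto simp: fin_supp_def)
    then show ?thesis
    proof (induction rule: k.fin_supp_induct)
      case zero
      show ?case by (rule mult_zero(1)[OF f])
    next
      case (single x c)
      then have x: "x \<in> D" "x \<notin> U" by auto
      show ?case
        unfolding single_smult[OF single(2)] mult_smult(1)[OF single(2) k.fin_supp_single[OF x(1) k.one_closed] f]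
          kill[OF x(1) outside[OF x]] k.r_null[OF single(2)] ..
    next
      case (add b c)
      show ?case unfolding mult_add_left[OF sub[OF add.hyps(1)] sub[OF add.hyps(2)] f] add.IH
        by (simp only: k.l_zero[OF k.zero_closed])
    qed
  qed
  then show ?thesis using f fU by blast
qed

end

section \<open>Rook diagrams as a twisted monoid\<close>

locale rook_setup = G: group G + k: cring k
  for G :: "('g, 'y) monoid_scheme" and k :: "('k, 'z) ring_scheme" +
  fixes n :: nat and \<epsilon> :: 'k
  assumes \<epsilon>: "\<epsilon> \<in> Units k"
begin

abbreviation "D \<equiv> rook_diagrams G n"
abbreviation "U \<equiv> full_diagrams G n"
abbreviation "w \<equiv> \<lambda>d d'. \<epsilon> [^]\<^bsub>k\<^esub> card (isolated_middle_nodes n d d')"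
abbreviation "\<Gamma> \<equiv> wreath_braid_group G n"

lemma \<epsilon>_closed [simp]: "\<epsilon> \<in> carrier k"
  using \<epsilon> by (rule k.Units_closed)

lemma rook_diagramE:
  assumes "d \<in> D"
  obtains b x where "d = (b, x)" "b \<in> partial_braids n" "x \<in> strands b \<rightarrow>\<^sub>E carrier G"
  using assms by (auto simp: rook_diagrams_def)

lemma mult_diagrams:
  "rook_mult G (b, x) (c, y) =
    (pbraid_mult b c, \<lambda>i\<in>strands (pbraid_mult b c). x i \<otimes>\<^bsub>G\<^esub> y (right_node b i))"
  by (simp add: rook_mult_def)

lemma rook_mult_closed: "d \<in> D \<Longrightarrow> d' \<in> D \<Longrightarrow> rook_mult G d d' \<in> D"
proof -
  assume "d \<in> D" "d' \<in> D"
  then obtain b x c y where b: "d = (b, x)" "b \<in> partial_braids n" "x \<in> strands b \<rightarrow>\<^sub>E carrier G"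
    and c: "d' = (c, y)" "c \<in> partial_braids n" "y \<in> strands c \<rightarrow>\<^sub>E carrier G"
    by (elim rook_diagramE)
  have "x i \<otimes>\<^bsub>G\<^esub> y (right_node b i) \<in> carrier G" if "i \<in> strands (pbraid_mult b c)" for i
    using that PiE_mem[OF b(3)] PiE_mem[OF c(3)] by (simp add: strands_mult[OF b(2) c(2)])
  then show ?thesis
    by (simp add: b(1) c(1) mult_diagrams rook_diagrams_def pbraid_mult_closed[OF b(2) c(2)])
qed

lemma rook_mult_assoc:
  assumes "d1 \<in> D" "d2 \<in> D" "d3 \<in> D"
  shows "rook_mult G (rook_mult G d1 d2) d3 = rook_mult G d1 (rook_mult G d2 d3)"
proof -
  obtain a x where a: "d1 = (a, x)" "a \<in> partial_braids n" "x \<in> strands a \<rightarrow>\<^sub>E carrier G"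
    using assms(1) by (rule rook_diagramE)
  obtain b y where b: "d2 = (b, y)" "b \<in> partial_braids n" "y \<in> strands b \<rightarrow>\<^sub>E carrier G"
    using assms(2) by (rule rook_diagramE)
  obtain c z where c: "d3 = (c, z)" "c \<in> partial_braids n" "z \<in> strands c \<rightarrow>\<^sub>E carrier G"
    using assms(3) by (rule rook_diagramE)
  note ab = pbraid_mult_closed[OF a(2) b(2)] and bc = pbraid_mult_closed[OF b(2) c(2)]
  have "(x i \<otimes>\<^bsub>G\<^esub> y (right_node a i)) \<otimes>\<^bsub>G\<^esub> z (right_node b (right_node a i)) =
    x i \<otimes>\<^bsub>G\<^esub> (y (right_node a i) \<otimes>\<^bsub>G\<^esub> z (right_node b (right_node a i)))"
    if "i \<in> strands a" "right_node a i \<in> strands b" "right_node b (right_node a i) \<in> strands c" for i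
    using that a(3) b(3) c(3) by (intro G.m_assoc) auto
  then show ?thesis
    unfolding a(1) b(1) c(1) mult_diagrams pbraid_mult_assoc[OF a(2) b(2) c(2)]
    by (auto simp: fun_eq_iff restrict_def strands_mult[OF a(2) bc] strands_mult[OF b(2) c(2)]
      strands_mult[OF a(2) b(2)] right_node_mult[OF a(2) b(2)])
qed

lemma rook_one_closed: "rook_one G n \<in> D"
  by (auto simp: rook_one_def rook_diagrams_def pbraid_one_eq partial_identity_closed)

lemma rook_one_mult:
  assumes "d \<in> D"
  shows "rook_mult G (rook_one G n) d = d" "rook_mult G d (rook_one G n) = d"
proof -
  obtain b x where b: "d = (b, x)" "b \<in> partial_braids n" "x \<in> strands b \<rightarrow>\<^sub>E carrier G"
    using assms by (rule rook_diagramE)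
  have s: "strands b \<subseteq> {..<n}" by (rule strands_subset[OF b(2)])
  have r: "right_node b ` strands b \<subseteq> {..<n}" using right_node_less[OF b(2)] by auto
  have id: "right_node (partial_identity {..<n}) i = i" if "i \<in> strands b" for i
    using that s by (intro partial_identity(2)[of _ n]) auto
  have x: "x i \<in> carrier G" if "i \<in> strands b" for i using b(3) that by auto
  have ext: "x i = undefined" if "i \<notin> strands b" for i using b(3) that by auto
  show "rook_mult G (rook_one G n) d = d"
    using s x ext id unfolding b(1) rook_one_def mult_diagrams pbraid_one_eq partial_identity_mult[OF b(2) order_refl s]
    by (auto simp: fun_eq_iff restrict_def subset_iff)
  show "rook_mult G d (rook_one G n) = d"
    using r x ext unfolding b(1) rook_one_def mult_diagrams pbraid_one_eq mult_partial_identity[OF b(2) order_refl r]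
    by (auto simp: fun_eq_iff restrict_def image_subset_iff)
qed

lemma isolated_eq: "isolated_middle_nodes n (b, x) (c, y) =
    {j. j < n \<and> j \<notin> right_node b ` strands b \<and> j \<notin> strands c}"
  by (auto simp: isolated_middle_nodes_def)

text \<open>Both sides count the components of the triple concatenation that meet no outer node; the
  strands of the middle factor among them are counted at either end.\<close>

lemma card_isolated:
  assumes "d1 \<in> D" "d2 \<in> D" "d3 \<in> D"
  shows "card (isolated_middle_nodes n d1 d2) + card (isolated_middle_nodes n (rook_mult G d1 d2) d3) =
    card (isolated_middle_nodes n d2 d3) + card (isolated_middle_nodes n d1 (rook_mult G d2 d3))"
proof -
  obtain a x where a: "d1 = (a, x)" "a \<in> partial_braids n" using assms(1) by (rule rook_diagramE)
  obtain b y where b: "d2 = (b, y)" "b \<in> partial_braids n" using assms(2) by (rule rook_diagramE)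
  obtain c z where c: "d3 = (c, z)" "c \<in> partial_braids n" using assms(3) by (rule rook_diagramE)
  \<comment> \<open>The strands of the middle diagram attached to neither outer diagram, named by
    their left ends; \<open>right_node b\<close> carries them to their right ends.\<close>
  let ?X = "{i \<in> strands b. i \<notin> right_node a ` strands a \<and> right_node b i \<notin> strands c}"
  have inj: "inj_on (right_node b) (strands b)" by (rule right_node_inj[OF b(2)])
  have fin: "finite (isolated_middle_nodes n d d')" for d d' :: "'g rook_diagram"
    by (cases d; cases d') (simp add: isolated_eq)
  have finX: "finite ?X" using finite_strands[OF b(2)] by simp
  have R: "right_node (pbraid_mult a b) ` strands (pbraid_mult a b) =
      right_node b ` (right_node a ` strands a \<inter> strands b)"
    by (force simp: strands_mult[OF a(2) b(2)] right_node_mult[OF a(2) b(2)])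
  have "isolated_middle_nodes n (rook_mult G d1 d2) d3 =
      isolated_middle_nodes n d2 d3 \<union> right_node b ` ?X"
    unfolding a b c mult_diagrams isolated_eq R using inj right_node_less[OF b(2)] by (auto simp: inj_on_def)
  moreover have "isolated_middle_nodes n d2 d3 \<inter> right_node b ` ?X = {}"
    unfolding b c isolated_eq by auto
  ultimately have 1: "card (isolated_middle_nodes n (rook_mult G d1 d2) d3) =
      card (isolated_middle_nodes n d2 d3) + card ?X"
    using fin finX inj by (simp add: card_Un_disjoint card_image inj_on_subset)
  have "isolated_middle_nodes n d1 (rook_mult G d2 d3) = isolated_middle_nodes n d1 d2 \<union> ?X"
    unfolding a b c mult_diagrams isolated_eq
    using strands_subset[OF b(2)] by (auto simp: strands_mult[OF b(2) c(2)])
  moreover have "isolated_middle_nodes n d1 d2 \<inter> ?X = {}"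
    unfolding a b isolated_eq by auto
  ultimately have 2: "card (isolated_middle_nodes n d1 (rook_mult G d2 d3)) =
      card (isolated_middle_nodes n d1 d2) + card ?X"
    using fin finX by (simp add: card_Un_disjoint)
  show ?thesis using 1 2 by simp
qed

lemma fullE:
  assumes "d \<in> U"
  obtains b x where "d = (b, x)" "b \<in> partial_braids n" "strands b = {..<n}" "x \<in> {..<n} \<rightarrow>\<^sub>E carrier G"
  using assms by (auto simp: full_diagrams_def rook_diagrams_def)

lemma full_image:
  assumes "b \<in> partial_braids n" "strands b = {..<n}"
  shows "right_node b ` {..<n} = {..<n}"
proof (rule endo_inj_surj)
  show "right_node b ` {..<n} \<subseteq> {..<n}" using right_node_less[OF assms(1)] assms(2) by auto
  show "inj_on (right_node b) {..<n}" using right_node_inj[OF assms(1)] assms(2) by simp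
qed simp

lemma full_iff: "d \<in> D \<Longrightarrow> d \<in> U \<longleftrightarrow> strands (fst d) = {..<n}"
  by (cases d) (simp add: full_diagrams_def)

text \<open>If the product has all strands, so has the first factor; then
  \<open>right_node b\<close> permutes the finitely many nodes, and no strand of the second factor
  can be missing.\<close>

lemma full_mult_iff:
  assumes "d \<in> D" "d' \<in> D"
  shows "rook_mult G d d' \<in> U \<longleftrightarrow> d \<in> U \<and> d' \<in> U"
proof -
  obtain b x where b: "d = (b, x)" "b \<in> partial_braids n" using assms(1) by (rule rook_diagramE)
  obtain c y where c: "d' = (c, y)" "c \<in> partial_braids n" using assms(2) by (rule rook_diagramE)
  have K: "{i \<in> strands b. right_node b i \<in> strands c} = {..<n} \<longleftrightarrow> strands b = {..<n} \<and> strands c = {..<n}"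
    (is "?K = _ \<longleftrightarrow> _")
  proof
    assume K: "?K = {..<n}"
    then have sb: "strands b = {..<n}" using strands_subset[OF b(2)] by auto
    have "right_node b ` {..<n} \<subseteq> strands c" using K by auto
    then have "{..<n} \<subseteq> strands c" using full_image[OF b(2) sb] by simp
    then show "strands b = {..<n} \<and> strands c = {..<n}" using sb strands_subset[OF c(2)] by auto
  next
    assume "strands b = {..<n} \<and> strands c = {..<n}"
    then show "?K = {..<n}" using right_node_less[OF b(2)] by auto
  qed
  show ?thesis
    unfolding full_iff[OF rook_mult_closed[OF assms]] full_iff[OF assms(1)] full_iff[OF assms(2)]
    unfolding b(1) c(1) mult_diagrams fst_conv strands_mult[OF b(2) c(2)] K ..
qed

lemma weight_full: "d \<in> U \<Longrightarrow> d' \<in> U \<Longrightarrow> w d d' = \<one>\<^bsub>k\<^esub>"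
proof -
  assume "d \<in> U" "d' \<in> U"
  then obtain b x c y where b: "d = (b, x)" "b \<in> partial_braids n" "strands b = {..<n}"
    and c: "d' = (c, y)" "strands c = {..<n}"
    by (elim fullE)
  have "isolated_middle_nodes n d d' = {}"
    unfolding b(1) c(1) isolated_eq c(2) by simp
  then show ?thesis by simp
qed

text \<open>The cocycle identity is \<open>card_isolated\<close> read in the exponents of
  \<open>\<epsilon>\<close>. The identity diagram leaves no node unattached, whence its weights are
  one.\<close>

lemma rook_twisted: "twisted_monoid k D (rook_mult G) w (rook_one G n)"
proof (rule twisted_monoid.intro)
  show "cring k" by (rule k.is_cring)
  show "w d1 d2 \<otimes>\<^bsub>k\<^esub> w (rook_mult G d1 d2) d3 = w d2 d3 \<otimes>\<^bsub>k\<^esub> w d1 (rook_mult G d2 d3)"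
    if "d1 \<in> D" "d2 \<in> D" "d3 \<in> D" for d1 d2 d3
    using card_isolated[OF that] by (simp add: k.nat_pow_mult)
  show "w (rook_one G n) d = \<one>\<^bsub>k\<^esub>" for d
  proof -
    have "right_node (partial_identity {..<n}) ` {..<n} = {..<n}"
      using partial_identity(2)[of "{..<n}" n] by force
    then have "isolated_middle_nodes n (rook_one G n) d = {}"
      by (cases d) (auto simp: rook_one_def pbraid_one_eq isolated_eq)
    then show ?thesis by simp
  qed
  show "w d (rook_one G n) = \<one>\<^bsub>k\<^esub>" for d
  proof -
    have "isolated_middle_nodes n d (rook_one G n) = {}"
      by (cases d) (auto simp: rook_one_def pbraid_one_eq isolated_eq)
    then show ?thesis by simp
  qed
qed (simp_all add: rook_mult_closed rook_mult_assoc rook_one_closed rook_one_mult)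

section \<open>Diagrams with one strand omitted\<close>

definition omit :: "nat \<Rightarrow> 'g rook_diagram" where
  "omit m = (partial_identity ({..<n} - {m}), \<lambda>i\<in>{..<n} - {m}. \<one>\<^bsub>G\<^esub>)"

lemma omit: "omit m \<in> D" "m < n \<Longrightarrow> omit m \<notin> U"
  by (auto simp: omit_def rook_diagrams_def full_diagrams_def partial_identity_closed)

definition right_nodes :: "'g rook_diagram \<Rightarrow> nat set" where
  "right_nodes d = right_node (fst d) ` strands (fst d)"

text \<open>\<open>omit m\<close> misses the node \<open>m\<close> and no other, so \<open>m\<close>
  is the single isolated middle node; the weight is \<open>\<epsilon>\<close> to the first power and
  its inverse cancels it.\<close>

lemma mult_omit_absorb:
  assumes m: "m < n" and d: "d \<in> D" and md: "m \<notin> right_nodes d"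
  shows "rook_mult G d (omit m) = d \<and> w d (omit m) \<otimes>\<^bsub>k\<^esub> inv\<^bsub>k\<^esub> \<epsilon> = \<one>\<^bsub>k\<^esub>"
proof -
  obtain b x where b: "d = (b, x)" "b \<in> partial_braids n" "x \<in> strands b \<rightarrow>\<^sub>E carrier G"
    using d by (rule rook_diagramE)
  have r: "right_node b ` strands b \<subseteq> {..<n} - {m}"
    using right_node_less[OF b(2)] md by (auto simp: right_nodes_def b(1))
  have x: "x i \<in> carrier G" if "i \<in> strands b" for i using b(3) that by auto
  have ext: "x i = undefined" if "i \<notin> strands b" for i using b(3) that by auto
  have "rook_mult G d (omit m) = d"
    using r x ext unfolding b(1) omit_def mult_diagrams mult_partial_identity[OF b(2) Diff_subset r]
    by (auto simp: fun_eq_iff restrict_def image_subset_iff)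
  moreover have "isolated_middle_nodes n d (omit m) = {m}"
    using m md by (auto simp: b(1) omit_def isolated_eq right_nodes_def)
  ultimately show ?thesis using \<epsilon> by simp
qed

lemma right_nodes_mult_omit:
  assumes d: "d \<in> D"
  shows "right_nodes (rook_mult G d (omit m)) \<subseteq> right_nodes d"
proof -
  obtain b x where b: "d = (b, x)" "b \<in> partial_braids n" using d by (rule rook_diagramE)
  have J: "{..<n} - {m} \<subseteq> {..<n}" by auto
  note c = partial_identity_closed[OF J]
  have "right_node (pbraid_mult b (partial_identity ({..<n} - {m}))) i = right_node b i"
    if "i \<in> strands b" "right_node b i \<in> {..<n} - {m}" for i
    using that right_node_mult[OF b(2) c, of i] by (simp add: partial_identity(2)[OF J])
  then show ?thesis
    unfolding b(1) omit_def mult_diagrams right_nodes_def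
    by (auto simp: strands_mult[OF b(2) c])
qed

text \<open>A diagram uses as many right nodes as it has strands, so missing a strand means missing
  a right node.\<close>

lemma not_full_misses:
  assumes d: "d \<in> D" "d \<notin> U"
  shows "\<exists>j<n. j \<notin> right_nodes d"
proof (rule ccontr)
  assume "\<not> (\<exists>j<n. j \<notin> right_nodes d)"
  then have sub: "{..<n} \<subseteq> right_nodes d" by auto
  obtain b x where b: "d = (b, x)" "b \<in> partial_braids n" using d(1) by (rule rook_diagramE)
  have "card {..<n} \<le> card (right_nodes d)"
    using finite_strands[OF b(2)] sub by (intro card_mono) (simp_all add: right_nodes_def b(1))
  also have "\<dots> = card (strands b)"
    using card_image[OF right_node_inj[OF b(2)]] by (simp add: right_nodes_def b(1))
  finally have "strands b = {..<n}"
    using strands_subset[OF b(2)] by (intro card_seteq) auto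
  then show False using d(2) unfolding full_iff[OF d(1)] unfolding b(1) by simp
qed

section \<open>The semidirect product as the monoid of full diagrams\<close>

lemma wreath_carrier: "carrier \<Gamma> = ({..<n} \<rightarrow>\<^sub>E carrier G) \<times> {b \<in> partial_braids n. strands b = {..<n}}"
  by (simp add: wreath_braid_group_def semidirect_product_def product_group_def braid_group_def)

text \<open>Elements of the semidirect product carry the labels first, diagrams the braid
  first.\<close>

lemma swap_bij: "bij_betw prod.swap (carrier \<Gamma>) U"
proof (rule bij_betw_imageI)
  show "prod.swap ` carrier \<Gamma> = U"
    unfolding wreath_carrier full_diagrams_def rook_diagrams_def by force
qed simp

lemma swap_mult:
  assumes "g \<in> carrier \<Gamma>" "h \<in> carrier \<Gamma>"
  shows "prod.swap (g \<otimes>\<^bsub>\<Gamma>\<^esub> h) = rook_mult G (prod.swap g) (prod.swap h)"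
proof -
  obtain x b where g: "g = (x, b)" "b \<in> partial_braids n" "strands b = {..<n}"
    using assms(1) by (auto simp: wreath_carrier)
  obtain y c where h: "h = (y, c)" "c \<in> partial_braids n" "strands c = {..<n}"
    using assms(2) by (auto simp: wreath_carrier)
  have "strands (pbraid_mult b c) = {..<n}"
    using right_node_less[OF g(2)] by (auto simp: strands_mult[OF g(2) h(2)] g(3) h(3))
  then show ?thesis
    by (auto simp: g(1) h(1) mult_diagrams wreath_braid_group_def semidirect_product_def
      product_group_def braid_group_def permute_factors_def fun_eq_iff restrict_def)
qed

lemma swap_one: "prod.swap \<one>\<^bsub>\<Gamma>\<^esub> = rook_one G n"
  by (simp add: wreath_braid_group_def semidirect_product_def product_group_def braid_group_def rook_one_def)

lemma swap_carrier: "g \<in> carrier \<Gamma> \<longleftrightarrow> prod.swap g \<in> U"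
  by (cases g) (auto simp: wreath_carrier full_diagrams_def rook_diagrams_def)

lemma full_in_D: "U \<subseteq> D"
  by (auto simp: full_diagrams_def)

lemma rook_one_full: "rook_one G n \<in> U"
  unfolding full_iff[OF rook_one_closed] by (simp add: rook_one_def pbraid_one_eq)

text \<open>The laws are inherited from diagrams along \<open>prod.swap\<close>, which is injective
  and multiplicative; the braid group and its action on labels are not treated separately.\<close>

lemma monoid_wreath: "monoid \<Gamma>"
proof (rule monoidI)
  have D: "prod.swap g \<in> D" if "g \<in> carrier \<Gamma>" for g using that swap_carrier full_in_D by auto
  show one: "\<one>\<^bsub>\<Gamma>\<^esub> \<in> carrier \<Gamma>" unfolding swap_carrier swap_one by (rule rook_one_full)
  show cl: "g \<otimes>\<^bsub>\<Gamma>\<^esub> h \<in> carrier \<Gamma>" if "g \<in> carrier \<Gamma>" "h \<in> carrier \<Gamma>" for g h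
    unfolding swap_carrier swap_mult[OF that] full_mult_iff[OF D[OF that(1)] D[OF that(2)]]
    using that by (simp add: swap_carrier)
  have inj: "g = h" if "prod.swap g = prod.swap h" for g h :: "(nat \<Rightarrow> 'g) \<times> pbraid"
    using that by (cases g; cases h) simp
  show "(g \<otimes>\<^bsub>\<Gamma>\<^esub> h) \<otimes>\<^bsub>\<Gamma>\<^esub> l = g \<otimes>\<^bsub>\<Gamma>\<^esub> (h \<otimes>\<^bsub>\<Gamma>\<^esub> l)"
    if "g \<in> carrier \<Gamma>" "h \<in> carrier \<Gamma>" "l \<in> carrier \<Gamma>" for g h l
    by (rule inj) (simp only: swap_mult cl that rook_mult_assoc[OF D D D])
  show "\<one>\<^bsub>\<Gamma>\<^esub> \<otimes>\<^bsub>\<Gamma>\<^esub> g = g" if "g \<in> carrier \<Gamma>" for g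
    by (rule inj) (simp only: swap_mult[OF one that] swap_one rook_one_mult[OF D[OF that]])
  show "g \<otimes>\<^bsub>\<Gamma>\<^esub> \<one>\<^bsub>\<Gamma>\<^esub> = g" if "g \<in> carrier \<Gamma>" for g
    by (rule inj) (simp only: swap_mult[OF that one] swap_one rook_one_mult[OF D[OF that]])
qed

lemma monoid_algebra_wreath: "monoid_algebra k \<Gamma>"
  by (intro monoid_algebra.intro monoid_algebra_axioms.intro monoid_wreath k.is_cring)

lemma rook_split: "\<exists>f. split_algebra k \<Gamma> D (rook_mult G) w (rook_one G n) U prod.swap f"
proof -
  interpret tw: twisted_monoid k D "rook_mult G" w "rook_one G n" by (rule rook_twisted)
  have "\<exists>f\<in>fin_supp k D. (\<forall>x\<in>U. f x = (if x = rook_one G n then \<one>\<^bsub>k\<^esub> else \<zero>\<^bsub>k\<^esub>)) \<and>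
    (\<forall>a\<in>fin_supp k D. (\<forall>u\<in>U. a u = \<zero>\<^bsub>k\<^esub>) \<longrightarrow> a \<otimes>\<^bsub>tw.A\<^esub> f = (\<lambda>_. \<zero>\<^bsub>k\<^esub>))"
  \<comment> \<open>Nodes on the right index the factors: \<open>omit m\<close> absorbs a diagram
    exactly up to the weight \<open>\<epsilon>\<close>, so the scalar \<open>\<delta>\<close> has to
    be its inverse.\<close>
  proof (rule tw.annihilator[where E = omit and R = right_nodes and \<delta> = "inv\<^bsub>k\<^esub> \<epsilon>" and n = n])
    show "inv\<^bsub>k\<^esub> \<epsilon> \<in> carrier k" using \<epsilon> by (rule k.Units_inv_closed)
  qed ((rule full_in_D full_mult_iff omit mult_omit_absorb right_nodes_mult_omit not_full_misses; assumption)+)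
  then obtain f where f: "f \<in> fin_supp k D"
    and fU: "\<And>x. x \<in> U \<Longrightarrow> f x = (if x = rook_one G n then \<one>\<^bsub>k\<^esub> else \<zero>\<^bsub>k\<^esub>)"
    and kill: "\<And>a. a \<in> fin_supp k D \<Longrightarrow> (\<And>u. u \<in> U \<Longrightarrow> a u = \<zero>\<^bsub>k\<^esub>) \<Longrightarrow> a \<otimes>\<^bsub>tw.A\<^esub> f = (\<lambda>_. \<zero>\<^bsub>k\<^esub>)"
    by blast
  have "split_algebra k \<Gamma> D (rook_mult G) w (rook_one G n) U prod.swap f"
  proof (intro split_algebra.intro split_algebra_axioms.intro monoid_algebra_wreath rook_twisted)
    show "a \<otimes>\<^bsub>tw.A\<^esub> f = \<zero>\<^bsub>tw.A\<^esub>" if "a \<in> fin_supp k D" "\<And>u. u \<in> U \<Longrightarrow> a u = \<zero>\<^bsub>k\<^esub>" for a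
      unfolding tw.A_simps by (rule kill[OF that])
  qed (fact full_in_D full_mult_iff weight_full swap_bij swap_mult swap_one f fU)+
  then show ?thesis by blast
qed

end

lemma (in monoid_algebra) group_split:
  "split_algebra k \<Gamma> (carrier \<Gamma>) (\<otimes>\<^bsub>\<Gamma>\<^esub>) (\<lambda>_ _. \<one>\<^bsub>k\<^esub>) \<one>\<^bsub>\<Gamma>\<^esub> (carrier \<Gamma>) id (single k \<one>\<^bsub>\<Gamma>\<^esub> \<one>\<^bsub>k\<^esub>)"
proof (intro split_algebra.intro split_algebra_axioms.intro)
  show "monoid_algebra k \<Gamma>" by (rule monoid_algebra_axioms)
  show "twisted_monoid k (carrier \<Gamma>) (\<otimes>\<^bsub>\<Gamma>\<^esub>) (\<lambda>_ _. \<one>\<^bsub>k\<^esub>) \<one>\<^bsub>\<Gamma>\<^esub>" by (rule B.twisted_monoid_axioms)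
  show "single k \<one>\<^bsub>\<Gamma>\<^esub> \<one>\<^bsub>k\<^esub> \<in> fin_supp k (carrier \<Gamma>)"
    by (rule k.fin_supp_single[OF H.one_closed k.one_closed])
  show "a \<otimes>\<^bsub>B\<^esub> single k \<one>\<^bsub>\<Gamma>\<^esub> \<one>\<^bsub>k\<^esub> = \<zero>\<^bsub>B\<^esub>"
    if a: "a \<in> fin_supp k (carrier \<Gamma>)" and z: "\<And>u. u \<in> carrier \<Gamma> \<Longrightarrow> a u = \<zero>\<^bsub>k\<^esub>" for a
  proof -
    \<comment> \<open>Here \<open>U\<close> is the whole basis, so only the zero element has to be
      annihilated.\<close>
    have "a = (\<lambda>_. \<zero>\<^bsub>k\<^esub>)" using z fin_supp_outside[OF a] by (intro ext) blast
    then show ?thesis unfolding B.one_mult(2)[OF a] B.A_simps .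
  qed
  show "bij_betw id (carrier \<Gamma>) (carrier \<Gamma>)" by simp
qed (simp_all only: H.m_closed order_refl id_apply single_def simp_thms)

theorem theorem7p8:
  fixes G :: "('g, 'y) monoid_scheme" and k :: "('k, 'z) ring_scheme"
    and \<phi> :: "'g \<Rightarrow> 'k \<Rightarrow> 'k" and n :: nat and \<epsilon> :: 'k
  assumes "group G" and "comm_G_ring G k \<phi>" and "\<epsilon> \<in> Units k"
  shows "let A = braided_rook_algebra G k n \<epsilon>; \<Gamma> = wreath_braid_group G n in
     graded_isomorphic k
       (Tor k A (rook_trivial G k n) (rook_trivial G k n))
       (Tor k (group_algebra k \<Gamma>) (group_trivial k \<Gamma>) (group_trivial k \<Gamma>)) \<and>
     graded_isomorphic k
       (Tor k (group_algebra k \<Gamma>) (group_trivial k \<Gamma>) (group_trivial k \<Gamma>))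
       (group_homology k \<Gamma>)"
proof -
  have "cring k" using assms(2) by (simp add: comm_G_ring_def)
  then interpret rook_setup G k n \<epsilon>
    using assms by (intro rook_setup.intro rook_setup_axioms.intro)
  let ?A = "braided_rook_algebra G k n \<epsilon>" and ?M = "rook_trivial G k n"
    and ?B = "group_algebra k \<Gamma>" and ?N = "group_trivial k \<Gamma>"
  obtain f where "split_algebra k \<Gamma> D (rook_mult G) w (rook_one G n) U prod.swap f"
    using rook_split by blast
  from split_algebra.Tor_group_homology[OF this]
  have 1: "graded_isomorphic k (Tor k ?A ?M ?M) (group_homology k \<Gamma>)"
    by (simp only: braided_rook_algebra_def rook_trivial_def)
  note split = monoid_algebra.group_split[OF monoid_algebra_wreath]
  have 2: "graded_isomorphic k (Tor k ?B ?N ?N) (group_homology k \<Gamma>)"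
    using split_algebra.Tor_group_homology[OF split] by (simp only: group_algebra_def group_trivial_def)
  have 3: "module k (Tor k ?B ?N ?N i)" for i
    using split_algebra.Tor_iso(2)[OF split] by (simp only: group_algebra_def group_trivial_def)
  \<comment> \<open>Both \<open>Tor\<close> modules are compared with group homology; reversing the
    second comparison requires that its source consists of modules.\<close>
  from graded_isomorphic_trans[OF 1 graded_isomorphic_sym[OF 3 2]] 2
  show ?thesis by (simp only: Let_def simp_thms)
qed

end
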